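(* Let $N\in\mathbb N$, $\tau\in(0,1/2)$, $\delta=\tau N$, $\lambda\ge 0$, $L=N(1+\lambda)$, $m\in\mathbb N\setminus\{1\}$, and $f\in\mathcal B_\delta(\mathbb R)$. Assume that $$\frac{\tau}{1+\lambda}<\frac12-\frac1\pi.$$ Let $s=\left\lceil\frac{m+1}{2}\right\rceil$ and let $R_{\mathrm B,m}f$ be the regularized Shannon sampling formula with localized sampling for the B-spline window function $\varphi_{\mathrm B}(x)=\frac{1}{M_{2s}(0)}M_{2s}\big(\frac{Lxs}{m}\big)$. Then $$\|f-R_{\mathrm B,m}f\|_{C_0(\mathbb R)}\le\frac{3\sqrt{\delta s}}{(2s-1)\,\pi}\;\mathrm e^{-m\left(\ln(\pi m(1+\lambda-2\tau))-\ln(2s(1+\lambda))\right)}\;\|f\|_{L^2(\mathbb R)}.$$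
   Context: Fourier transform: $\hat f(v)=\int_{\mathbb R}f(t)\,\mathrm e^{-2\pi\mathrm i tv}\,\mathrm dt$ (extended to $L^2(\mathbb R)$ by Plancherel). $\mathrm{sinc}\,x=\frac{\sin x}{x}$ for $x\ne0$ and $\mathrm{sinc}\,0=1$. $\|g\|_{C_0(\mathbb R)}:=\max_{t\in\mathbb R}|g(t)|$. Paley--Wiener space: $\mathcal B_\delta(\mathbb R)=\{f\in L^2(\mathbb R):\ \mathrm{supp}\,\hat f\subseteq[-\delta,\delta]\}$; each element is identified with its smooth representative, so point values make sense. $M_{2s}$ denotes the centered cardinal B-spline of even order $2s$, i.e. the $2s$-fold convolution of the indicator function of $[-\frac12,\frac12]$ with itself (so $M_{2s}$ is supported on $[-s,s]$), with Fourier transform $v\mapsto(\mathrm{sinc}(\pi v))^{2s}$. The regularized Shannon sampling formula with localized sampling for the B-spline window is $$(R_{\mathrm B,m}f)(t)=\sum_{\ell\in\mathbb Z}f\big(\tfrac{\ell}{L}\big)\,\mathrm{sinc}\big(L\pi(t-\tfrac{\ell}{L})\big)\,\varphi_{\mathrm B}\big(t-\tfrac{\ell}{L}\big)\,\mathbf 1_{[-m/L,m/L]}\big(t-\tfrac{\ell}{L}\big),\quad t\in\mathbb R,$$ where $\mathbf 1_{[-m/L,m/L]}$ is the indicator function of $[-m/L,m/L]$. *)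

theory Defs
  imports "HOL-Probability.Probability"
begin

section \<open>The Fourier transform on \<open>L\<^sup>2(\<real>)\<close> and the Paley--Wiener space\<close>

definition L2_space :: "(real \<Rightarrow> complex) set" where
  "L2_space = {f \<in> borel_measurable lborel. integrable lborel (\<lambda>t. (cmod (f t))\<^sup>2)}"

definition L2_norm :: "(real \<Rightarrow> complex) \<Rightarrow> real" where
  "L2_norm f = sqrt (LINT t|lborel. (cmod (f t))\<^sup>2)"

text \<open>
  The distance is measured by a nonnegative integral rather than by \<^term>\<open>L2_norm\<close>, because the
  Bochner integral of a non-integrable function is \<open>0\<close>.
\<close>

definition L2_tendsto :: "(nat \<Rightarrow> real \<Rightarrow> complex) \<Rightarrow> (real \<Rightarrow> complex) \<Rightarrow> bool" where
  "L2_tendsto h f \<longleftrightarrow>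
     (\<lambda>n. \<integral>\<^sup>+ t. ennreal ((cmod (h n t - f t))\<^sup>2) \<partial>lborel) \<longlonglongrightarrow> 0"

definition fourier :: "(real \<Rightarrow> complex) \<Rightarrow> real \<Rightarrow> complex" where
  "fourier f v = (LINT t|lborel. f t * exp (- 2 * complex_of_real pi * \<i> * of_real t * of_real v))"

text \<open>
  The extension by Plancherel's theorem: \<open>g\<close> is a representative of the Fourier transform of
  \<open>f \<in> L\<^sup>2(\<real>)\<close> if the Fourier transforms of some sequence in \<open>L\<^sup>1(\<real>) \<inter> L\<^sup>2(\<real>)\<close> converging
  to \<open>f\<close> in \<open>L\<^sup>2(\<real>)\<close> converge to \<open>g\<close> in \<open>L\<^sup>2(\<real>)\<close>. It is a relation because \<open>g\<close> is determined
  only almost everywhere.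
\<close>

definition has_L2_fourier :: "(real \<Rightarrow> complex) \<Rightarrow> (real \<Rightarrow> complex) \<Rightarrow> bool" where
  "has_L2_fourier f g \<longleftrightarrow> f \<in> L2_space \<and> g \<in> L2_space \<and>
     (\<exists>h. (\<forall>n. integrable lborel (h n) \<and> h n \<in> L2_space) \<and>
          L2_tendsto h f \<and> L2_tendsto (\<lambda>n. fourier (h n)) g)"

text \<open>The support of an almost-everywhere equivalence class of functions.\<close>

definition ess_support :: "(real \<Rightarrow> complex) \<Rightarrow> real set" where
  "ess_support g = - \<Union>{U. open U \<and> (AE v in lborel. v \<in> U \<longrightarrow> g v = 0)}"

definition smooth :: "(real \<Rightarrow> complex) \<Rightarrow> bool" where
  "smooth f \<longleftrightarrow>
     (\<exists>D. D 0 = f \<and> (\<forall>n t. (D n has_vector_derivative D (Suc n) t) (at t)))"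

text \<open>
  The elements are the smooth representatives, so that point values are meaningful.
\<close>

definition paley_wiener :: "real \<Rightarrow> (real \<Rightarrow> complex) set" where
  "paley_wiener \<delta> = {f \<in> L2_space. smooth f \<and>
     (\<exists>g. has_L2_fourier f g \<and> ess_support g \<subseteq> {-\<delta>..\<delta>})}"

section \<open>The space \<open>C\<^sub>0(\<real>)\<close>\<close>

definition C0_space :: "(real \<Rightarrow> complex) set" where
  "C0_space = {g. continuous_on UNIV g \<and> (g \<longlongrightarrow> 0) at_infinity}"

definition C0_norm :: "(real \<Rightarrow> complex) \<Rightarrow> real" where
  "C0_norm g = (GREATEST y. y \<in> range (\<lambda>t. cmod (g t)))"

section \<open>B-splines and the regularized Shannon sampling formula\<close>

definition conv :: "(real \<Rightarrow> real) \<Rightarrow> (real \<Rightarrow> real) \<Rightarrow> real \<Rightarrow> real" where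
  "conv f g x = (LINT y|lborel. f y * g (x - y))"

text \<open>
  \<open>bspline n\<close> is the centered cardinal B-spline of order \<open>n \<ge> 1\<close>, the convolution of \<open>n\<close> copies
  of the indicator function, hence \<open>n - 1\<close> convolutions.
\<close>

definition bspline :: "nat \<Rightarrow> real \<Rightarrow> real" where
  "bspline n = (conv (indicator {-1/2..1/2}) ^^ (n - 1)) (indicator {-1/2..1/2})"

definition bspline_window :: "real \<Rightarrow> nat \<Rightarrow> nat \<Rightarrow> real \<Rightarrow> real" where
  "bspline_window L m s x = bspline (2 * s) (L * x * real s / real m) / bspline (2 * s) 0"

text \<open>
  For each \<open>t\<close> only finitely many terms of the series are nonzero.
\<close>

definition regularized_shannon ::
    "real \<Rightarrow> nat \<Rightarrow> (real \<Rightarrow> real) \<Rightarrow> (real \<Rightarrow> complex) \<Rightarrow> real \<Rightarrow> complex" where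
  "regularized_shannon L m \<phi> f t =
     (\<Sum>\<^sub>\<infinity>l\<in>(UNIV :: int set).
        f (of_int l / L) *
        complex_of_real (sinc (L * pi * (t - of_int l / L)) * \<phi> (t - of_int l / L) *
          indicator {- (real m / L)..real m / L} (t - of_int l / L)))"

end

theory Submission
  imports Defs
begin

text \<open>
  A function \<open>f\<close> of the Paley--Wiener space is a superposition of exponentials,
  \<open>f t = \<integral> g v exp (2 \<pi> \<i> v t) dv\<close> with \<open>g\<close> supported in \<open>[-\<delta>, \<delta>]\<close> and \<open>\<parallel>g\<parallel> \<le> \<parallel>f\<parallel>\<close> in \<open>L\<^sup>2\<close>
  (\<open>paley_wiener_representation\<close>). The sampling operator is linear, so its error at \<open>t\<close> is the
  integral of \<open>g\<close> against the error committed on the single exponentials, and the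
  Cauchy--Schwarz inequality on \<open>[-\<delta>, \<delta>]\<close> leaves \<open>sqrt (2 \<delta>) \<parallel>f\<parallel>\<close> times the largest error on an
  exponential of frequency at most \<open>\<delta>\<close>.

  The window is a mixture of exponentials with nonnegative weights, because the Fourier
  transform of an even-order B-spline is an even power of \<open>sinc\<close>. Multiplying by the window
  therefore spreads \<open>exp (\<i> \<theta> x)\<close> into the exponentials \<open>exp (\<i> (\<theta> - a) x)\<close>, on which Shannon's
  series is exact when \<open>\<bar>\<theta> - a\<bar> < \<pi>\<close>, while for the remaining \<open>a\<close> it is off by at most \<open>2\<close>: the true
  value and the aliased one both have modulus at most \<open>1\<close>. So the error is at most twice the mass of
  the weights outside the band (\<open>sampled_exponential_bound\<close>). Since the window has bounded support,
  only finitely many samples occur and any summation method may be used for the series; Fejer means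
  make both claims elementary. For the B-spline the outside mass is a sum of two tails of
  \<open>sinc\<^sup>2\<^sup>s\<close>, which start at points \<open>X\<close> and \<open>C - X\<close> with \<open>C = \<pi> m / s\<close>.

  Replacing \<open>\<bar>sin\<bar>\<close> by \<open>1\<close> in both tails is too crude: for odd \<open>m\<close> it bounds their sum by up to twice
  the amount that the claimed constant allows. Instead (\<open>sinc_tail_pair_bound\<close>), the difference between
  that amount and the sum decreases in \<open>X\<close>, so only the symmetric position \<open>X = C / 2\<close> matters. For
  \<open>m \<ge> 3\<close> both tails then start within \<open>\<pi>/3\<close> of \<open>\<pi>\<close>, where high powers of the sine are small. The hypothesis
  \<open>\<tau> / (1 + \<lambda>) < 1/2 - 1/\<pi>\<close> enters as \<open>X > m / s\<close>, which makes the monotonicity work. In the case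
  \<open>m = 2\<close> both steps are tight: the monotonicity needs a comparison of \<open>sinc y\<close> with \<open>sinc (\<pi> - y)\<close>, and
  the tail from \<open>C / 2 = \<pi>/2\<close> a subdivision.

  Finally the window is normalized by the central value of the B-spline, which ought to be at least
  \<open>2 sqrt 2 / (3 sqrt s)\<close>. Equality holds for \<open>s = 2\<close>; for \<open>s \<ge> 3\<close> the inequality
  \<open>sinc y \<ge> 1 - y\<^sup>2/6\<close> gives this up to the factor \<open>0.976\<close>, which the tail estimate can spare
  (\<open>bspline_at_0_lower\<close>).
\<close>

section \<open>Integrability and complex exponentials\<close>

lemma integrable_pair_dominated:
  fixes F :: "real \<Rightarrow> real \<Rightarrow> complex" and f g :: "real \<Rightarrow> real"
  assumes [measurable]: "case_prod F \<in> borel_measurable (lborel \<Otimes>\<^sub>M lborel)"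
    and f: "integrable lborel f" and g: "integrable lborel g"
    and bound: "\<And>x y. norm (F x y) \<le> f x * g y"
  shows "integrable (lborel \<Otimes>\<^sub>M lborel) (case_prod F)"
proof -
  have "integrable (lborel \<Otimes>\<^sub>M lborel) (\<lambda>z. f (fst z) * g (snd z))"
  proof (rule lborel_pair.Fubini_integrable)
    have "(\<lambda>x. LBINT y. norm (f (fst (x, y)) * g (snd (x, y)))) = (\<lambda>x. \<bar>f x\<bar> * (LBINT y. \<bar>g y\<bar>))"
      by (simp add: abs_mult)
    then show "integrable lborel (\<lambda>x. LBINT y. norm (f (fst (x, y)) * g (snd (x, y))))"
      using f by simp
    show "AE x in lborel. integrable lborel (\<lambda>y. f (fst (x, y)) * g (snd (x, y)))"
      using g by simp
    show "(\<lambda>z. f (fst z) * g (snd z)) \<in> borel_measurable (lborel \<Otimes>\<^sub>M lborel)"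
      using f g by measurable
  qed
  then show ?thesis
    by (rule Bochner_Integration.integrable_bound) (use bound in \<open>auto intro!: AE_I2 order_trans[OF _ abs_ge_self]\<close>)
qed

lemma integrable_norm_le:
  fixes f :: "'a \<Rightarrow> 'b::{banach, second_countable_topology}" and g :: "'a \<Rightarrow> real"
  assumes "integrable M g" "f \<in> borel_measurable M" "\<And>x. norm (f x) \<le> g x"
  shows "integrable M f"
  by (rule Bochner_Integration.integrable_bound[OF assms(1,2)]) (use assms(3) in \<open>auto intro!: AE_I2 order_trans[OF _ abs_ge_self]\<close>)

lemma continuous_cis: "continuous_on UNIV cis"
  by (auto intro!: continuous_intros simp: cis_conv_exp)

lemma measurable_cis [measurable]: "cis \<in> borel_measurable borel"
  by (rule borel_measurable_continuous_onI[OF continuous_cis])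

lemma integrable_mult_cis:
  assumes "integrable lborel f" "p \<in> borel_measurable borel"
  shows "integrable lborel (\<lambda>x::real. f x * cis (p x))"
  by (rule integrable_norm_le[where g="\<lambda>x. norm (f x)"]) (use assms in \<open>auto simp: norm_mult\<close>)

lemma measurable_cnj [measurable]: "cnj \<in> borel_measurable borel"
  by (intro borel_measurable_continuous_onI continuous_intros)

section \<open>Gaussian regularization and Fourier inversion\<close>

lemma fourier_cis: "fourier f v = (LBINT t. f t * cis (- (2 * pi * t * v)))"
  by (simp add: fourier_def cis_conv_exp mult_ac)

text \<open>
  The factor \<open>\<sigma>\<close> is placed so that the Fourier transform of this weight is the normal density
  of standard deviation \<open>\<sigma>\<close>, which is an approximate identity as \<open>\<sigma>\<close> tends to \<open>0\<close>.
\<close>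

definition gauss_weight :: "real \<Rightarrow> real \<Rightarrow> real" where
  "gauss_weight \<sigma> v = exp (- (2 * pi * \<sigma> * v)\<^sup>2 / 2)"

lemma gauss_weight_measurable [measurable]: "gauss_weight \<sigma> \<in> borel_measurable borel"
  unfolding gauss_weight_def by measurable

lemma gauss_weight_bounds: "0 < gauss_weight \<sigma> v" "gauss_weight \<sigma> v \<le> 1"
  by (auto simp: gauss_weight_def)

lemma gauss_weight_eq:
  "gauss_weight \<sigma> v = sqrt (2 * pi) * std_normal_density (2 * pi * \<sigma> * v)"
  by (simp add: gauss_weight_def std_normal_density_def)

lemma gauss_weight_integrable:
  assumes "\<sigma> > 0"
  shows "integrable lborel (gauss_weight \<sigma>)"
proof -
  have "integrable lborel (\<lambda>v. std_normal_density (0 + (2 * pi * \<sigma>) * v))"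
    using assms by (intro lborel_integrable_real_affine) auto
  then show ?thesis
    unfolding gauss_weight_eq[abs_def] by simp
qed

text \<open>
  The characteristic function of the standard normal distribution, rescaled.
\<close>

lemma gauss_weight_fourier:
  assumes "\<sigma> > 0"
  shows "(LBINT v. gauss_weight \<sigma> v * cis (2 * pi * v * y)) = normal_density 0 \<sigma> y"
proof -
  have char: "(LBINT x. std_normal_density x *\<^sub>R cis (u * x)) = exp (- u\<^sup>2 / 2)" for u
    using fun_cong[OF char_std_normal_distribution, of u]
    by (simp add: char_def integral_density cis_conv_exp)
  have "(LBINT x. std_normal_density x *\<^sub>R cis (y / \<sigma> * x))
      = (2 * pi * \<sigma>) *\<^sub>R (LBINT v. std_normal_density (2 * pi * \<sigma> * v) *\<^sub>R cis (2 * pi * v * y))"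
    using assms
    by (subst lborel_integral_real_affine[where c="2 * pi * \<sigma>" and t=0]) (auto simp: mult_ac)
  then have "(2 * pi * \<sigma>) *\<^sub>R (LBINT v. std_normal_density (2 * pi * \<sigma> * v) *\<^sub>R cis (2 * pi * v * y))
      = exp (- (y / \<sigma>)\<^sup>2 / 2)"
    using char[of "y / \<sigma>"] by (simp only:)
  then have "(LBINT v. std_normal_density (2 * pi * \<sigma> * v) *\<^sub>R cis (2 * pi * v * y))
      = of_real (exp (- (y / \<sigma>)\<^sup>2 / 2) / (2 * pi * \<sigma>))"
    using assms by (simp add: scaleR_conv_of_real field_simps)
  moreover have "(LBINT v. gauss_weight \<sigma> v * cis (2 * pi * v * y))
      = of_real (sqrt (2 * pi)) * (LBINT v. std_normal_density (2 * pi * \<sigma> * v) *\<^sub>R cis (2 * pi * v * y))"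
    by (simp add: gauss_weight_eq scaleR_conv_of_real mult.assoc)
  moreover have "sqrt (2 * pi) * (exp (- (y / \<sigma>)\<^sup>2 / 2) / (2 * pi * \<sigma>)) = normal_density 0 \<sigma> y"
  proof -
    define q where "q = sqrt (2 * pi)"
    have q: "q > 0" "sqrt (2 * pi * \<sigma>\<^sup>2) = q * \<sigma>"
      using assms by (auto simp: real_sqrt_mult q_def)
    have q2: "2 * pi = q * q"
      unfolding q_def by (simp only: real_sqrt_mult_self) simp
    have "q * (exp (- (y / \<sigma>)\<^sup>2 / 2) / (2 * pi * \<sigma>)) = 1 / (q * \<sigma>) * exp (- (y / \<sigma>)\<^sup>2 / 2)"
      unfolding q2 using q(1) assms by (simp add: field_simps)
    then show ?thesis
      unfolding normal_density_def q(2) q_def[symmetric] by (simp add: power_divide)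
  qed
  ultimately show ?thesis
    by (metis of_real_mult)
qed

lemma normal_density_swap: "normal_density x \<sigma> y = normal_density y \<sigma> x"
  by (simp add: normal_density_def power2_commute)

lemma normal_density_shift: "normal_density t \<sigma> x = normal_density 0 \<sigma> (t - x)"
  by (simp add: normal_density_def power2_commute)

lemma integral_normal_density_mean:
  "\<sigma> > 0 \<Longrightarrow> (LBINT y. normal_density y \<sigma> x) = 1"
  by (subst normal_density_swap) simp

lemma integrable_normal_density_mean:
  "\<sigma> > 0 \<Longrightarrow> integrable lborel (\<lambda>y. normal_density y \<sigma> x)"
  by (subst normal_density_swap) simp

lemma fourier_measurable [measurable]:
  assumes [measurable]: "f \<in> borel_measurable borel"
  shows "fourier f \<in> borel_measurable borel"
  unfolding fourier_cis[abs_def] by measurable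

lemma norm_fourier_le: "norm (fourier h v) \<le> (LBINT t. norm (h t))"
  unfolding fourier_cis by (rule order_trans[OF integral_norm_bound]) (simp add: norm_mult)

text \<open>
  Fubini's theorem moves the Fourier transform from \<open>h\<close> to the Gaussian weight. The weight makes
  the left-hand side converge although the Fourier transform of \<open>h\<close> need not be integrable.
\<close>

lemma fourier_gauss_weight:
  fixes h :: "real \<Rightarrow> complex"
  assumes "\<sigma> > 0" and h: "integrable lborel h"
  shows "(LBINT v. fourier h v * (gauss_weight \<sigma> v * cis (2 * pi * v * t)))
       = (LBINT x. h x * normal_density t \<sigma> x)"
proof -
  note [measurable] = borel_measurable_integrable[OF h]
  let ?F = "\<lambda>x v. h x * cis (- (2 * pi * x * v)) * (gauss_weight \<sigma> v * cis (2 * pi * v * t))"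
  have "integrable (lborel \<Otimes>\<^sub>M lborel) (case_prod ?F)"
    by (rule integrable_pair_dominated[where f="\<lambda>x. norm (h x)" and g="gauss_weight \<sigma>"])
      (use h assms gauss_weight_integrable gauss_weight_bounds(1)[THEN less_imp_le] in \<open>auto simp: norm_mult\<close>)
  from lborel_pair.Fubini_integral[OF this]
  have "(LBINT v. fourier h v * (gauss_weight \<sigma> v * cis (2 * pi * v * t)))
      = (LBINT x. LBINT v. ?F x v)"
    by (simp add: fourier_cis)
  also have "\<dots> = (LBINT x. h x * (LBINT v. gauss_weight \<sigma> v * cis (2 * pi * v * (t - x))))"
  proof (rule Bochner_Integration.integral_cong[OF refl])
    fix x
    have "(LBINT v. ?F x v) = (LBINT v. h x * (gauss_weight \<sigma> v * cis (2 * pi * v * (t - x))))"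
      by (rule Bochner_Integration.integral_cong) (auto simp: cis_mult algebra_simps)
    then show "(LBINT v. ?F x v) = h x * (LBINT v. gauss_weight \<sigma> v * cis (2 * pi * v * (t - x)))"
      by simp
  qed
  finally show ?thesis
    using assms by (simp add: gauss_weight_fourier normal_density_shift[of t])
qed

lemma mult_le_mean_squares: "a * b \<le> (a\<^sup>2 + b\<^sup>2) / (2::real)"
  using sum_squares_ge_zero[of "a - b" 0] by (simp add: power2_eq_square algebra_simps)

lemma integrable_normal_mult_square:
  assumes h[measurable]: "h \<in> borel_measurable borel" and h2: "integrable lborel (\<lambda>x. (cmod (h x))\<^sup>2)"
    and "\<sigma> > 0"
  shows "integrable lborel (\<lambda>x. (cmod (h x))\<^sup>2 * normal_density t \<sigma> x)"
proof (rule integrable_norm_le[where g="\<lambda>x. (cmod (h x))\<^sup>2 * (1 / sqrt (2 * pi * \<sigma>\<^sup>2))"])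
  show "norm ((cmod (h x))\<^sup>2 * normal_density t \<sigma> x) \<le> (cmod (h x))\<^sup>2 * (1 / sqrt (2 * pi * \<sigma>\<^sup>2))" for x
    using assms(3) by (auto simp: normal_density_def abs_mult intro!: mult_left_mono divide_right_mono mult_left_le)
qed (use h2 in auto)

text \<open>
  The inequality \<open>\<parallel>h * n\<parallel> \<le> \<parallel>h\<parallel>\<close> for a probability density \<open>n\<close>, in the form of a pairing with \<open>h\<close>. It
  needs nothing but \<open>2 a b \<le> a\<^sup>2 + b\<^sup>2\<close> because the Gaussian is symmetric in its two arguments.
\<close>

lemma gauss_quadratic_form_le:
  assumes h: "integrable lborel h" and h2: "integrable lborel (\<lambda>x. (cmod (h x))\<^sup>2)" and \<sigma>: "\<sigma> > 0"
  shows "cmod (LBINT y. cnj (h y) * (LBINT x. h x * normal_density y \<sigma> x))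
       \<le> (LBINT x. (cmod (h x))\<^sup>2)"
proof -
  note [measurable] = borel_measurable_integrable[OF h]
  let ?n = "\<lambda>x y. normal_density y \<sigma> x"
  let ?S = "LBINT x. (cmod (h x))\<^sup>2"
  define F where "F x y = (cmod (h x))\<^sup>2 * ?n x y" for x y
  have nm[measurable]: "(\<lambda>(x, y). ?n x y) \<in> borel_measurable (lborel \<Otimes>\<^sub>M lborel)"
    unfolding normal_density_def by measurable
  have Fint: "integrable (lborel \<Otimes>\<^sub>M lborel) (case_prod F)"
  proof (rule lborel_pair.Fubini_integrable)
    show "case_prod F \<in> borel_measurable (lborel \<Otimes>\<^sub>M lborel)"
      unfolding F_def by measurable
    have "(\<lambda>x. LBINT y. norm (case_prod F (x, y))) = (\<lambda>x. (cmod (h x))\<^sup>2)"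
      using \<sigma> by (auto simp: F_def abs_mult integral_normal_density_mean integrable_normal_density_mean)
    then show "integrable lborel (\<lambda>x. LBINT y. norm (case_prod F (x, y)))"
      using h2 by simp
    show "AE x in lborel. integrable lborel (\<lambda>y. case_prod F (x, y))"
      using \<sigma> by (auto simp: F_def integral_normal_density_mean integrable_normal_density_mean)
  qed
  have F1: "(LBINT y. F x y) = (cmod (h x))\<^sup>2" for x
    using \<sigma> by (simp add: F_def integral_normal_density_mean integrable_normal_density_mean)
  have F2: "integrable lborel (\<lambda>x. F x y)" for y
    unfolding F_def using integrable_normal_mult_square[OF _ h2 \<sigma>] by measurable
  have F3: "integrable lborel (\<lambda>y. LBINT x. F x y)"
    using lborel_pair.integrable_snd[OF Fint] .
  have F4: "(LBINT y. LBINT x. F x y) = ?S"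
    using lborel_pair.Fubini_integral[OF Fint] F1 by simp
  have bnd: "norm (cnj (h y) * (LBINT x. h x * ?n x y)) \<le> ((cmod (h y))\<^sup>2 + (LBINT x. F x y)) / 2" for y
  proof -
    have "norm (cnj (h y) * (LBINT x. h x * ?n x y)) = norm (LBINT x. cnj (h y) * (h x * ?n x y))"
      by simp
    also have "\<dots> \<le> (LBINT x. norm (cnj (h y) * (h x * ?n x y)))"
      by (rule integral_norm_bound)
    also have "\<dots> \<le> (LBINT x. ((cmod (h y))\<^sup>2 * ?n x y + F x y) / 2)"
    proof (rule integral_mono_AE')
      show "integrable lborel (\<lambda>x. ((cmod (h y))\<^sup>2 * ?n x y + F x y) / 2)"
        using F2 \<sigma> by simp
      show "AE x in lborel. 0 \<le> ((cmod (h y))\<^sup>2 * ?n x y + F x y) / 2"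
        by (simp add: F_def)
      have "norm (cnj (h y) * (h x * ?n x y)) \<le> ((cmod (h y))\<^sup>2 * ?n x y + F x y) / 2" for x
        using mult_right_mono[OF mult_le_mean_squares[of "cmod (h y)" "cmod (h x)"], of "?n x y"]
        by (simp add: norm_mult F_def algebra_simps)
      then show "AE x in lborel. norm (cnj (h y) * (h x * ?n x y)) \<le> ((cmod (h y))\<^sup>2 * ?n x y + F x y) / 2"
        by simp
    qed
    also have "\<dots> = ((cmod (h y))\<^sup>2 + (LBINT x. F x y)) / 2"
      using F2 \<sigma> by simp
    finally show ?thesis .
  qed
  have "cmod (LBINT y. cnj (h y) * (LBINT x. h x * ?n x y))
      \<le> (LBINT y. norm (cnj (h y) * (LBINT x. h x * ?n x y)))"
    by (rule integral_norm_bound)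
  also have "\<dots> \<le> (LBINT y. ((cmod (h y))\<^sup>2 + (LBINT x. F x y)) / 2)"
  proof (rule integral_mono_AE')
    have "0 \<le> (LBINT x. F x y)" for y
      by (rule Bochner_Integration.integral_nonneg) (simp add: F_def)
    then show "AE y in lborel. 0 \<le> ((cmod (h y))\<^sup>2 + (LBINT x. F x y)) / 2"
      by (intro AE_I2) simp
  qed (use bnd F3 h2 in auto)
  also have "\<dots> = ?S"
    using F3 F4 h2 by simp
  finally show ?thesis .
qed

text \<open>
  Writing the square as the product with the conjugate and applying Fubini's theorem turns the
  weighted norm of the Fourier transform into the quadratic form of the Gaussian.
\<close>

lemma fourier_gauss_weight_norm:
  assumes h: "integrable lborel h" and h2: "integrable lborel (\<lambda>x. (cmod (h x))\<^sup>2)" and \<sigma>: "\<sigma> > 0"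
  shows "integrable lborel (\<lambda>v. (cmod (fourier h v))\<^sup>2 * gauss_weight \<sigma> v)"
    and "(LBINT v. (cmod (fourier h v))\<^sup>2 * gauss_weight \<sigma> v) \<le> (LBINT x. (cmod (h x))\<^sup>2)"
proof -
  note [measurable] = borel_measurable_integrable[OF h]
  let ?B = "LBINT t. norm (h t)"
  show int: "integrable lborel (\<lambda>v. (cmod (fourier h v))\<^sup>2 * gauss_weight \<sigma> v)"
  proof (rule integrable_norm_le[where g="\<lambda>v. ?B\<^sup>2 * gauss_weight \<sigma> v"])
    show "norm ((cmod (fourier h v))\<^sup>2 * gauss_weight \<sigma> v) \<le> ?B\<^sup>2 * gauss_weight \<sigma> v" for v
      using gauss_weight_bounds(1)[of \<sigma> v] norm_fourier_le[of h v]
      by (auto simp: abs_mult intro!: mult_right_mono power_mono)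
  qed (use gauss_weight_integrable[OF \<sigma>] in auto)
  let ?F = "\<lambda>y v. cnj (h y) * (fourier h v * (gauss_weight \<sigma> v * cis (2 * pi * v * y)))"
  have Fint: "integrable (lborel \<Otimes>\<^sub>M lborel) (case_prod ?F)"
  proof (rule integrable_pair_dominated[where f="\<lambda>x. norm (h x)" and g="\<lambda>v. ?B * gauss_weight \<sigma> v"])
    show "cmod (?F y v) \<le> cmod (h y) * (?B * gauss_weight \<sigma> v)" for y v
      using gauss_weight_bounds(1)[of \<sigma> v] norm_fourier_le[of h v]
      by (auto simp: norm_mult intro!: mult_left_mono mult_right_mono)
  qed (use h gauss_weight_integrable[OF \<sigma>] in auto)
  have "of_real (LBINT v. (cmod (fourier h v))\<^sup>2 * gauss_weight \<sigma> v)
      = (LBINT v. LBINT y. ?F y v)"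
  proof (subst integral_complex_of_real[symmetric], rule Bochner_Integration.integral_cong[OF refl])
    fix v
    have "(LBINT y. ?F y v) = (LBINT y. (fourier h v * gauss_weight \<sigma> v) * cnj (h y * cis (- (2 * pi * y * v))))"
      by (rule Bochner_Integration.integral_cong) (auto simp: cis_cnj mult_ac)
    also have "\<dots> = (fourier h v * gauss_weight \<sigma> v) * cnj (fourier h v)"
      by (simp add: fourier_cis del: complex_cnj_mult)
    also have "\<dots> = complex_of_real ((cmod (fourier h v))\<^sup>2 * gauss_weight \<sigma> v)"
      unfolding of_real_mult complex_norm_square by (simp add: mult_ac)
    finally show "complex_of_real ((cmod (fourier h v))\<^sup>2 * gauss_weight \<sigma> v) = (LBINT y. ?F y v)"
      by simp
  qed
  also have "\<dots> = (LBINT y. LBINT v. ?F y v)"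
    by (rule lborel_pair.Fubini_integral[OF Fint])
  also have "\<dots> = (LBINT y. cnj (h y) * (LBINT x. h x * normal_density y \<sigma> x))"
    by (simp add: fourier_gauss_weight[OF \<sigma> h])
  finally have "norm (complex_of_real (LBINT v. (cmod (fourier h v))\<^sup>2 * gauss_weight \<sigma> v)) \<le> (LBINT x. (cmod (h x))\<^sup>2)"
    using gauss_quadratic_form_le[OF h h2 \<sigma>] by simp
  then show "(LBINT v. (cmod (fourier h v))\<^sup>2 * gauss_weight \<sigma> v) \<le> (LBINT x. (cmod (h x))\<^sup>2)"
    by simp
qed

lemma gauss_weight_tendsto: "(\<lambda>n. gauss_weight (1 / real (Suc n)) v) \<longlonglongrightarrow> 1"
proof -
  have "(\<lambda>n. 1 / real (Suc n)) \<longlonglongrightarrow> 0"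
    using LIMSEQ_inverse_real_of_nat by (simp add: inverse_eq_divide)
  then have "(\<lambda>n. exp (- (2 * pi * (1 / real (Suc n)) * v)\<^sup>2 / 2)) \<longlonglongrightarrow> exp (- (2 * pi * 0 * v)\<^sup>2 / 2)"
    by (intro tendsto_intros) auto
  then show ?thesis
    by (simp add: gauss_weight_def)
qed

text \<open>
  The half of Plancherel's theorem that is needed below. The weights increase to \<open>1\<close>, so Fatou's
  lemma removes them from the previous estimate.
\<close>

lemma nn_integral_fourier_le:
  assumes h: "integrable lborel h" and h2: "integrable lborel (\<lambda>x. (cmod (h x))\<^sup>2)"
  shows "(\<integral>\<^sup>+v. ennreal ((cmod (fourier h v))\<^sup>2) \<partial>lborel) \<le> (\<integral>\<^sup>+x. ennreal ((cmod (h x))\<^sup>2) \<partial>lborel)"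
proof -
  note [measurable] = borel_measurable_integrable[OF h]
  let ?s = "\<lambda>n. 1 / real (Suc n)"
  let ?f = "\<lambda>n v. ennreal ((cmod (fourier h v))\<^sup>2 * gauss_weight (?s n) v)"
  have lim: "liminf (\<lambda>n. ?f n v) = ennreal ((cmod (fourier h v))\<^sup>2)" for v
  proof (rule lim_imp_Liminf)
    have "(\<lambda>n. (cmod (fourier h v))\<^sup>2 * gauss_weight (?s n) v) \<longlonglongrightarrow> (cmod (fourier h v))\<^sup>2 * 1"
      by (intro tendsto_intros gauss_weight_tendsto)
    then show "(\<lambda>n. ?f n v) \<longlonglongrightarrow> ennreal ((cmod (fourier h v))\<^sup>2)"
      by (simp only: mult_1_right tendsto_ennrealI)
  qed simp
  have "(\<integral>\<^sup>+v. ennreal ((cmod (fourier h v))\<^sup>2) \<partial>lborel) = (\<integral>\<^sup>+v. liminf (\<lambda>n. ?f n v) \<partial>lborel)"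
    by (simp only: lim)
  also have "\<dots> \<le> liminf (\<lambda>n. \<integral>\<^sup>+v. ?f n v \<partial>lborel)"
    by (rule nn_integral_liminf) measurable
  also have "\<dots> \<le> liminf (\<lambda>n. ennreal (LBINT x. (cmod (h x))\<^sup>2))"
  proof (rule Liminf_mono[OF always_eventually], rule allI)
    fix n
    have "(\<integral>\<^sup>+v. ?f n v \<partial>lborel) = ennreal (LBINT v. (cmod (fourier h v))\<^sup>2 * gauss_weight (?s n) v)"
      by (rule nn_integral_eq_integral[OF fourier_gauss_weight_norm(1)[OF h h2]])
        (auto intro!: AE_I2 mult_nonneg_nonneg less_imp_le[OF gauss_weight_bounds(1)])
    then show "(\<integral>\<^sup>+v. ?f n v \<partial>lborel) \<le> ennreal (LBINT x. (cmod (h x))\<^sup>2)"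
      using fourier_gauss_weight_norm(2)[OF h h2, of "?s n"] by (simp add: ennreal_leI)
  qed
  also have "\<dots> = ennreal (LBINT x. (cmod (h x))\<^sup>2)"
    by (simp add: Liminf_const)
  also have "\<dots> = (\<integral>\<^sup>+x. ennreal ((cmod (h x))\<^sup>2) \<partial>lborel)"
    by (rule nn_integral_eq_integral[symmetric, OF h2]) simp
  finally show ?thesis .
qed


lemma L2_spaceD:
  assumes "f \<in> L2_space"
  shows "f \<in> borel_measurable borel" "integrable lborel (\<lambda>t. (cmod (f t))\<^sup>2)"
  using assms by (auto simp: L2_space_def)

lemma L2_norm_sq: "(L2_norm f)\<^sup>2 = (LBINT t. (cmod (f t))\<^sup>2)"
  by (simp add: L2_norm_def)

lemma L2_norm_nonneg: "0 \<le> L2_norm f"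
  by (simp add: L2_norm_def)

lemma nn_integral_L2_norm:
  assumes "f \<in> L2_space"
  shows "(\<integral>\<^sup>+t. ennreal ((cmod (f t))\<^sup>2) \<partial>lborel) = ennreal ((L2_norm f)\<^sup>2)"
  unfolding L2_norm_sq by (rule nn_integral_eq_integral[OF L2_spaceD(2)[OF assms]]) simp

lemma L2_Cauchy_Schwarz:
  assumes f: "f \<in> L2_space" and g: "g \<in> L2_space"
  shows "integrable lborel (\<lambda>x. f x * g x)"
    and "(LBINT x. cmod (f x) * cmod (g x)) \<le> L2_norm f * L2_norm g"
proof -
  note [measurable] = L2_spaceD(1)[OF f] L2_spaceD(1)[OF g]
  show *: "integrable lborel (\<lambda>x. f x * g x)"
    by (rule integrable_norm_le[where g="\<lambda>x. ((cmod (f x))\<^sup>2 + (cmod (g x))\<^sup>2) / 2"])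
      (use L2_spaceD[OF f] L2_spaceD[OF g] mult_le_mean_squares in \<open>auto simp: norm_mult\<close>)
  have int: "integrable lborel (\<lambda>x. cmod (f x) * cmod (g x))"
    using integrable_norm[OF *] by (simp add: norm_mult)
  have "ennreal ((LBINT x. cmod (f x) * cmod (g x))\<^sup>2) = (\<integral>\<^sup>+x. ennreal (cmod (f x)) * ennreal (cmod (g x)) \<partial>lborel)\<^sup>2"
    by (simp add: nn_integral_eq_integral[OF int] flip: ennreal_mult ennreal_power)
  also have "\<dots> \<le> (\<integral>\<^sup>+x. ennreal (cmod (f x)) ^ 2 \<partial>lborel) * (\<integral>\<^sup>+x. ennreal (cmod (g x)) ^ 2 \<partial>lborel)"
    by (rule Cauchy_Schwarz_nn_integral) measurable
  also have "\<dots> = ennreal ((L2_norm f * L2_norm g)\<^sup>2)"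
    by (simp add: ennreal_power nn_integral_L2_norm[OF f] nn_integral_L2_norm[OF g] ennreal_mult power_mult_distrib)
  finally have "(LBINT x. cmod (f x) * cmod (g x))\<^sup>2 \<le> (L2_norm f * L2_norm g)\<^sup>2"
    by (subst (asm) ennreal_le_iff) auto
  then show "(LBINT x. cmod (f x) * cmod (g x)) \<le> L2_norm f * L2_norm g"
    by (rule power2_le_imp_le) (simp add: L2_norm_nonneg)
qed

lemma L2_space_diff:
  assumes f: "f \<in> L2_space" and g: "g \<in> L2_space"
  shows "(\<lambda>x. f x - g x) \<in> L2_space"
proof -
  note [measurable] = L2_spaceD(1)[OF f] L2_spaceD(1)[OF g]
  have le: "(cmod (f x - g x))\<^sup>2 \<le> 2 * (cmod (f x))\<^sup>2 + 2 * (cmod (g x))\<^sup>2" for x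
  proof -
    have "(cmod (f x - g x))\<^sup>2 \<le> (cmod (f x) + cmod (g x))\<^sup>2"
      by (intro power_mono norm_triangle_ineq4) auto
    also have "\<dots> \<le> 2 * (cmod (f x))\<^sup>2 + 2 * (cmod (g x))\<^sup>2"
      using mult_le_mean_squares[of "cmod (f x)" "cmod (g x)"] by (simp add: power2_sum)
    finally show ?thesis .
  qed
  have "integrable lborel (\<lambda>x. (cmod (f x - g x))\<^sup>2)"
    by (rule integrable_norm_le[where g="\<lambda>x. 2 * (cmod (f x))\<^sup>2 + 2 * (cmod (g x))\<^sup>2"])
      (use L2_spaceD[OF f] L2_spaceD[OF g] le in auto)
  then show ?thesis
    by (simp add: L2_space_def)
qed

lemma L2_tendsto_norm:
  assumes "\<And>n. h n \<in> L2_space" "f \<in> L2_space" "L2_tendsto h f"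
  shows "(\<lambda>n. L2_norm (\<lambda>x. h n x - f x)) \<longlonglongrightarrow> 0"
proof -
  have "(\<lambda>n. ennreal ((L2_norm (\<lambda>x. h n x - f x))\<^sup>2)) \<longlonglongrightarrow> ennreal 0"
    using assms(3) by (simp add: L2_tendsto_def nn_integral_L2_norm[OF L2_space_diff[OF assms(1,2)]])
  then have "(\<lambda>n. (L2_norm (\<lambda>x. h n x - f x))\<^sup>2) \<longlonglongrightarrow> 0"
    by (subst (asm) tendsto_ennreal_iff) auto
  from tendsto_real_sqrt[OF this] show ?thesis
    by (simp add: L2_norm_nonneg)
qed

lemma L2_tendsto_integral_mult:
  assumes h: "\<And>n. h n \<in> L2_space" and f: "f \<in> L2_space" and "L2_tendsto h f" and g: "g \<in> L2_space"
  shows "(\<lambda>n. LBINT x. h n x * g x) \<longlonglongrightarrow> (LBINT x. f x * g x)"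
proof (rule LIM_zero_cancel, rule Lim_null_comparison)
  show "\<forall>\<^sub>F n in sequentially. norm ((LBINT x. h n x * g x) - (LBINT x. f x * g x))
      \<le> L2_norm (\<lambda>x. h n x - f x) * L2_norm g"
  proof (rule always_eventually, rule allI)
    fix n
    have "(LBINT x. h n x * g x) - (LBINT x. f x * g x) = (LBINT x. (h n x - f x) * g x)"
      by (simp add: L2_Cauchy_Schwarz(1) h f g left_diff_distrib)
    then show "norm ((LBINT x. h n x * g x) - (LBINT x. f x * g x))
      \<le> L2_norm (\<lambda>x. h n x - f x) * L2_norm g"
      using L2_Cauchy_Schwarz(2)[OF L2_space_diff[OF h[of n] f] g]
        integral_norm_bound[of lborel "\<lambda>x. (h n x - f x) * g x"] by (simp add: norm_mult)
  qed
  show "(\<lambda>n. L2_norm (\<lambda>x. h n x - f x) * L2_norm g) \<longlonglongrightarrow> 0"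
    using tendsto_mult_right[OF L2_tendsto_norm[OF assms(1-3)], of "L2_norm g"] by simp
qed

lemma L2_norm_triangle:
  assumes f: "f \<in> L2_space" and g: "g \<in> L2_space"
  shows "L2_norm f \<le> L2_norm (\<lambda>x. f x - g x) + L2_norm g"
proof (rule power2_le_imp_le)
  let ?d = "\<lambda>x. f x - g x"
  have d: "?d \<in> L2_space" by (rule L2_space_diff[OF f g])
  have int: "integrable lborel (\<lambda>x. cmod (?d x) * cmod (g x))"
    using integrable_norm[OF L2_Cauchy_Schwarz(1)[OF d g]] by (simp add: norm_mult)
  have "(cmod (f x))\<^sup>2 \<le> (cmod (?d x))\<^sup>2 + 2 * (cmod (?d x) * cmod (g x)) + (cmod (g x))\<^sup>2" for x
    using power_mono[OF norm_triangle_ineq[of "?d x" "g x"], of 2] by (simp add: power2_sum)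
  then have "(L2_norm f)\<^sup>2 \<le> (LBINT x. (cmod (?d x))\<^sup>2 + 2 * (cmod (?d x) * cmod (g x)) + (cmod (g x))\<^sup>2)"
    unfolding L2_norm_sq by (intro integral_mono) (use int L2_spaceD[OF f] L2_spaceD[OF g] L2_spaceD[OF d] in auto)
  also have "\<dots> = (L2_norm ?d)\<^sup>2 + 2 * (LBINT x. cmod (?d x) * cmod (g x)) + (L2_norm g)\<^sup>2"
    using int L2_spaceD[OF g] L2_spaceD[OF d] by (simp add: L2_norm_sq)
  also have "\<dots> \<le> (L2_norm ?d + L2_norm g)\<^sup>2"
    using L2_Cauchy_Schwarz(2)[OF d g] by (simp add: power2_sum)
  finally show "(L2_norm f)\<^sup>2 \<le> (L2_norm ?d + L2_norm g)\<^sup>2" .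
qed (simp add: L2_norm_nonneg)

lemma fourier_L2:
  assumes h: "integrable lborel h" "h \<in> L2_space"
  shows "fourier h \<in> L2_space" "L2_norm (fourier h) \<le> L2_norm h"
proof -
  note [measurable] = L2_spaceD(1)[OF h(2)]
  have le: "(\<integral>\<^sup>+v. ennreal ((cmod (fourier h v))\<^sup>2) \<partial>lborel) \<le> ennreal ((L2_norm h)\<^sup>2)"
    using nn_integral_fourier_le[OF h(1) L2_spaceD(2)[OF h(2)]] nn_integral_L2_norm[OF h(2)] by simp
  have "integrable lborel (\<lambda>v. (cmod (fourier h v))\<^sup>2)"
    by (rule integrableI_nonneg) (use le in \<open>auto simp: le_less_trans\<close>)
  then show *: "fourier h \<in> L2_space"
    by (simp add: L2_space_def)
  have "(L2_norm (fourier h))\<^sup>2 \<le> (L2_norm h)\<^sup>2"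
    using le unfolding nn_integral_L2_norm[OF *] by (subst (asm) ennreal_le_iff) auto
  then show "L2_norm (fourier h) \<le> L2_norm h"
    by (rule power2_le_imp_le) (simp add: L2_norm_nonneg)
qed

lemma has_L2_fourier_norm_le:
  assumes "has_L2_fourier f g"
  shows "L2_norm g \<le> L2_norm f"
proof -
  from assms obtain h where f: "f \<in> L2_space" and g: "g \<in> L2_space"
    and h: "\<And>n. integrable lborel (h n)" "\<And>n. h n \<in> L2_space"
    and lim: "L2_tendsto h f" "L2_tendsto (\<lambda>n. fourier (h n)) g"
    unfolding has_L2_fourier_def by blast
  let ?d = "\<lambda>n. L2_norm (\<lambda>x. fourier (h n) x - g x)" and ?e = "\<lambda>n. L2_norm (\<lambda>x. h n x - f x)"
  have "L2_norm g \<le> ?d n + ?e n + L2_norm f" for n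
  proof -
    have "L2_norm (\<lambda>x. g x - fourier (h n) x) = ?d n"
      by (simp add: L2_norm_def norm_minus_commute)
    then show ?thesis
      using L2_norm_triangle[OF g fourier_L2(1)[OF h(1)[of n] h(2)[of n]]]
        fourier_L2(2)[OF h(1)[of n] h(2)[of n]] L2_norm_triangle[OF h(2)[of n] f] by linarith
  qed
  moreover have "(\<lambda>n. ?d n + ?e n + L2_norm f) \<longlonglongrightarrow> 0 + 0 + L2_norm f"
    by (intro tendsto_intros L2_tendsto_norm fourier_L2 h f g lim)
  ultimately have "L2_norm g \<le> 0 + 0 + L2_norm f"
    by (intro LIMSEQ_le_const) auto
  then show ?thesis by simp
qed

text \<open>
  The Gaussian identity for the extended transform: both sides are inner products with a fixed
  element of \<open>L\<^sup>2\<close>, so they pass to the limit along the approximating sequence.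
\<close>

lemma has_L2_fourier_gauss:
  fixes f g :: "real \<Rightarrow> complex"
  assumes "has_L2_fourier f g" and "\<sigma> > 0"
  shows "(LBINT v. g v * (gauss_weight \<sigma> v * cis (2 * pi * v * t))) = (LBINT x. f x * normal_density t \<sigma> x)"
proof -
  from assms obtain h where f: "f \<in> L2_space" and g: "g \<in> L2_space"
    and h: "\<And>n. integrable lborel (h n)" "\<And>n. h n \<in> L2_space"
    and lim: "L2_tendsto h f" "L2_tendsto (\<lambda>n. fourier (h n)) g"
    unfolding has_L2_fourier_def by blast
  have w: "(\<lambda>v. gauss_weight \<sigma> v * cis (2 * pi * v * t)) \<in> L2_space"
  proof -
    have "integrable lborel (\<lambda>v. (cmod (gauss_weight \<sigma> v * cis (2 * pi * v * t)))\<^sup>2)"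
    proof (rule integrable_norm_le[where g="gauss_weight \<sigma>"])
      show "norm ((cmod (gauss_weight \<sigma> v * cis (2 * pi * v * t)))\<^sup>2) \<le> gauss_weight \<sigma> v" for v
        using gauss_weight_bounds[of \<sigma> v] by (simp add: norm_mult power2_eq_square mult_left_le)
    qed (use gauss_weight_integrable[OF assms(2)] in auto)
    then show ?thesis by (simp add: L2_space_def)
  qed
  have n: "(\<lambda>x. complex_of_real (normal_density t \<sigma> x)) \<in> L2_space"
  proof -
    have "integrable lborel (\<lambda>x. (cmod (complex_of_real (normal_density t \<sigma> x)))\<^sup>2)"
    proof (rule integrable_norm_le[where g="\<lambda>x. 1 / sqrt (2 * pi * \<sigma>\<^sup>2) * normal_density t \<sigma> x"])
      have "normal_density t \<sigma> x \<le> 1 / sqrt (2 * pi * \<sigma>\<^sup>2)" for x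
        using assms(2) by (auto simp: normal_density_def divide_right_mono)
      then show "norm ((cmod (complex_of_real (normal_density t \<sigma> x)))\<^sup>2) \<le> 1 / sqrt (2 * pi * \<sigma>\<^sup>2) * normal_density t \<sigma> x" for x
        unfolding norm_of_real power2_abs real_norm_def abs_power2
        unfolding power2_eq_square by (rule mult_right_mono) simp
    qed (use assms(2) in auto)
    then show ?thesis by (simp add: L2_space_def)
  qed
  have "(LBINT v. fourier (h n) v * (gauss_weight \<sigma> v * cis (2 * pi * v * t))) = (LBINT x. h n x * normal_density t \<sigma> x)" for n
    by (rule fourier_gauss_weight[OF assms(2) h(1)])
  then have "(\<lambda>k. LBINT x. h k x * normal_density t \<sigma> x) \<longlonglongrightarrow> (LBINT v. g v * (gauss_weight \<sigma> v * cis (2 * pi * v * t)))"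
    using L2_tendsto_integral_mult[OF fourier_L2(1)[OF h] g lim(2) w] by simp
  then show ?thesis
    by (rule LIMSEQ_unique[OF _ L2_tendsto_integral_mult[OF h(2) f lim(1) n]])
qed


text \<open>
  A bound that tends to \<open>0\<close> with \<open>\<sigma>\<close>, uniformly away from the mean, from \<open>e\<^sup>-\<^sup>u \<le> 1/u\<close>.
\<close>

lemma normal_density_far_le:
  assumes "\<sigma> > 0" "\<rho> > 0" "\<rho> \<le> \<bar>x - t\<bar>"
  shows "normal_density t \<sigma> x \<le> 2 * \<sigma> / \<rho>\<^sup>2"
proof -
  define u where "u = (x - t)\<^sup>2 / (2 * \<sigma>\<^sup>2)"
  have "\<rho>\<^sup>2 \<le> (x - t)\<^sup>2"
    using power_mono[OF assms(3), of 2] assms(2) by simp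
  then have u: "u \<ge> \<rho>\<^sup>2 / (2 * \<sigma>\<^sup>2)" "\<rho>\<^sup>2 / (2 * \<sigma>\<^sup>2) > 0"
    using assms by (auto simp: u_def divide_right_mono)
  have "exp (- u) \<le> inverse u"
  proof -
    have "u \<le> exp u" "u > 0"
      using exp_ge_add_one_self[of u] u by linarith+
    then show ?thesis
      by (simp add: exp_minus le_imp_inverse_le)
  qed
  also have "\<dots> \<le> inverse (\<rho>\<^sup>2 / (2 * \<sigma>\<^sup>2))"
    using u by (intro le_imp_inverse_le)
  finally have e: "exp (- u) \<le> 2 * \<sigma>\<^sup>2 / \<rho>\<^sup>2" by simp
  have "1 / sqrt (2 * pi * \<sigma>\<^sup>2) \<le> 1 / \<sigma>"
  proof -
    have "\<sigma>\<^sup>2 \<le> 2 * pi * \<sigma>\<^sup>2"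
      using pi_gt3 by (simp add: mult_le_cancel_right1)
    from real_sqrt_le_mono[OF this] show ?thesis
      using assms by (intro divide_left_mono) (auto simp del: real_sqrt_mult)
  qed
  then have "normal_density t \<sigma> x \<le> 1 / \<sigma> * (2 * \<sigma>\<^sup>2 / \<rho>\<^sup>2)"
    unfolding normal_density_def using e assms by (intro mult_mono) (auto simp: u_def)
  then show ?thesis
    using assms by (simp add: power2_eq_square)
qed

text \<open>
  The difference \<open>f x - f t\<close> is small near \<open>t\<close> by continuity. Far from \<open>t\<close> the function is only
  square integrable; there \<open>\<bar>f\<bar> \<le> 1 + \<bar>f\<bar>\<^sup>2\<close>, the constant part is handled by the variance of the
  Gaussian and the square by its uniform smallness.
\<close>

lemma gauss_approximate_identity:
  assumes f: "f \<in> L2_space" and cont: "isCont f t"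
  shows "(\<lambda>n. LBINT x. f x * normal_density t (1 / real (Suc n)) x) \<longlonglongrightarrow> f t"
proof (rule LIMSEQ_I)
  note [measurable] = L2_spaceD(1)[OF f]
  fix r :: real assume r: "r > 0"
  then obtain \<rho> where \<rho>: "\<rho> > 0" "\<And>x. \<bar>x - t\<bar> < \<rho> \<Longrightarrow> cmod (f x - f t) < r / 2"
    using cont unfolding continuous_at_eps_delta dist_norm real_norm_def by (meson half_gt_zero)
  let ?C = "(1 + cmod (f t)) / \<rho>\<^sup>2"
  let ?N = "(L2_norm f)\<^sup>2"
  have main: "norm ((LBINT x. f x * normal_density t \<sigma> x) - f t) \<le> r / 2 + ?C * \<sigma>\<^sup>2 + 2 * \<sigma> / \<rho>\<^sup>2 * ?N"
    if \<sigma>: "\<sigma> > 0" for \<sigma>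
  proof -
    let ?n = "normal_density t \<sigma>"
    let ?G = "\<lambda>x. r / 2 * ?n x + ?C * (?n x * (x - t)\<^sup>2) + 2 * \<sigma> / \<rho>\<^sup>2 * (cmod (f x))\<^sup>2"
    have mom: "has_bochner_integral lborel (\<lambda>x. ?n x * (x - t)\<^sup>2) (\<sigma>\<^sup>2)"
    proof -
      have "fact (2 * 1) / ((2 / \<sigma>\<^sup>2) ^ 1 * fact 1) = \<sigma>\<^sup>2"
        using \<sigma> by (simp add: field_simps)
      then show ?thesis
        using normal_moment_even[OF \<sigma>, of t 1] by (simp only: mult_1_right)
    qed
    have fn: "integrable lborel (\<lambda>x. f x * ?n x)"
    proof (rule integrable_norm_le[where g="\<lambda>x. (?n x + (cmod (f x))\<^sup>2 * ?n x) / 2"])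
      show "norm (f x * ?n x) \<le> (?n x + (cmod (f x))\<^sup>2 * ?n x) / 2" for x
        using mult_right_mono[OF mult_le_mean_squares[of 1 "cmod (f x)"], of "?n x"]
        by (simp add: norm_mult algebra_simps)
    qed (use \<sigma> integrable_normal_mult_square[OF L2_spaceD[OF f] \<sigma>] in auto)
    have bnd: "norm (f x * ?n x - f t * ?n x) \<le> (?G x)" for x
    proof -
      have n0: "0 \<le> ?n x" by simp
      have eq: "norm (f x * ?n x - f t * ?n x) = cmod (f x - f t) * ?n x"
        by (simp add: norm_mult flip: left_diff_distrib)
      show ?thesis
      proof (cases "\<bar>x - t\<bar> < \<rho>")
        case True
        have "cmod (f x - f t) * ?n x \<le> r / 2 * ?n x"
          using \<rho>(2)[OF True] by (intro mult_right_mono) auto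
        moreover have "0 \<le> ?C * (?n x * (x - t)\<^sup>2)" "0 \<le> 2 * \<sigma> / \<rho>\<^sup>2 * (cmod (f x))\<^sup>2"
          using \<sigma> by auto
        ultimately show ?thesis
          unfolding eq by linarith
      next
        case False
        have "cmod (f x - f t) \<le> cmod (f x) + cmod (f t)"
          by (rule norm_triangle_ineq4)
        also have "\<dots> \<le> (1 + cmod (f t)) + (cmod (f x))\<^sup>2"
          using mult_le_mean_squares[of 1 "cmod (f x)", simplified] norm_ge_zero[of "f x"] by linarith
        finally have "cmod (f x - f t) * ?n x \<le> (1 + cmod (f t)) * ?n x + (cmod (f x))\<^sup>2 * ?n x"
          using mult_right_mono[OF _ n0, of "cmod (f x - f t)" "(1 + cmod (f t)) + (cmod (f x))\<^sup>2"]
          by (simp only: distrib_right)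
        moreover have "(cmod (f x))\<^sup>2 * ?n x \<le> (cmod (f x))\<^sup>2 * (2 * \<sigma> / \<rho>\<^sup>2)"
          using normal_density_far_le[OF \<sigma> \<rho>(1), of x t] False by (intro mult_left_mono) auto
        moreover have "(1 + cmod (f t)) * ?n x * 1 \<le> (1 + cmod (f t)) * ?n x * ((x - t)\<^sup>2 / \<rho>\<^sup>2)"
        proof (rule mult_left_mono)
          show "1 \<le> (x - t)\<^sup>2 / \<rho>\<^sup>2"
            using power_mono[of \<rho> "\<bar>x - t\<bar>" 2] \<rho>(1) False by simp
        qed simp
        moreover have "0 \<le> r / 2 * ?n x"
          using r by simp
        ultimately show ?thesis
          unfolding eq by (simp add: mult_ac)
      qed
    qed
    have ft: "integrable lborel (\<lambda>x. f t * ?n x)"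
      using \<sigma> by (intro integrable_mult_right integrable_of_real) auto
    have "(LBINT x. f t * ?n x) = f t * (LBINT x. complex_of_real (?n x))"
      by simp
    also have "\<dots> = f t"
      unfolding integral_complex_of_real using \<sigma> by simp
    finally have ftv: "(LBINT x. f t * ?n x) = f t" .
    have "norm ((LBINT x. f x * ?n x) - f t) = norm (LBINT x. f x * ?n x - f t * ?n x)"
      by (simp only: Bochner_Integration.integral_diff[OF fn ft] ftv)
    also have "\<dots> \<le> (LBINT x. norm (f x * ?n x - f t * ?n x))"
      by (rule integral_norm_bound)
    also have "\<dots> \<le> (LBINT x. (?G x))"
    proof (rule integral_mono_AE')
      show "integrable lborel (\<lambda>x. (?G x))"
        using \<sigma> L2_spaceD[OF f] mom by (intro Bochner_Integration.integrable_add integrable_mult_right) (auto simp: has_bochner_integral_iff)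
      show "AE x in lborel. norm (f x * ?n x - f t * ?n x) \<le> (?G x)"
        by (rule AE_I2) (rule bnd)
    qed (use r \<sigma> in \<open>auto intro!: AE_I2 add_nonneg_nonneg\<close>)
    also have "\<dots> = r / 2 + ?C * \<sigma>\<^sup>2 + 2 * \<sigma> / \<rho>\<^sup>2 * ?N"
    proof -
      have "has_bochner_integral lborel (\<lambda>x. (?G x))
          (r / 2 * 1 + ?C * \<sigma>\<^sup>2 + 2 * \<sigma> / \<rho>\<^sup>2 * ?N)"
        by (intro has_bochner_integral_add has_bochner_integral_mult_right mom)
          (use \<sigma> L2_spaceD[OF f] in \<open>auto simp: has_bochner_integral_iff L2_norm_sq\<close>)
      then show ?thesis
        by (simp add: has_bochner_integral_iff)
    qed
    finally show ?thesis .
  qed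
  have s0: "(\<lambda>n. 1 / real (Suc n)) \<longlonglongrightarrow> 0"
    using LIMSEQ_inverse_real_of_nat by (simp add: inverse_eq_divide)
  have "(\<lambda>n. r / 2 + ?C * (1 / real (Suc n))\<^sup>2 + 2 * (1 / real (Suc n)) / \<rho>\<^sup>2 * ?N) \<longlonglongrightarrow> r / 2 + ?C * 0\<^sup>2 + 2 * 0 / \<rho>\<^sup>2 * ?N"
    by (intro tendsto_intros s0) (use \<rho> in auto)
  then have "\<forall>\<^sub>F n in sequentially. r / 2 + ?C * (1 / real (Suc n))\<^sup>2 + 2 * (1 / real (Suc n)) / \<rho>\<^sup>2 * ?N < r"
    by (rule order_tendstoD) (use r in simp)
  then have "\<forall>\<^sub>F n in sequentially. norm ((LBINT x. f x * normal_density t (1 / real (Suc n)) x) - f t) < r"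
  proof eventually_elim
    case (elim n)
    with main[of "1 / real (Suc n)"] show ?case by simp
  qed
  then show "\<exists>no. \<forall>n\<ge>no. norm ((LBINT x. f x * normal_density t (1 / real (Suc n)) x) - f t) < r"
    by (simp add: eventually_sequentially)
qed

text \<open>
  Fourier inversion, isolated from the way in which \<open>f\<close> and \<open>g\<close> are related: the Gaussian identity is
  the only input, so that the lemma serves Paley--Wiener functions and B-splines alike.
\<close>

lemma gauss_inversion:
  fixes f g :: "real \<Rightarrow> complex"
  assumes gauss: "\<And>\<sigma>. \<sigma> > 0 \<Longrightarrow> (LBINT v. g v * (gauss_weight \<sigma> v * cis (2 * pi * v * t))) = (LBINT x. f x * normal_density t \<sigma> x)"
    and g: "integrable lborel g" and f: "f \<in> L2_space" and cont: "isCont f t"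
  shows "f t = (LBINT v. g v * cis (2 * pi * v * t))"
proof -
  note [measurable] = borel_measurable_integrable[OF g]
  have "(\<lambda>n. LBINT v. g v * (gauss_weight (1 / real (Suc n)) v * cis (2 * pi * v * t)))
      \<longlonglongrightarrow> (LBINT v. g v * cis (2 * pi * v * t))"
  proof (rule integral_dominated_convergence[where w="\<lambda>v. cmod (g v)"])
    show "AE v in lborel. (\<lambda>n. g v * (gauss_weight (1 / real (Suc n)) v * cis (2 * pi * v * t))) \<longlonglongrightarrow> g v * cis (2 * pi * v * t)"
    proof (rule AE_I2)
      fix v
      have "(\<lambda>n. g v * (of_real (gauss_weight (1 / real (Suc n)) v) * cis (2 * pi * v * t))) \<longlonglongrightarrow> g v * (of_real 1 * cis (2 * pi * v * t))"
        by (intro tendsto_intros gauss_weight_tendsto)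
      then show "(\<lambda>n. g v * (gauss_weight (1 / real (Suc n)) v * cis (2 * pi * v * t))) \<longlonglongrightarrow> g v * cis (2 * pi * v * t)"
        by simp
    qed
    show "AE v in lborel. norm (g v * (gauss_weight (1 / real (Suc n)) v * cis (2 * pi * v * t))) \<le> cmod (g v)" for n
      using gauss_weight_bounds[of "1 / real (Suc n)"] by (auto simp: norm_mult mult_left_le less_imp_le)
  qed (use g in auto)
  moreover have "(LBINT v. g v * (gauss_weight (1 / real (Suc n)) v * cis (2 * pi * v * t)))
      = (LBINT x. f x * normal_density t (1 / real (Suc n)) x)" for n
    by (rule gauss) simp
  ultimately have "(\<lambda>n. LBINT x. f x * normal_density t (1 / real (Suc n)) x) \<longlonglongrightarrow> (LBINT v. g v * cis (2 * pi * v * t))"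
    by simp
  then show ?thesis
    by (rule LIMSEQ_unique[OF gauss_approximate_identity[OF f cont]])
qed

section \<open>Fejer means and sampled exponentials\<close>

text \<open>
  The Fejer means of the \<open>2\<pi>\<close>-periodic function that equals \<open>b \<mapsto> e\<^sup>i\<^sup>b\<^sup>x\<close> on \<open>(-\<pi>, \<pi>)\<close>; its Fourier
  coefficients are the values \<open>sinc (\<pi> (x - l))\<close>. The Cesaro average over partial sums is written as
  a double sum over \<open>j, k < n\<close> with \<open>l = j - k\<close>, which makes the positivity of the kernel visible.
\<close>

definition fejer_mean :: "real \<Rightarrow> nat \<Rightarrow> real \<Rightarrow> complex" where
  "fejer_mean x n b = (\<Sum>j<n. \<Sum>k<n. of_real (sinc (pi * (x - (real j - real k)))) * cis ((real j - real k) * b)) / of_nat n"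

definition fejer_kernel :: "nat \<Rightarrow> real \<Rightarrow> real" where
  "fejer_kernel n b = (cmod (\<Sum>k<n. cis (real k * b)))\<^sup>2 / real n"

lemma fejer_kernel_nonneg: "0 \<le> fejer_kernel n b"
  by (simp add: fejer_kernel_def)

lemma fejer_kernel_eq_sum:
  "of_real (fejer_kernel n b) = (\<Sum>j<n. \<Sum>k<n. cis ((real j - real k) * b)) / of_nat n"
proof -
  have "of_real ((cmod (\<Sum>k<n. cis (real k * b)))\<^sup>2) = (\<Sum>j<n. cis (real j * b)) * (\<Sum>k<n. cnj (cis (real k * b)))"
    by (simp only: complex_norm_square cnj_sum)
  also have "\<dots> = (\<Sum>j<n. \<Sum>k<n. cis ((real j - real k) * b))"
    by (simp add: sum_product cis_cnj cis_mult algebra_simps)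
  finally show ?thesis
    by (simp add: fejer_kernel_def)
qed

lemma fejer_kernel_measurable [measurable]: "fejer_kernel n \<in> borel_measurable borel"
  unfolding fejer_kernel_def by measurable

text \<open>
  The geometric sum in the kernel telescopes when multiplied by \<open>1 - e\<^sup>i\<^sup>b\<close>, and
  \<open>\<bar>1 - e\<^sup>i\<^sup>b\<bar>\<^sup>2 = 2 (1 - cos b)\<close>. The estimate says that the kernel concentrates at the zeros of \<open>1 - cos\<close>.
\<close>

lemma fejer_kernel_cos_le: "fejer_kernel n b * (1 - cos b) \<le> 2 / real n"
proof (cases "n = 0")
  case False
  define S where "S = (\<Sum>k<n. cis (real k * b))"
  have "(1 - cis b) * S = 1 - cis (real n * b)"
    using one_diff_power_eq[of "cis b" n] by (simp add: S_def Complex.DeMoivre)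
  then have "(cmod (1 - cis b))\<^sup>2 * (cmod S)\<^sup>2 = (cmod (1 - cis (real n * b)))\<^sup>2"
    by (metis norm_mult power_mult_distrib)
  also have "\<dots> \<le> 2\<^sup>2"
    using norm_triangle_ineq4[of 1 "cis (real n * b)"] by (intro power_mono) auto
  also have "(cmod (1 - cis b))\<^sup>2 = 2 * (1 - cos b)"
    unfolding cmod_power2 using sin_cos_squared_add[of b] by (simp add: power2_eq_square algebra_simps)
  finally have "2 * ((1 - cos b) * (cmod S)\<^sup>2) \<le> 2 * 2"
    by (simp add: algebra_simps)
  then have "(1 - cos b) * (cmod S)\<^sup>2 \<le> 2"
    by linarith
  then have "(1 - cos b) * (cmod S)\<^sup>2 / real n \<le> 2 / real n"
    by (rule divide_right_mono) simp
  then show ?thesis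
    by (simp add: fejer_kernel_def S_def mult.commute)
qed (simp add: fejer_kernel_def)

lemma has_bochner_integral_cis:
  "has_bochner_integral lborel (\<lambda>a. indicator {-pi..pi} a *\<^sub>R cis (a * y)) (of_real (2 * pi * sinc (pi * y)))"
proof (cases "y = 0")
  case True
  have "has_bochner_integral lborel (\<lambda>a. indicator {-pi..pi} a *\<^sub>R (1::complex)) (of_real (pi - (-pi)))"
    using has_bochner_integral_FTC_Icc[of "-pi" pi "\<lambda>a. of_real a :: complex" "\<lambda>_. 1"]
    by (auto intro!: derivative_eq_intros continuous_intros simp: has_vector_derivative_def has_derivative_of_real scaleR_conv_of_real)
  with True show ?thesis by simp
next
  case False
  define F where "F a = cis (a * y) / (\<i> * of_real y)" for a
  have "has_bochner_integral lborel (\<lambda>a. indicator {-pi..pi} a *\<^sub>R cis (a * y)) (F pi - F (-pi))"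
  proof (rule has_bochner_integral_FTC_Icc)
    show "(F has_vector_derivative cis (x * y)) (at x within {- pi..pi})" for x
      unfolding F_def cis_conv_exp using False
      by (auto intro!: derivative_eq_intros has_vector_derivative_real_field simp: field_simps)
    show "continuous_on {- pi..pi} (\<lambda>x. cis (x * y))"
      by (auto intro!: continuous_intros simp: cis_conv_exp)
  qed simp
  moreover have "F pi - F (-pi) = of_real (2 * pi * sinc (pi * y))"
    using False by (auto simp: F_def complex_eq_iff Re_divide Im_divide field_simps power2_eq_square)
  ultimately show ?thesis by simp
qed

lemma fejer_mean_integral:
  "has_bochner_integral lborel (\<lambda>a. indicator {-pi..pi} a *\<^sub>R (cis (a * x) * fejer_kernel n (b - a))) (2 * pi * fejer_mean x n b)"
proof -
  have "has_bochner_integral lborel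
     (\<lambda>a. (\<Sum>j<n. \<Sum>k<n. (indicator {-pi..pi} a *\<^sub>R cis (a * (x - (real j - real k)))) * cis ((real j - real k) * b)) / of_nat n)
     ((\<Sum>j<n. \<Sum>k<n. of_real (2 * pi * sinc (pi * (x - (real j - real k)))) * cis ((real j - real k) * b)) / of_nat n)"
    by (intro has_bochner_integral_divide_zero has_bochner_integral_sum has_bochner_integral_mult_left has_bochner_integral_cis)
  moreover have "(\<Sum>j<n. \<Sum>k<n. of_real (2 * pi * sinc (pi * (x - (real j - real k)))) * cis ((real j - real k) * b)) / of_nat n
     = 2 * pi * fejer_mean x n b"
    by (simp only: fejer_mean_def of_real_mult sum_distrib_left mult.assoc times_divide_eq_right)
  moreover have "(\<Sum>j<n. \<Sum>k<n. (indicator {-pi..pi} a *\<^sub>R cis (a * (x - (real j - real k)))) * cis ((real j - real k) * b)) / of_nat n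
     = indicator {-pi..pi} a *\<^sub>R (cis (a * x) * fejer_kernel n (b - a))" for a
  proof -
    have "cis (a * (x - (real j - real k))) * cis ((real j - real k) * b) = cis (a * x) * cis ((real j - real k) * (b - a))" for j k
      by (simp add: cis_mult algebra_simps)
    then show ?thesis
      unfolding fejer_kernel_eq_sum
      by (simp add: sum_distrib_left scaleR_conv_of_real mult.assoc times_divide_eq_right)
  qed
  ultimately show ?thesis by simp
qed

lemma fejer_kernel_integral:
  assumes "n > 0"
  shows "has_bochner_integral lborel (\<lambda>a. indicator {-pi..pi} a * fejer_kernel n (b - a)) (2 * pi)"
proof -
  have "sinc (pi * (real k - real j)) = (if j = k then 1 else 0)" for j k :: nat
  proof (cases "j = k")
    case False
    have "sin (pi * (real k - real j)) = 0"
      unfolding sin_zero_iff_int2 by (intro exI[of _ "int k - int j"]) (simp add: mult.commute)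
    then show ?thesis using False by simp
  qed simp
  then have "fejer_mean 0 n b = (\<Sum>j<n. \<Sum>k<n. if j = k then cis ((real j - real k) * b) else 0) / of_nat n"
    by (simp add: fejer_mean_def if_distrib[of of_real] mult_delta_left cong: if_cong)
  also have "\<dots> = 1"
    using assms by simp
  finally have "fejer_mean 0 n b = 1" .
  then have "has_bochner_integral lborel (\<lambda>a. complex_of_real (indicator {-pi..pi} a * fejer_kernel n (b - a))) (complex_of_real (2 * pi))"
    using fejer_mean_integral[of 0 n b] by (simp add: scaleR_conv_of_real)
  then show ?thesis
    by (simp only: has_bochner_integral_iff complex_of_real_integrable_eq integral_complex_of_real of_real_eq_iff)
qed

text \<open>
  The kernel is nonnegative with total mass \<open>2 \<pi>\<close>, so averaging does not increase the modulus. This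
  bound holds for all \<open>b\<close>, also where the periodic function jumps.
\<close>

lemma fejer_mean_norm_le: "cmod (fejer_mean x n b) \<le> 1"
proof (cases "n = 0")
  case True
  then show ?thesis by (simp add: fejer_mean_def)
next
  case False
  have "norm (2 * pi * fejer_mean x n b) = norm (LBINT a. indicator {-pi..pi} a *\<^sub>R (cis (a * x) * fejer_kernel n (b - a)))"
    using fejer_mean_integral[of x n b] by (simp add: has_bochner_integral_iff)
  also have "\<dots> \<le> (LBINT a. indicator {-pi..pi} a * fejer_kernel n (b - a))"
    by (rule order_trans[OF integral_norm_bound]) (simp add: norm_mult fejer_kernel_nonneg)
  also have "\<dots> = 2 * pi"
    using fejer_kernel_integral[of n b] False by (simp add: has_bochner_integral_iff)
  finally show ?thesis
    by (simp add: norm_mult)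
qed

lemma cis_diff_le: "cmod (cis u - cis v) \<le> \<bar>u - v\<bar>"
proof -
  have "cmod (cis u - cis v) = cmod (cis v * (cis (u - v) - 1))"
    by (simp add: cis_mult algebra_simps)
  also have "\<dots> = cmod (exp (\<i> * of_real (u - v)) - 1)"
    by (simp add: norm_mult cis_conv_exp)
  also have "\<dots> \<le> \<bar>u - v\<bar>"
    using iexp_approx1[of "u - v" 0] by simp
  finally show ?thesis .
qed

text \<open>
  On the compact interval \<open>[-\<pi>, \<pi>]\<close> the only zero of \<open>1 - cos (b - a)\<close> is \<open>a = b\<close>. Hence the
  oscillation of the exponential is at most \<open>r/2 + C (1 - cos (b - a))\<close> for a suitable \<open>C\<close>, and the
  kernel integrates the second term to \<open>O(1/n)\<close>.
\<close>

lemma fejer_mean_tendsto: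
  assumes b: "\<bar>b\<bar> < pi"
  shows "(\<lambda>n. fejer_mean x n b) \<longlonglongrightarrow> cis (b * x)"
proof (rule LIMSEQ_I)
  fix r :: real assume r: "r > 0"
  obtain C where C: "C \<ge> 0" "\<And>a. a \<in> {-pi..pi} \<Longrightarrow> cmod (cis (a * x) - cis (b * x)) \<le> r / 2 + C * (1 - cos (b - a))"
  proof -
    define \<rho> where "\<rho> = min (r / (2 * (\<bar>x\<bar> + 1))) (pi - \<bar>b\<bar>)"
    have \<rho>: "\<rho> > 0" "\<rho> \<le> pi - \<bar>b\<bar>" "\<rho> \<le> r / (2 * (\<bar>x\<bar> + 1))"
      using r b by (auto simp: \<rho>_def)
    have \<rho>pi: "\<rho> \<le> pi" using \<rho> by linarith
    have c: "1 - cos \<rho> > 0"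
      using cos_monotone_0_pi[of 0 \<rho>] \<rho>(1) \<rho>pi by simp
    \<comment> \<open>away from \<open>b\<close> the trivial bound \<open>2\<close> is absorbed by the second term\<close>
    define C where "C = 2 / (1 - cos \<rho>)"
    have "cmod (cis (a * x) - cis (b * x)) \<le> r / 2 + C * (1 - cos (b - a))" if a: "a \<in> {-pi..pi}" for a
    proof (cases "\<bar>b - a\<bar> < \<rho>")
      case True
      have "cmod (cis (a * x) - cis (b * x)) \<le> \<bar>b - a\<bar> * \<bar>x\<bar>"
        using cis_diff_le[of "a * x" "b * x"] by (simp add: abs_minus_commute flip: abs_mult left_diff_distrib)
      also have "\<dots> \<le> r / (2 * (\<bar>x\<bar> + 1)) * (\<bar>x\<bar> + 1)"
        using True \<rho>(3) r by (intro mult_mono) auto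
      also have "\<dots> = r / 2"
        by (simp add: field_simps)
      also have "\<dots> \<le> r / 2 + C * (1 - cos (b - a))"
        using c by (simp add: C_def)
      finally show ?thesis .
    next
      case False
      have "cos (b - a) \<le> cos \<rho>"
      proof (cases "\<bar>b - a\<bar> \<le> pi")
        case True
        have "cos \<bar>b - a\<bar> \<le> cos \<rho>"
          using True False \<rho> by (intro cos_monotone_0_pi_le) auto
        then show ?thesis by simp
      next
        case far: False
        \<comment> \<open>\<open>\<rho> \<le> \<pi> - \<bar>b\<bar>\<close> keeps the reflected angle away from \<open>0\<close>\<close>
        have "cos (2 * pi - \<bar>b - a\<bar>) \<le> cos \<rho>"
          using far \<rho> a b by (intro cos_monotone_0_pi_le) auto
        then show ?thesis by (simp add: cos_diff)
      qed
      then have "1 \<le> (1 - cos (b - a)) / (1 - cos \<rho>)"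
        using c by simp
      moreover have "cmod (cis (a * x) - cis (b * x)) \<le> 2"
        using norm_triangle_ineq4[of "cis (a * x)" "cis (b * x)"] by simp
      moreover have "C * (1 - cos (b - a)) = 2 * ((1 - cos (b - a)) / (1 - cos \<rho>))"
        by (simp add: C_def)
      ultimately have "cmod (cis (a * x) - cis (b * x)) \<le> C * (1 - cos (b - a))"
        by linarith
      then show ?thesis using r by simp
    qed
    moreover have "C \<ge> 0" using c by (simp add: C_def)
    ultimately show ?thesis using that by blast
  qed
  have main: "cmod (fejer_mean x n b - cis (b * x)) \<le> r / 2 + C * (2 / real n)" if n: "n > 0" for n
  proof -
    note kint = fejer_kernel_integral[OF n, of b]
    let ?k = "\<lambda>a. (indicator {-pi..pi} a * fejer_kernel n (b - a))"
    let ?G = "\<lambda>a. r / 2 * (?k a) + C * (2 / real n) * indicator {-pi..pi} a"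
    have kc: "has_bochner_integral lborel (\<lambda>a. cis (b * x) * of_real (?k a)) (cis (b * x) * of_real (2 * pi))"
      by (intro has_bochner_integral_mult_right has_bochner_integral_of_real kint)
    let ?g = "\<lambda>a. indicator {-pi..pi} a *\<^sub>R (cis (a * x) * fejer_kernel n (b - a)) - cis (b * x) * of_real (?k a)"
    have "has_bochner_integral lborel ?g (2 * pi * fejer_mean x n b - cis (b * x) * of_real (2 * pi))"
      by (intro has_bochner_integral_diff fejer_mean_integral kc)
    then have "norm (2 * pi * fejer_mean x n b - cis (b * x) * of_real (2 * pi)) = norm (integral\<^sup>L lborel ?g)"
      by (simp only: has_bochner_integral_iff)
    also have "\<dots> \<le> (LBINT a. norm (?g a))"
      by (rule integral_norm_bound)
    also have "\<dots> \<le> (LBINT a. (?G a))"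
    proof (rule integral_mono_AE')
      show "integrable lborel (\<lambda>a. (?G a))"
        using kint by (intro Bochner_Integration.integrable_add integrable_mult_right) (auto simp: has_bochner_integral_iff)
      show "AE a in lborel. 0 \<le> (?G a)"
        using C(1) r by (auto intro!: AE_I2 add_nonneg_nonneg simp: fejer_kernel_nonneg)
      show "AE a in lborel. norm (?g a) \<le> (?G a)"
      proof (rule AE_I2)
        fix a
        show "norm (?g a) \<le> (?G a)"
        proof (cases "a \<in> {-pi..pi}")
          case True
          have "norm (?g a) = cmod (cis (a * x) - cis (b * x)) * fejer_kernel n (b - a)"
            using True by (simp add: norm_mult fejer_kernel_nonneg flip: left_diff_distrib)
          also have "\<dots> \<le> (r / 2 + C * (1 - cos (b - a))) * fejer_kernel n (b - a)"
            by (intro mult_right_mono C(2) True fejer_kernel_nonneg)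
          also have "\<dots> = r / 2 * fejer_kernel n (b - a) + C * (fejer_kernel n (b - a) * (1 - cos (b - a)))"
            by (simp add: algebra_simps)
          also have "\<dots> \<le> r / 2 * fejer_kernel n (b - a) + C * (2 / real n)"
            by (intro add_left_mono mult_left_mono fejer_kernel_cos_le C(1))
          finally show ?thesis using True by simp
        qed simp
      qed
    qed
    also have "\<dots> = r / 2 * (2 * pi) + C * (2 / real n) * (2 * pi)"
    proof -
      have "has_bochner_integral lborel (indicator {-pi..pi} :: real \<Rightarrow> real) (measure lborel {-pi..pi})"
        by (rule has_bochner_integral_real_indicator) auto
      then have "has_bochner_integral lborel (indicator {-pi..pi} :: real \<Rightarrow> real) (2 * pi)"
        by simp
      then have "has_bochner_integral lborel (\<lambda>a. (?G a))
          (r / 2 * (2 * pi) + C * (2 / real n) * (2 * pi))"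
        by (intro has_bochner_integral_add has_bochner_integral_mult_right kint)
      then show ?thesis by (simp only: has_bochner_integral_iff)
    qed
    also have "norm (2 * pi * fejer_mean x n b - cis (b * x) * of_real (2 * pi)) = 2 * pi * cmod (fejer_mean x n b - cis (b * x))"
    proof -
      have "2 * pi * fejer_mean x n b - cis (b * x) * of_real (2 * pi) = of_real (2 * pi) * (fejer_mean x n b - cis (b * x))"
        by (simp add: algebra_simps)
      then show ?thesis by (simp only: norm_mult norm_of_real) simp
    qed
    finally have "2 * pi * cmod (fejer_mean x n b - cis (b * x)) \<le> 2 * pi * (r / 2 + C * (2 / real n))"
      by (simp only: algebra_simps)
    then show ?thesis
      by (rule mult_left_le_imp_le) simp
  qed
  have "(\<lambda>n. r / 2 + C * (2 / real n)) \<longlonglongrightarrow> r / 2 + C * 0"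
    by (intro tendsto_intros tendsto_divide_0[OF tendsto_const] filterlim_at_top_imp_at_infinity filterlim_real_sequentially)
  then have "\<forall>\<^sub>F n in sequentially. r / 2 + C * (2 / real n) < r"
    by (rule order_tendstoD) (use r in simp)
  with eventually_gt_at_top[of 0]
  have "\<forall>\<^sub>F n in sequentially. norm (fejer_mean x n b - cis (b * x)) < r"
  proof eventually_elim
    case (elim n)
    with main[of n] show ?case by simp
  qed
  then show "\<exists>no. \<forall>n\<ge>no. norm (fejer_mean x n b - cis (b * x)) < r"
    by (simp add: eventually_sequentially)
qed


lemma card_shifted_pairs_tendsto:
  "(\<lambda>n. (\<Sum>j<n. \<Sum>k<n. if int j - int k = l then 1 else 0 :: real) / real n) \<longlonglongrightarrow> 1"
proof (rule tendsto_sandwich)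
  define c where "c n = (\<Sum>j<n. \<Sum>k<n. if int j - int k = l then 1 else 0 :: real)" for n :: nat
  have inner: "(\<Sum>k<n. if int j - int k = l then 1 else 0 :: real) = (if 0 \<le> int j - l \<and> int j - l < int n then 1 else 0)" for j n :: nat
  proof -
    have "(\<Sum>k<n. if int j - int k = l then 1 else 0 :: real) = (\<Sum>k<n. if k = nat (int j - l) then (if 0 \<le> int j - l then 1 else 0) else 0)"
      by (intro sum.cong) auto
    also have "\<dots> = (if 0 \<le> int j - l \<and> int j - l < int n then 1 else 0)"
      by (auto simp: sum.delta)
    finally show ?thesis .
  qed
  have upper: "c n \<le> real n" for n
  proof -
    have "c n \<le> (\<Sum>j<n. 1)"
      unfolding c_def inner by (intro sum_mono) auto
    then show ?thesis by simp
  qed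
  have lower: "real n - \<bar>real_of_int l\<bar> \<le> c n" for n
  proof -
    let ?I = "{nat (max 0 l)..<n - nat (max 0 (- l))}"
    have "real n - \<bar>real_of_int l\<bar> \<le> real (card ?I)"
      by (cases "l \<ge> 0") auto
    also have "real (card ?I) = (\<Sum>j\<in>?I. 1)"
      by simp
    also have "\<dots> \<le> c n"
      unfolding c_def inner by (rule sum_le_included[where i="\<lambda>x. x"]) (auto split: if_splits)
    finally show ?thesis .
  qed
  show "\<forall>\<^sub>F n in sequentially. c n / real n \<le> 1"
    using upper by (intro always_eventually allI) (auto simp: divide_le_eq_1)
  show "\<forall>\<^sub>F n in sequentially. 1 - \<bar>real_of_int l\<bar> / real n \<le> c n / real n"
    using eventually_gt_at_top[of 0]
  proof eventually_elim
    case (elim n)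
    then show ?case
      using divide_right_mono[OF lower[of n], of "real n"] by (simp add: diff_divide_distrib)
  qed
  have "(\<lambda>n. 1 - \<bar>real_of_int l\<bar> / real n) \<longlonglongrightarrow> 1 - 0"
    by (intro tendsto_intros tendsto_divide_0[OF tendsto_const] filterlim_at_top_imp_at_infinity filterlim_real_sequentially)
  then show "(\<lambda>n. 1 - \<bar>real_of_int l\<bar> / real n) \<longlonglongrightarrow> 1"
    by simp
qed simp

text \<open>
  Every index \<open>l\<close> is represented as \<open>j - k\<close> between \<open>n - \<bar>l\<bar>\<close> and \<open>n\<close> times. For sums with finitely
  many nonzero terms the Cesaro average thus recovers the sum itself.
\<close>

lemma cesaro_mean_finite_support:
  fixes u :: "int \<Rightarrow> complex"
  assumes "finite A" "\<And>l. l \<notin> A \<Longrightarrow> u l = 0"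
  shows "(\<lambda>n. (\<Sum>j<n. \<Sum>k<n. u (int j - int k)) / of_nat n) \<longlonglongrightarrow> (\<Sum>l\<in>A. u l)"
proof -
  have u: "u z = (\<Sum>l\<in>A. of_real (if z = l then 1 else 0) * u l)" for z
    using assms by (simp add: if_distrib[of of_real] mult_delta_left sum.delta cong: if_cong)
  have eq: "(\<Sum>j<n. \<Sum>k<n. u (int j - int k)) / of_nat n
      = (\<Sum>l\<in>A. of_real ((\<Sum>j<n. \<Sum>k<n. if int j - int k = l then 1 else 0) / real n) * u l)" for n
  proof -
    have "(\<Sum>j<n. \<Sum>k<n. u (int j - int k)) = (\<Sum>j<n. \<Sum>k<n. \<Sum>l\<in>A. of_real (if int j - int k = l then 1 else 0) * u l)"
      by (intro sum.cong refl u)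
    also have "\<dots> = (\<Sum>j<n. \<Sum>l\<in>A. \<Sum>k<n. of_real (if int j - int k = l then 1 else 0) * u l)"
      by (intro sum.cong refl sum.swap)
    also have "\<dots> = (\<Sum>l\<in>A. \<Sum>j<n. \<Sum>k<n. of_real (if int j - int k = l then 1 else 0) * u l)"
      by (rule sum.swap)
    finally show ?thesis
      by (simp only: of_real_divide of_real_sum sum_distrib_right sum_divide_distrib of_real_of_nat_eq times_divide_eq_left)
  qed
  have "(\<lambda>n. \<Sum>l\<in>A. of_real ((\<Sum>j<n. \<Sum>k<n. if int j - int k = l then 1 else 0) / real n) * u l) \<longlonglongrightarrow> (\<Sum>l\<in>A. of_real 1 * u l)"
    by (intro tendsto_sum tendsto_mult tendsto_const tendsto_of_real card_shifted_pairs_tendsto)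
  then show ?thesis
    by (simp only: eq of_real_1 mult_1_left)
qed

text \<open>
  The core of the error estimate. The window \<open>Q\<close> is the Fourier integral of the nonnegative density
  \<open>p\<close>. Exchanging this integral with the Cesaro-averaged sum over the samples produces Fejer means at
  the frequency \<open>\<theta> - a\<close>: they converge to the exponential inside the band and are bounded by \<open>1\<close> outside,
  where the error is therefore at most \<open>2\<close>.
\<close>

lemma sampled_exponential_bound:
  fixes p :: "real \<Rightarrow> real"
  assumes p: "integrable lborel p" "\<And>a. 0 \<le> p a"
    and Q: "\<And>y. Q y = (LBINT a. of_real (p a) * cis (a * y))"
    and A: "finite A" "\<And>l. l \<notin> A \<Longrightarrow> Q (x - of_int l) = 0"
  shows "cmod (cis (\<theta> * x) * Q 0 - (\<Sum>l\<in>A. cis (\<theta> * of_int l) * of_real (sinc (pi * (x - of_int l))) * Q (x - of_int l)))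
       \<le> 2 * (LBINT a. indicator {a. pi \<le> \<bar>\<theta> - a\<bar>} a * p a)"
proof -
  note [measurable] = borel_measurable_integrable[OF p(1)]
  define u where "u l = cis (\<theta> * of_int l) * of_real (sinc (pi * (x - of_int l))) * Q (x - of_int l)" for l :: int
  define \<sigma> where "\<sigma> n a = fejer_mean x n (\<theta> - a)" for n a
  have \<sigma>m[measurable]: "\<sigma> n \<in> borel_measurable borel" for n
    unfolding \<sigma>_def fejer_mean_def by measurable
  have \<sigma>1: "cmod (\<sigma> n a) \<le> 1" for n a
    by (simp add: \<sigma>_def fejer_mean_norm_le)
  have Qint: "has_bochner_integral lborel (\<lambda>a. of_real (p a) * cis (a * y)) (Q y)" for y
    unfolding has_bochner_integral_iff Q using p(1) by (auto intro!: integrable_mult_cis)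
  have Sn: "has_bochner_integral lborel (\<lambda>a. of_real (p a) * cis (a * x) * \<sigma> n a) ((\<Sum>j<n. \<Sum>k<n. u (int j - int k)) / of_nat n)" for n
  proof -
    let ?c = "\<lambda>j k. cis (\<theta> * of_int (int j - int k)) * of_real (sinc (pi * (x - of_int (int j - int k))))"
    let ?e = "\<lambda>a j k. of_real (p a) * cis (a * (x - of_int (int j - int k)))"
    have "has_bochner_integral lborel
        (\<lambda>a. (\<Sum>j<n. \<Sum>k<n. ?c j k * ?e a j k) / of_nat n)
        ((\<Sum>j<n. \<Sum>k<n. u (int j - int k)) / of_nat n)"
      unfolding u_def
      by (intro has_bochner_integral_divide_zero has_bochner_integral_sum has_bochner_integral_mult_right Qint)
    moreover have "(\<Sum>j<n. \<Sum>k<n. ?c j k * ?e a j k) / of_nat n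
        = of_real (p a) * cis (a * x) * \<sigma> n a" for a
    proof -
      have "cis (\<theta> * of_int (int j - int k)) * of_real q * (of_real (p a) * cis (a * (x - of_int (int j - int k))))
          = of_real (p a) * cis (a * x) * (of_real q * cis ((real j - real k) * (\<theta> - a)))" for j k :: nat and q
      proof -
        have "cis (\<theta> * of_int (int j - int k)) * cis (a * (x - of_int (int j - int k))) = cis (a * x) * cis ((real j - real k) * (\<theta> - a))"
          by (simp add: cis_mult algebra_simps)
        then show ?thesis
          by (metis (no_types, lifting) mult.assoc mult.left_commute)
      qed
      then have "(\<Sum>j<n. \<Sum>k<n. ?c j k * ?e a j k)
        = (\<Sum>j<n. \<Sum>k<n. of_real (p a) * cis (a * x) * (of_real (sinc (pi * (x - of_int (int j - int k)))) * cis ((real j - real k) * (\<theta> - a))))"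
        by (simp only:)
      then show ?thesis
        by (simp only: \<sigma>_def fejer_mean_def sum_distrib_left times_divide_eq_right of_int_diff of_int_of_nat_eq)
    qed
    ultimately show ?thesis by simp
  qed
  let ?far = "\<lambda>a. indicator {a. pi \<le> \<bar>\<theta> - a\<bar>} a :: real"
  let ?near = "\<lambda>a. indicator {a. \<bar>\<theta> - a\<bar> < pi} a :: real"
  let ?e = "\<lambda>n a. ?near a * (p a * cmod (cis ((\<theta> - a) * x) - \<sigma> n a))"
  have e2: "cmod (cis ((\<theta> - a) * x) - \<sigma> n a) \<le> 2" for n a
    using norm_triangle_ineq4[of "cis ((\<theta> - a) * x)" "\<sigma> n a"] \<sigma>1[of n a] by simp
  have eint: "integrable lborel (?e n)" for n
    by (rule integrable_norm_le[where g="\<lambda>a. 2 * p a"])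
      (use p e2 in \<open>auto simp: abs_mult mult.commute[of 2] intro!: mult_left_mono split: split_indicator\<close>)
  have elim: "(\<lambda>n. LBINT a. ?e n a) \<longlonglongrightarrow> integral\<^sup>L lborel (\<lambda>_::real. 0 :: real)"
  proof (rule integral_dominated_convergence[where w="\<lambda>a. 2 * p a" and f="\<lambda>_. 0" and s="?e"])
    show "AE a in lborel. (\<lambda>n. ?e n a) \<longlonglongrightarrow> 0"
    proof (rule AE_I2)
      fix a
      show "(\<lambda>n. ?e n a) \<longlonglongrightarrow> 0"
      proof (cases "\<bar>\<theta> - a\<bar> < pi")
        case True
        have "(\<lambda>n. ?near a * (p a * cmod (cis ((\<theta> - a) * x) - \<sigma> n a))) \<longlonglongrightarrow> ?near a * (p a * cmod (cis ((\<theta> - a) * x) - cis ((\<theta> - a) * x)))"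
          unfolding \<sigma>_def by (intro tendsto_intros fejer_mean_tendsto True)
        then show ?thesis by simp
      qed simp
    qed
    show "AE a in lborel. norm (?e n a) \<le> 2 * p a" for n
      using p e2 by (auto simp: abs_mult mult.commute[of 2] intro!: mult_left_mono split: split_indicator)
  qed (use p eint in auto)
  have bound: "cmod (cis (\<theta> * x) * Q 0 - (\<Sum>j<n. \<Sum>k<n. u (int j - int k)) / of_nat n)
      \<le> 2 * (LBINT a. ?far a * p a) + (LBINT a. ?e n a)" for n
  proof -
    let ?g = "\<lambda>a. cis (\<theta> * x) * (of_real (p a) * cis (a * 0)) - of_real (p a) * cis (a * x) * \<sigma> n a"
    have farint: "integrable lborel (\<lambda>a. ?far a * p a)"
      by (rule integrable_norm_le[where g=p]) (use p in \<open>auto split: split_indicator\<close>)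
    have "has_bochner_integral lborel ?g (cis (\<theta> * x) * Q 0 - (\<Sum>j<n. \<Sum>k<n. u (int j - int k)) / of_nat n)"
      by (intro has_bochner_integral_diff has_bochner_integral_mult_right Qint Sn)
    then have "cmod (cis (\<theta> * x) * Q 0 - (\<Sum>j<n. \<Sum>k<n. u (int j - int k)) / of_nat n) = norm (integral\<^sup>L lborel ?g)"
      by (simp only: has_bochner_integral_iff)
    also have "\<dots> \<le> (LBINT a. norm (?g a))"
      by (rule integral_norm_bound)
    also have "\<dots> \<le> (LBINT a. 2 * (?far a * p a) + ?e n a)"
    proof (rule integral_mono_AE')
      show "integrable lborel (\<lambda>a. 2 * (?far a * p a) + ?e n a)"
        using farint eint by simp
      show "AE a in lborel. 0 \<le> 2 * (?far a * p a) + ?e n a"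
        using p by simp
      have "norm (?g a) = p a * cmod (cis ((\<theta> - a) * x) - \<sigma> n a)" for a
      proof -
        have "?g a = of_real (p a) * (cis (a * x) * (cis ((\<theta> - a) * x) - \<sigma> n a))"
          by (simp add: cis_mult algebra_simps)
        then show ?thesis
          using p(2)[of a] by (simp only: norm_mult norm_of_real) simp
      qed
      moreover have "p a * cmod (cis ((\<theta> - a) * x) - \<sigma> n a) \<le> 2 * (?far a * p a) + ?e n a" for a
        using mult_left_mono[OF e2[of a n] p(2)[of a]] by (auto split: split_indicator)
      ultimately show "AE a in lborel. norm (?g a) \<le> 2 * (?far a * p a) + ?e n a"
        by (intro AE_I2) (simp only:)
    qed
    also have "\<dots> = 2 * (LBINT a. ?far a * p a) + (LBINT a. ?e n a)"
      using farint eint by simp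
    finally show ?thesis .
  qed
  have lim: "(\<lambda>n. (\<Sum>j<n. \<Sum>k<n. u (int j - int k)) / of_nat n) \<longlonglongrightarrow> (\<Sum>l\<in>A. u l)"
    by (rule cesaro_mean_finite_support[OF A(1)]) (simp add: u_def A(2))
  have "cmod (cis (\<theta> * x) * Q 0 - (\<Sum>l\<in>A. u l)) \<le> 2 * (LBINT a. ?far a * p a) + integral\<^sup>L lborel (\<lambda>_::real. 0 :: real)"
  proof (rule LIMSEQ_le)
    show "(\<lambda>n. cmod (cis (\<theta> * x) * Q 0 - (\<Sum>j<n. \<Sum>k<n. u (int j - int k)) / of_nat n)) \<longlonglongrightarrow> cmod (cis (\<theta> * x) * Q 0 - (\<Sum>l\<in>A. u l))"
      by (intro tendsto_intros lim)
    show "(\<lambda>n. 2 * (LBINT a. ?far a * p a) + (LBINT a. ?e n a)) \<longlonglongrightarrow> 2 * (LBINT a. ?far a * p a) + integral\<^sup>L lborel (\<lambda>_::real. 0 :: real)"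
      by (intro tendsto_intros elim)
  qed (use bound in auto)
  then show ?thesis
    by (simp add: u_def)
qed

section \<open>B-splines and their Fourier transforms\<close>

abbreviation centered_box :: "real \<Rightarrow> real" where
  "centered_box \<equiv> indicator {-1/2..1/2}"

lemma bspline_1: "bspline 1 = centered_box"
  by (simp add: bspline_def)

lemma bspline_Suc: "n \<ge> 1 \<Longrightarrow> bspline (Suc n) = conv centered_box (bspline n)"
  by (cases n) (auto simp: bspline_def)

lemma conv_box_eq:
  "conv centered_box g x = (LBINT u. indicator {x - 1/2..x + 1/2} u * g u)"
proof -
  have "conv centered_box g x = (LBINT y. indicator {x - 1/2..x + 1/2} (x + (-1) * y) * g (x + (-1) * y))"
    unfolding conv_def by (intro Bochner_Integration.integral_cong) (auto simp: indicator_def)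
  also have "\<dots> = (LBINT u. indicator {x - 1/2..x + 1/2} u * g u)"
    by (subst lborel_integral_real_affine[where c="-1" and t=x and f="\<lambda>u. indicator {x - 1/2..x + 1/2} u * g u"]) auto
  finally show ?thesis .
qed

text \<open>
  These properties give integrability and are inherited by the convolution with the box, with
  \<open>r + 1/2\<close> in place of \<open>r\<close>.
\<close>

definition unit_bump :: "real \<Rightarrow> (real \<Rightarrow> real) \<Rightarrow> bool" where
  "unit_bump r g \<longleftrightarrow> g \<in> borel_measurable borel \<and> (\<forall>x. 0 \<le> g x \<and> g x \<le> 1) \<and> (\<forall>x. \<bar>x\<bar> > r \<longrightarrow> g x = 0)"

lemma unit_bump_box: "unit_bump (1/2) centered_box"
  by (auto simp: unit_bump_def indicator_def)

lemma integrable_box: "integrable lborel centered_box"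
  by (rule integrable_real_indicator) auto

lemma integrable_indicator_Icc: "integrable lborel (indicator {a..b::real} :: real \<Rightarrow> real)"
  by (rule integrable_real_indicator) (auto simp: emeasure_lborel_Icc_eq)

lemma unit_bump_integrable:
  assumes "unit_bump r g"
  shows "integrable lborel g"
proof (rule integrable_norm_le[where g="indicator {-r..r}"])
  show "norm (g x) \<le> indicator {-r..r} x" for x
    using assms by (cases "x \<in> {-r..r}") (auto simp: unit_bump_def)
qed (use assms integrable_indicator_Icc in \<open>auto simp: unit_bump_def\<close>)

lemma integrable_indicator_mult:
  fixes g :: "real \<Rightarrow> real"
  assumes "integrable lborel g" "A \<in> sets borel"
  shows "integrable lborel (\<lambda>u. indicator A u * g u)"
  using integrable_mult_indicator[OF _ assms(1), of A] assms(2) by simp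

text \<open>
  The two averages run over unit intervals that differ by two intervals of length
  \<open>\<bar>x - x'\<bar>\<close>, and the integrand is bounded by \<open>1\<close>.
\<close>

lemma unit_bump_conv_lipschitz:
  assumes g: "unit_bump r g"
  shows "\<bar>conv centered_box g x - conv centered_box g x'\<bar> \<le> 2 * \<bar>x - x'\<bar>"
proof -
  have *: "conv centered_box g y - conv centered_box g x \<le> 2 * (y - x)" "conv centered_box g x - conv centered_box g y \<le> 2 * (y - x)" if "x \<le> y" for x y
  proof -
    let ?I = "\<lambda>z. indicator {z - 1/2..z + 1/2} :: real \<Rightarrow> real"
    let ?J = "\<lambda>z. indicator {x + z..y + z} :: real \<Rightarrow> real"
    have J: "(LBINT u. ?J z u) = y - x" for z
      using that by simp
    have gi: "integrable lborel (\<lambda>u. ?I z u * g u)" for z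
      by (intro integrable_indicator_mult unit_bump_integrable[OF g]) auto
    have Ji: "integrable lborel (\<lambda>u. ?J (1/2) u + ?J (-1/2) u)"
      by (intro Bochner_Integration.integrable_add integrable_indicator_Icc)
    have g01: "0 \<le> g u" "g u \<le> 1" for u
      using g by (auto simp: unit_bump_def)
    have pt: "\<bar>?I y u * g u - ?I x u * g u\<bar> \<le> ?J (1/2) u + ?J (-1/2) u" for u
    proof -
      have "\<bar>?I y u - ?I x u\<bar> \<le> ?J (1/2) u + ?J (-1/2) u"
        using that by (auto simp: indicator_def)
      moreover have "\<bar>?I y u * g u - ?I x u * g u\<bar> \<le> \<bar>?I y u - ?I x u\<bar> * 1"
        using g01[of u] by (auto simp: abs_mult simp flip: left_diff_distrib intro!: mult_left_le)
      ultimately show ?thesis by simp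
    qed
    have "\<bar>conv centered_box g y - conv centered_box g x\<bar> = \<bar>LBINT u. ?I y u * g u - ?I x u * g u\<bar>"
      unfolding conv_box_eq using gi by simp
    also have "\<dots> \<le> (LBINT u. \<bar>?I y u * g u - ?I x u * g u\<bar>)"
      by (rule integral_abs_bound)
    also have "\<dots> \<le> (LBINT u. ?J (1/2) u + ?J (-1/2) u)"
      by (rule integral_mono_AE') (use pt Ji in auto)
    also have "\<dots> = (LBINT u. ?J (1/2) u) + (LBINT u. ?J (-1/2) u)"
      by (intro Bochner_Integration.integral_add integrable_indicator_Icc)
    also have "\<dots> = 2 * (y - x)"
      unfolding J by simp
    finally show "conv centered_box g y - conv centered_box g x \<le> 2 * (y - x)" "conv centered_box g x - conv centered_box g y \<le> 2 * (y - x)"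
      by auto
  qed
  show ?thesis
    using *[of x x'] *[of x' x] by (cases "x \<le> x'") auto
qed

lemma unit_bump_conv_continuous:
  assumes g: "unit_bump r g"
  shows "continuous_on UNIV (conv centered_box g)"
  unfolding continuous_on_iff
proof (intro ballI allI impI)
  fix x e :: real assume "e > 0"
  have "\<bar>conv centered_box g x' - conv centered_box g x\<bar> < e" if "\<bar>x' - x\<bar> < e / 2" for x'
    by (rule le_less_trans[OF unit_bump_conv_lipschitz[OF g]]) (use that in simp)
  with \<open>e > 0\<close> show "\<exists>d>0. \<forall>x'\<in>UNIV. dist x' x < d \<longrightarrow> dist (conv centered_box g x') (conv centered_box g x) < e"
    by (intro exI[of _ "e / 2"]) (simp add: dist_real_def)
qed

lemma unit_bump_conv:
  assumes g: "unit_bump r g"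
  shows "unit_bump (r + 1/2) (conv centered_box g)"
  unfolding unit_bump_def
proof (intro conjI allI impI)
  have g01: "0 \<le> g u" "g u \<le> 1" for u
    using g by (auto simp: unit_bump_def)
  show "conv centered_box g \<in> borel_measurable borel"
    by (rule borel_measurable_continuous_onI[OF unit_bump_conv_continuous[OF g]])
  show "0 \<le> conv centered_box g x" for x
    unfolding conv_box_eq by (rule Bochner_Integration.integral_nonneg) (simp add: g01)
  show "conv centered_box g x \<le> 1" for x
  proof -
    have "conv centered_box g x \<le> (LBINT u. indicator {x - 1/2..x + 1/2} u)"
      unfolding conv_box_eq
      by (rule integral_mono_AE') (use g01 in \<open>auto intro!: AE_I2 integrable_indicator_Icc mult_left_le\<close>)
    then show ?thesis by simp
  qed
  show "conv centered_box g x = 0" if "\<bar>x\<bar> > r + 1/2" for x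
  proof -
    have "indicator {x - 1/2..x + 1/2} u * g u = 0" for u
      using that g by (auto simp: unit_bump_def indicator_def)
    then have "(\<lambda>u. indicator {x - 1/2..x + 1/2} u * g u) = (\<lambda>_. 0)"
      by (intro ext)
    then show ?thesis unfolding conv_box_eq by (simp only: Bochner_Integration.integral_zero)
  qed
qed

lemma bspline_unit_bump: "n \<ge> 1 \<Longrightarrow> unit_bump (real n / 2) (bspline n)"
proof (induction n rule: nat_induct_at_least)
  case base
  then show ?case using unit_bump_box by (simp only: bspline_1 of_nat_1)
next
  case (Suc n)
  then show ?case
    using unit_bump_conv[OF Suc.IH] by (simp add: bspline_Suc add_divide_distrib add.commute)
qed

lemma bspline_continuous:
  assumes "n \<ge> 2"
  shows "continuous_on UNIV (bspline n)"
proof -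
  obtain k where "n = Suc k" "k \<ge> 1" using assms by (cases n) auto
  then show ?thesis
    using unit_bump_conv_continuous[OF bspline_unit_bump] by (simp add: bspline_Suc)
qed

lemma fourier_conv:
  assumes f: "integrable lborel f" and g: "integrable lborel g"
  shows "fourier (\<lambda>x. of_real (conv f g x)) v = fourier (\<lambda>x. of_real (f x)) v * fourier (\<lambda>x. of_real (g x)) v"
proof -
  note [measurable] = borel_measurable_integrable[OF f] borel_measurable_integrable[OF g]
  define F where "F y x = complex_of_real (f y * g (x - y)) * cis (- (2 * pi * x * v))" for y x
  have nrm: "norm (F y x) = \<bar>f y\<bar> * \<bar>g (x - y)\<bar>" for y x
    by (simp add: F_def norm_mult abs_mult)
  have gs: "integrable lborel (\<lambda>x. g (x - y))" for y
    using lborel_integrable_real_affine[OF g, of 1 "-y"] by simp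
  have gsi: "(LBINT x. \<bar>g (x - y)\<bar>) = (LBINT x. \<bar>g x\<bar>)" for y
    using lborel_integral_real_affine[of 1 "\<lambda>x. \<bar>g x\<bar>" "-y"] by simp
  have Fint: "integrable (lborel \<Otimes>\<^sub>M lborel) (case_prod F)"
  proof (rule lborel_pair.Fubini_integrable)
    show "case_prod F \<in> borel_measurable (lborel \<Otimes>\<^sub>M lborel)"
      unfolding F_def by measurable
    have "(\<lambda>y. LBINT x. norm (case_prod F (y, x))) = (\<lambda>y. \<bar>f y\<bar> * (LBINT x. \<bar>g x\<bar>))"
      by (simp add: nrm gsi)
    then show "integrable lborel (\<lambda>y. LBINT x. norm (case_prod F (y, x)))"
      using f by simp
    have [measurable]: "F y \<in> borel_measurable borel" for y
      unfolding F_def[abs_def] by measurable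
    have "integrable lborel (F y)" for y
      by (rule integrable_norm_le[where g="\<lambda>x. \<bar>f y\<bar> * \<bar>g (x - y)\<bar>"]) (use gs nrm in auto)
    then show "AE y in lborel. integrable lborel (\<lambda>x. case_prod F (y, x))"
      by simp
  qed
  have "fourier (\<lambda>x. of_real (conv f g x)) v = (LBINT x. LBINT y. F y x)"
    unfolding fourier_cis conv_def F_def by (simp flip: integral_complex_of_real)
  also have "\<dots> = (LBINT y. LBINT x. F y x)"
    by (rule lborel_pair.Fubini_integral[OF Fint])
  also have "\<dots> = (LBINT y. of_real (f y) * cis (- (2 * pi * y * v)) * fourier (\<lambda>x. of_real (g x)) v)"
  proof (rule Bochner_Integration.integral_cong[OF refl])
    fix y
    have "(LBINT x. F y x) = (LBINT x. F y (y + 1 * x))"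
      using lborel_integral_real_affine[of 1 "F y" y] by simp
    also have "\<dots> = (LBINT x. of_real (f y) * cis (- (2 * pi * y * v)) * (of_real (g x) * cis (- (2 * pi * x * v))))"
      by (rule Bochner_Integration.integral_cong) (auto simp: F_def cis_mult algebra_simps)
    finally show "(LBINT x. F y x) = of_real (f y) * cis (- (2 * pi * y * v)) * fourier (\<lambda>x. of_real (g x)) v"
      by (simp add: fourier_cis)
  qed
  also have "\<dots> = fourier (\<lambda>x. of_real (f x)) v * fourier (\<lambda>x. of_real (g x)) v"
    by (simp add: fourier_cis)
  finally show ?thesis .
qed

lemma fourier_box: "fourier (\<lambda>x. of_real (centered_box x)) v = of_real (sinc (pi * v))"
proof (cases "v = 0")
  case True
  have "(LBINT t. complex_of_real (centered_box t)) = of_real (LBINT t. centered_box t)"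
    by (rule integral_complex_of_real)
  with True show ?thesis by (simp add: fourier_cis)
next
  case False
  define F where "F a = cis (- (2 * pi * a * v)) / (- (2 * \<i> * of_real (pi * v)))" for a
  have "(LBINT t. indicator {-1/2..1/2} t *\<^sub>R cis (- (2 * pi * t * v))) = F (1/2) - F (-1/2)"
  proof (rule integral_FTC_Icc)
    show "(F has_vector_derivative cis (- (2 * pi * x * v))) (at x within {- 1/2..1/2})" for x
      unfolding F_def cis_conv_exp using False
      by (auto intro!: derivative_eq_intros has_vector_derivative_real_field simp: field_simps)
    show "continuous_on {- 1/2..1/2} (\<lambda>x. cis (- (2 * pi * x * v)))"
      by (auto intro!: continuous_intros simp: cis_conv_exp)
  qed simp
  moreover have "F (1/2) - F (-1/2) = of_real (sinc (pi * v))"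
    using False by (auto simp: F_def complex_eq_iff Re_divide Im_divide field_simps power2_eq_square)
  ultimately show ?thesis
    by (simp add: fourier_cis scaleR_conv_of_real)
qed

lemma fourier_bspline:
  "n \<ge> 1 \<Longrightarrow> fourier (\<lambda>x. of_real (bspline n x)) v = of_real (sinc (pi * v) ^ n)"
proof (induction n rule: nat_induct_at_least)
  case base
  then show ?case using fourier_box[of v] by (simp only: bspline_1 power_one_right)
next
  case (Suc n)
  have "fourier (\<lambda>x. of_real (bspline (Suc n) x)) v = of_real (sinc (pi * v)) * of_real (sinc (pi * v) ^ n)"
    unfolding bspline_Suc[OF Suc.hyps]
    by (subst fourier_conv[OF integrable_box unit_bump_integrable[OF bspline_unit_bump[OF Suc.hyps]]])
      (simp only: Suc.IH fourier_box)
  then show ?case by (simp only: of_real_mult power_Suc)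
qed

lemma sinc_abs_le_1: "\<bar>sinc x\<bar> \<le> 1"
  using abs_sin_x_le_abs_x[of x] by (auto simp: abs_divide divide_le_eq_1)

lemma integrable_sinc_power:
  assumes "n \<ge> 2"
  shows "integrable lborel (\<lambda>y. sinc y ^ n)"
proof (rule integrable_norm_le[where g="\<lambda>y. 2 * inverse (1 + y\<^sup>2)"])
  have "integrable lborel (\<lambda>y::real. indicator (einterval (-\<infinity>) \<infinity>) y *\<^sub>R inverse (1 + y\<^sup>2))"
    using integrable_inverse_1_plus_square unfolding set_integrable_def .
  then show "integrable lborel (\<lambda>y::real. 2 * inverse (1 + y\<^sup>2))"
    by simp
  show "norm (sinc y ^ n) \<le> 2 * inverse (1 + y\<^sup>2)" for y
  proof -
    have "norm (sinc y ^ n) = \<bar>sinc y\<bar> ^ n"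
      by (simp add: power_abs)
    also have "\<dots> \<le> \<bar>sinc y\<bar> ^ 2"
      by (rule power_decreasing[OF assms]) (use sinc_abs_le_1 in auto)
    also have "\<dots> = (sinc y)\<^sup>2"
      by simp
    also have "\<dots> \<le> 2 * inverse (1 + y\<^sup>2)"
    proof -
      have "(sinc y)\<^sup>2 \<le> 1"
        using sinc_abs_le_1[of y] by (simp add: abs_square_le_1)
      moreover have "y\<^sup>2 * (sinc y)\<^sup>2 \<le> 1"
        using abs_sin_le_one[of y] by (auto simp: power_divide abs_square_le_1)
      ultimately have "(1 + y\<^sup>2) * (sinc y)\<^sup>2 \<le> 2"
        by (simp only: distrib_right)
      then show ?thesis
        by (simp only: inverse_eq_divide times_divide_eq_right mult_1_right pos_le_divide_eq add_pos_nonneg zero_less_one zero_le_power2 mult.commute)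
    qed
    finally show ?thesis .
  qed
qed simp

text \<open>
  The frequency variable is \<open>y = \<pi> v\<close>, so that the density is a plain power of \<open>sinc\<close>.
\<close>

lemma bspline_inversion:
  assumes n: "n \<ge> 2"
  shows "of_real (bspline n x) = (LBINT y. of_real (sinc y ^ n / pi) * cis (2 * y * x))"
proof -
  let ?b = "\<lambda>x. complex_of_real (bspline n x)"
  have sl: "unit_bump (real n / 2) (bspline n)"
    using n by (intro bspline_unit_bump) simp
  have bi: "integrable lborel ?b"
    by (rule integrable_of_real[OF unit_bump_integrable[OF sl]])
  have L2: "?b \<in> L2_space"
  proof -
    have "integrable lborel (\<lambda>x. (cmod (?b x))\<^sup>2)"
      by (rule integrable_norm_le[OF unit_bump_integrable[OF sl]])
        (use sl in \<open>auto simp: unit_bump_def power2_eq_square mult_left_le\<close>)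
    then show ?thesis using bi by (simp add: L2_space_def)
  qed
  have fb: "fourier ?b = (\<lambda>v. of_real (sinc (pi * v) ^ n))"
    using n by (intro ext fourier_bspline) simp
  have fi: "integrable lborel (fourier ?b)"
  proof -
    have "integrable lborel (\<lambda>v. sinc (0 + pi * v) ^ n)"
      by (rule lborel_integrable_real_affine[OF integrable_sinc_power[OF n]]) simp
    then show ?thesis unfolding fb by (intro integrable_of_real) (simp only: add_0)
  qed
  have ct: "isCont ?b x"
    using bspline_continuous[OF n] by (auto simp: continuous_on_eq_continuous_at intro!: continuous_intros)
  have "?b x = (LBINT v. fourier ?b v * cis (2 * pi * v * x))"
    by (rule gauss_inversion[OF fourier_gauss_weight[OF _ bi] fi L2 ct]) simp
  also have "\<dots> = (LBINT v. of_real (sinc (pi * v) ^ n) * cis (2 * pi * v * x))"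
    by (simp only: fb)
  also have "\<dots> = (LBINT y. of_real (sinc y ^ n / pi) * cis (2 * y * x))"
  proof -
    have "(LBINT y. of_real (sinc y ^ n / pi) * cis (2 * y * x))
        = pi *\<^sub>R (LBINT v. of_real (sinc (0 + pi * v) ^ n / pi) * cis (2 * (0 + pi * v) * x))"
      by (subst lborel_integral_real_affine[where c=pi and t=0]) simp_all
    also have "\<dots> = (LBINT v. pi *\<^sub>R (of_real (sinc (0 + pi * v) ^ n / pi) * cis (2 * (0 + pi * v) * x)))"
      by (rule integral_scaleR_right[symmetric])
    also have "\<dots> = (LBINT v. of_real (sinc (pi * v) ^ n) * cis (2 * pi * v * x))"
      by (rule Bochner_Integration.integral_cong[OF refl]) (simp add: scaleR_conv_of_real mult_ac)
    finally show ?thesis ..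
  qed
  finally show ?thesis .
qed

section \<open>Tails of powers of the sinc function\<close>

definition sinc_tail :: "nat \<Rightarrow> real \<Rightarrow> real" where
  "sinc_tail p a = (LBINT y. indicator {a..} y * sinc y ^ p)"

lemma sinc_tail_split:
  assumes "p \<ge> 2" "a \<le> b"
  shows "sinc_tail p a = (LBINT y. indicator {a..b} y * sinc y ^ p) + sinc_tail p b"
proof -
  have i: "integrable lborel (\<lambda>y. indicator A y * sinc y ^ p)" if "A \<in> sets borel" for A
    by (rule integrable_indicator_mult[OF integrable_sinc_power[OF assms(1)] that])
  have "sinc_tail p a = (LBINT y. indicator {a..b} y * sinc y ^ p + indicator {b..} y * sinc y ^ p)"
    unfolding sinc_tail_def
  proof (rule integral_cong_AE)
    show "AE y in lborel. indicator {a..} y * sinc y ^ p = indicator {a..b} y * sinc y ^ p + indicator {b..} y * sinc y ^ p"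
      using AE_lborel_singleton[of b]
      by eventually_elim (use assms(2) in \<open>auto split: split_indicator\<close>)
  qed (auto intro!: borel_measurable_integrable[OF i] borel_measurable_add)
  also have "\<dots> = (LBINT y. indicator {a..b} y * sinc y ^ p) + sinc_tail p b"
    unfolding sinc_tail_def by (rule Bochner_Integration.integral_add) (rule i, simp)+
  finally show ?thesis .
qed

lemma sinc_tail_step:
  assumes p: "p \<ge> 2" and ab: "a \<le> b"
    and F: "\<And>y. a \<le> y \<Longrightarrow> y \<le> b \<Longrightarrow> (F has_real_derivative f y) (at y)"
    and f: "\<And>y. a \<le> y \<Longrightarrow> y \<le> b \<Longrightarrow> isCont f y"
    and le: "\<And>y. a \<le> y \<Longrightarrow> y \<le> b \<Longrightarrow> sinc y ^ p \<le> f y"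
  shows "sinc_tail p a \<le> sinc_tail p b + (F b - F a)"
proof -
  have fi: "has_bochner_integral lborel (\<lambda>y. f y * indicator {a..b} y) (F b - F a)"
    by (rule has_bochner_integral_FTC_Icc_real[OF ab F f])
  have "(LBINT y. indicator {a..b} y * sinc y ^ p) \<le> (LBINT y. f y * indicator {a..b} y)"
  proof (rule integral_mono)
    show "integrable lborel (\<lambda>y. indicator {a..b} y * sinc y ^ p)"
      by (rule integrable_indicator_mult[OF integrable_sinc_power[OF p]]) simp
    show "integrable lborel (\<lambda>y. f y * indicator {a..b} y)"
      using fi by (simp add: has_bochner_integral_iff)
    show "indicator {a..b} y * sinc y ^ p \<le> f y * indicator {a..b} y" for y
      using le[of y] by (auto simp: indicator_def)
  qed
  then show ?thesis
    using sinc_tail_split[OF p ab] fi by (simp add: has_bochner_integral_iff)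
qed

text \<open>
  Both tails are compared with the tail from \<open>C / 2\<close>. Passing to the starting points \<open>X\<close> and \<open>C - X\<close> adds
  the integral of \<open>sinc\<^sup>p\<close> over \<open>[X, C/2]\<close> to one of them and removes the integral over the mirror image
  of this interval from the other.
\<close>

lemma sinc_tail_pair_step:
  assumes p: "p \<ge> 2" and X: "X \<le> C / 2"
    and F: "\<And>y. X \<le> y \<Longrightarrow> y \<le> C / 2 \<Longrightarrow> (F has_real_derivative f y) (at y)"
    and f: "\<And>y. X \<le> y \<Longrightarrow> y \<le> C / 2 \<Longrightarrow> isCont f y"
    and le: "\<And>y. X \<le> y \<Longrightarrow> y \<le> C / 2 \<Longrightarrow> sinc y ^ p - sinc (C - y) ^ p \<le> f y"
  shows "sinc_tail p X + sinc_tail p (C - X) \<le> 2 * sinc_tail p (C / 2) + (F (C / 2) - F X)"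
proof -
  let ?I = "indicator {X..C / 2} :: real \<Rightarrow> real"
  have fi: "has_bochner_integral lborel (\<lambda>y. f y * ?I y) (F (C / 2) - F X)"
    by (rule has_bochner_integral_FTC_Icc_real[OF X F f])
  have i: "integrable lborel (\<lambda>y. indicator A y * sinc y ^ p)" if "A \<in> sets borel" for A
    by (rule integrable_indicator_mult[OF integrable_sinc_power[OF p] that])
  have refl: "indicator {C / 2..C - X} (C + (-1) * y) * sinc (C + (-1) * y) ^ p = ?I y * sinc (C - y) ^ p" for y
  proof -
    have "indicator {C / 2..C - X} (C + (-1) * y) = ?I y"
      by (auto simp: indicator_def)
    moreover have "C + (-1) * y = C - y"
      by simp
    ultimately show ?thesis by (simp only:)
  qed
  have ri: "integrable lborel (\<lambda>y. ?I y * sinc (C - y) ^ p)"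
    using lborel_integrable_real_affine[OF i[of "{C / 2..C - X}"], of "-1" C] unfolding refl by simp
  have rv: "(LBINT y. indicator {C / 2..C - X} y * sinc y ^ p) = (LBINT y. ?I y * sinc (C - y) ^ p)"
    by (subst lborel_integral_real_affine[where c="-1" and t=C]) (simp, simp only: refl, simp)
  have "(LBINT y. ?I y * sinc y ^ p) - (LBINT y. ?I y * sinc (C - y) ^ p)
      = (LBINT y. ?I y * sinc y ^ p - ?I y * sinc (C - y) ^ p)"
    using i[of "{X..C / 2}"] ri by (intro Bochner_Integration.integral_diff[symmetric]) simp_all
  also have "\<dots> \<le> (LBINT y. f y * ?I y)"
  proof (rule integral_mono)
    show "integrable lborel (\<lambda>y. ?I y * sinc y ^ p - ?I y * sinc (C - y) ^ p)"
      using i[of "{X..C / 2}"] ri by (intro Bochner_Integration.integrable_diff) simp_all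
    show "integrable lborel (\<lambda>y. f y * ?I y)"
      using fi by (simp add: has_bochner_integral_iff)
    show "?I y * sinc y ^ p - ?I y * sinc (C - y) ^ p \<le> f y * ?I y" for y
      using le[of y] by (cases "y \<in> {X..C / 2}") (simp_all only: indicator_simps atLeastAtMost_iff, simp_all)
  qed
  also have "\<dots> = F (C / 2) - F X"
    using fi by (simp add: has_bochner_integral_iff)
  finally have *: "(LBINT y. ?I y * sinc y ^ p) - (LBINT y. ?I y * sinc (C - y) ^ p) \<le> F (C / 2) - F X" .
  have "C / 2 \<le> C - X" using X by simp
  from sinc_tail_split[OF p X] sinc_tail_split[OF p this] * rv show ?thesis
    by linarith
qed

lemma sinc_tail_tendsto_0:
  assumes p: "p \<ge> 2"
  shows "(\<lambda>n. sinc_tail p (a + real n)) \<longlonglongrightarrow> 0"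
proof -
  have "(\<lambda>n. LBINT y. indicator {a + real n..} y * sinc y ^ p) \<longlonglongrightarrow> (LBINT y::real. 0 :: real)"
  proof (rule integral_dominated_convergence[where w="\<lambda>y. \<bar>sinc y ^ p\<bar>"])
    show "AE y in lborel. (\<lambda>n. indicator {a + real n..} y * sinc y ^ p) \<longlonglongrightarrow> 0"
    proof (rule AE_I2)
      fix y :: real
      obtain N :: nat where N: "y - a < real N"
        using reals_Archimedean2 by blast
      have "indicator {a + real n..} y * sinc y ^ p = 0" if "n \<ge> N" for n
        using N that by (simp add: indicator_def)
      then show "(\<lambda>n. indicator {a + real n..} y * sinc y ^ p) \<longlonglongrightarrow> 0"
        by (intro tendsto_eventually eventually_sequentiallyI)
    qed
    show "AE y in lborel. norm (indicator {a + real n..} y * sinc y ^ p) \<le> \<bar>sinc y ^ p\<bar>" for n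
      by (rule AE_I2) (simp add: indicator_def)
    show "integrable lborel (\<lambda>y. \<bar>sinc y ^ p\<bar>)"
      by (rule integrable_abs[OF integrable_sinc_power[OF p]])
    show "(\<lambda>y. indicator {a + real n..} y * sinc y ^ p) \<in> borel_measurable lborel" for n
      by measurable
  qed simp
  then show ?thesis
    by (simp add: sinc_tail_def)
qed

lemma power_tail_deriv:
  assumes "y > 0" "q \<ge> 1"
  shows "((\<lambda>y. - (c / (real q * y ^ q))) has_real_derivative c / y ^ Suc q) (at y)"
proof -
  have "((\<lambda>y. - (c / (real q * y ^ q))) has_real_derivative c * (real q * (real q * y ^ (q - 1))) / (real q * y ^ q)\<^sup>2) (at y)"
    using assms by (auto intro!: derivative_eq_intros simp: power2_eq_square)
  moreover have "c * (real q * (real q * y ^ (q - 1))) / (real q * y ^ q)\<^sup>2 = c / y ^ Suc q"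
  proof -
    obtain r where r: "q = Suc r" using assms by (cases q) auto
    have "c * (R * (R * z)) / (R * (y * z))\<^sup>2 = c / (y * (y * z))" if "R > 0" "z > 0" for R z :: real
      using that assms by (simp add: power2_eq_square)
    from this[of "real (Suc r)" "y ^ r"] assms(1) show ?thesis
      unfolding r by (simp only: diff_Suc_1 power_Suc zero_less_power of_nat_0_less_iff zero_less_Suc simp_thms mult.assoc)
  qed
  ultimately show ?thesis by simp
qed

lemma sinc_tail_power_step:
  assumes "q \<ge> 1" "odd q" "0 < a" "a \<le> b"
    and le: "\<And>y. a \<le> y \<Longrightarrow> y \<le> b \<Longrightarrow> sin y ^ Suc q \<le> c"
  shows "sinc_tail (Suc q) a \<le> sinc_tail (Suc q) b + c * (1 / (real q * a ^ q) - 1 / (real q * b ^ q))"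
proof -
  have "sinc_tail (Suc q) a \<le> sinc_tail (Suc q) b + (- (c / (real q * b ^ q)) - (- (c / (real q * a ^ q))))"
  proof (rule sinc_tail_step[where f="\<lambda>y. c / y ^ Suc q"])
    show "((\<lambda>y. - (c / (real q * y ^ q))) has_real_derivative c / y ^ Suc q) (at y)" if "a \<le> y" "y \<le> b" for y
      using that assms by (intro power_tail_deriv) auto
    show "isCont (\<lambda>y. c / y ^ Suc q) y" if "a \<le> y" "y \<le> b" for y
      using that assms by (intro continuous_intros) auto
    show "sinc y ^ Suc q \<le> c / y ^ Suc q" if "a \<le> y" "y \<le> b" for y
    proof -
      have "sinc y ^ Suc q = sin y ^ Suc q / y ^ Suc q"
        using that assms by (simp only: power_divide split: if_splits) auto
      also have "\<dots> \<le> c / y ^ Suc q"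
        using that assms by (intro divide_right_mono le) auto
      finally show ?thesis .
    qed
  qed (use assms in auto)
  then show ?thesis by (simp add: algebra_simps)
qed

lemma sin_even_power_le_1: "even n \<Longrightarrow> sin (y::real) ^ n \<le> 1"
  by (metis abs_sin_le_one power_abs power_even_abs power_le_one abs_ge_zero)

lemma sinc_tail_power_le:
  assumes "q \<ge> 1" "odd q" "0 < a"
  shows "sinc_tail (Suc q) a \<le> 1 / (real q * a ^ q)"
proof -
  have "sinc_tail (Suc q) a \<le> sinc_tail (Suc q) (a + real n) + 1 / (real q * a ^ q)" for n
  proof -
    define u v where "u = 1 / (real q * a ^ q)" and "v = 1 / (real q * (a + real n) ^ q)"
    have "sinc_tail (Suc q) a \<le> sinc_tail (Suc q) (a + real n) + 1 * (1 / (real q * a ^ q) - 1 / (real q * (a + real n) ^ q))"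
      by (rule sinc_tail_power_step) (use assms sin_even_power_le_1[of "Suc q"] in auto)
    then have "sinc_tail (Suc q) a \<le> sinc_tail (Suc q) (a + real n) + (u - v)"
      by (simp only: u_def v_def mult_1_left)
    moreover have "0 \<le> v"
      using assms by (simp add: v_def)
    ultimately show ?thesis unfolding u_def[symmetric] by linarith
  qed
  moreover have "(\<lambda>n. sinc_tail (Suc q) (a + real n) + 1 / (real q * a ^ q)) \<longlonglongrightarrow> 0 + 1 / (real q * a ^ q)"
    using assms by (intro tendsto_intros sinc_tail_tendsto_0) auto
  ultimately have "sinc_tail (Suc q) a \<le> 0 + 1 / (real q * a ^ q)"
    by (intro LIMSEQ_le_const) auto
  then show ?thesis by simp
qed

lemma sin_squared_near_pi:
  assumes "\<bar>y - pi\<bar> \<le> \<beta>" "\<beta> \<le> pi / 2"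
  shows "(sin y)\<^sup>2 \<le> (sin \<beta>)\<^sup>2"
proof -
  have "(sin y)\<^sup>2 = (sin \<bar>y - pi\<bar>)\<^sup>2"
    by (simp add: sin_diff abs_if)
  also have "\<dots> \<le> (sin \<beta>)\<^sup>2"
    using assms by (intro power_mono sin_monotone_2pi_le sin_ge_zero) auto
  finally show ?thesis .
qed

lemma sin_power_near_pi:
  assumes "\<bar>y - pi\<bar> \<le> \<beta>" "\<beta> \<le> pi / 2"
  shows "sin y ^ (2 * j) \<le> ((sin \<beta>)\<^sup>2) ^ j"
  using power_mono[OF sin_squared_near_pi[OF assms], of j] by (simp add: power_mult)

lemma sin_pi_4_squared: "(sin (pi / 4))\<^sup>2 = 1 / 2"
  by (simp add: sin_45 power_divide)

lemma sin_pi_3_squared: "(sin (pi / 3))\<^sup>2 = 3 / 4"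
  by (simp add: sin_60 power_divide)

lemma Bernoulli_second_order:
  assumes "x \<ge> (0::real)"
  shows "1 + real n * x + real n * (real n - 1) / 2 * x\<^sup>2 \<le> (1 + x) ^ n"
proof (induction n)
  case (Suc n)
  have "(1 + x) * (1 + real n * x + real n * (real n - 1) / 2 * x\<^sup>2) \<le> (1 + x) * (1 + x) ^ n"
    using assms by (intro mult_left_mono Suc) auto
  moreover have "(1 + x) * (1 + real n * x + real n * (real n - 1) / 2 * x\<^sup>2)
     = 1 + real (Suc n) * x + real (Suc n) * (real (Suc n) - 1) / 2 * x\<^sup>2 + real n * (real n - 1) / 2 * x ^ 3"
    by (simp add: field_simps power2_eq_square power3_eq_cube)
  moreover have "0 \<le> real n * (real n - 1) / 2 * x ^ 3"
    using assms by (cases n) auto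
  ultimately show ?case by simp
qed simp


text \<open>
  The monotonicity argument: the pointwise hypothesis says that the right-hand side decreases in
  \<open>X\<close> at least as fast as the left-hand side, so that the inequality at \<open>C / 2\<close> implies the one at \<open>X\<close>.
\<close>

lemma sinc_tail_pair_le:
  assumes q: "q \<ge> 1" and m: "m \<ge> 1" and X: "0 < X" "X \<le> C / 2"
    and pointwise: "\<And>y. X \<le> y \<Longrightarrow> y \<le> C / 2 \<Longrightarrow>
      sinc y ^ Suc q - sinc (C - y) ^ Suc q \<le> (\<kappa> * real m / real q) / y ^ Suc m"
    and endpoint: "2 * sinc_tail (Suc q) (C / 2) \<le> \<kappa> / (real q * (C / 2) ^ m)"
  shows "sinc_tail (Suc q) X + sinc_tail (Suc q) (C - X) \<le> \<kappa> / (real q * X ^ m)"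
proof -
  let ?F = "\<lambda>y. - ((\<kappa> * real m / real q) / (real m * y ^ m))"
  have "sinc_tail (Suc q) X + sinc_tail (Suc q) (C - X) \<le> 2 * sinc_tail (Suc q) (C / 2) + (?F (C / 2) - ?F X)"
  proof (rule sinc_tail_pair_step[where f="\<lambda>y. (\<kappa> * real m / real q) / y ^ Suc m"])
    show "(?F has_real_derivative (\<kappa> * real m / real q) / y ^ Suc m) (at y)" if "X \<le> y" "y \<le> C / 2" for y
      using that X m by (intro power_tail_deriv) auto
    show "isCont (\<lambda>y. (\<kappa> * real m / real q) / y ^ Suc m) y" if "X \<le> y" "y \<le> C / 2" for y
      using that X by (intro continuous_intros) auto
  qed (use q X pointwise in auto)
  moreover have "?F y = - (\<kappa> / (real q * y ^ m))" for y
    using m by simp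
  ultimately show ?thesis
    using endpoint by (simp only:)
qed

text \<open>
  On \<open>[\<pi> - \<beta>, \<pi> + \<beta>]\<close> the sine is at most \<open>sin \<beta>\<close> in modulus, and beyond \<open>\<pi> + \<beta>\<close> the power of
  \<open>y\<close> has already decayed.
\<close>

lemma sinc_tail_near_pi:
  assumes j: "j \<ge> 1" and \<beta>: "0 < \<beta>" "\<beta> \<le> pi / 2"
  defines "q \<equiv> 2 * j - 1"
  shows "sinc_tail (2 * j) (pi - \<beta>)
    \<le> (((sin \<beta>)\<^sup>2) ^ j + ((pi - \<beta>) / (pi + \<beta>)) ^ q) / (real q * (pi - \<beta>) ^ q)"
proof -
  have q: "q \<ge> 1" "odd q" "Suc q = 2 * j" using j by (auto simp: q_def)
  have pos: "pi - \<beta> > 0" "pi + \<beta> > 0" using \<beta> pi_gt_zero by auto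
  define c where "c = ((sin \<beta>)\<^sup>2) ^ j"
  define u v where "u = 1 / (real q * (pi - \<beta>) ^ q)" and "v = 1 / (real q * (pi + \<beta>) ^ q)"
  have c: "c \<ge> 0" by (simp add: c_def)
  have "sinc_tail (Suc q) (pi - \<beta>) \<le> sinc_tail (Suc q) (pi + \<beta>) + c * (u - v)"
    unfolding u_def v_def
  proof (rule sinc_tail_power_step)
    show "sin y ^ Suc q \<le> c" if "pi - \<beta> \<le> y" "y \<le> pi + \<beta>" for y
      unfolding q(3) c_def using that \<beta> by (intro sin_power_near_pi) auto
  qed (use q \<beta> pos in auto)
  moreover have "sinc_tail (Suc q) (pi + \<beta>) \<le> v"
    unfolding v_def using q pos by (intro sinc_tail_power_le) auto
  moreover have "0 \<le> c * v"
    using c pos by (simp add: v_def)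
  ultimately have "sinc_tail (Suc q) (pi - \<beta>) \<le> c * u + v"
    by (simp add: algebra_simps)
  also have "v = ((pi - \<beta>) / (pi + \<beta>)) ^ q * u"
    using pos by (simp add: u_def v_def power_divide)
  finally show ?thesis
    unfolding q(3) by (simp add: u_def c_def add_divide_distrib)
qed

lemma sinc_tail_near_pi_le:
  assumes j: "j \<ge> 1" and \<beta>: "0 < \<beta>" "\<beta> \<le> \<gamma>" "\<gamma> \<le> pi / 2"
    and c: "((sin \<gamma>)\<^sup>2) ^ j \<le> c" and d: "((pi - \<beta>) / (pi + \<beta>)) ^ (2 * j - 1) \<le> d"
  shows "sinc_tail (2 * j) (pi - \<beta>) \<le> (c + d) / (real (2 * j - 1) * (pi - \<beta>) ^ (2 * j - 1))"
proof -
  have "(sin \<beta>)\<^sup>2 \<le> (sin \<gamma>)\<^sup>2"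
    using sin_squared_near_pi[of "pi + \<beta>" \<gamma>] \<beta> by simp
  then have "((sin \<beta>)\<^sup>2) ^ j \<le> c"
    using power_mono[of "(sin \<beta>)\<^sup>2" "(sin \<gamma>)\<^sup>2" j] c by simp
  then have "(((sin \<beta>)\<^sup>2) ^ j + ((pi - \<beta>) / (pi + \<beta>)) ^ (2 * j - 1)) / (real (2 * j - 1) * (pi - \<beta>) ^ (2 * j - 1))
      \<le> (c + d) / (real (2 * j - 1) * (pi - \<beta>) ^ (2 * j - 1))"
    using d \<beta> pi_gt_zero by (intro divide_right_mono add_mono mult_nonneg_nonneg zero_le_power) auto
  moreover have "\<beta> \<le> pi / 2" using \<beta> by linarith
  ultimately show ?thesis
    using sinc_tail_near_pi[OF j \<beta>(1)] by (blast intro: order_trans)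
qed

text \<open>
  Here \<open>\<beta> = \<pi> / (2k + 2) \<le> \<pi>/4\<close> gives the summand \<open>1/4\<close>, and the second-order Bernoulli inequality
  gives \<open>(q / (q + 2))\<^sup>q \<le> 3/13\<close>. The sum is below \<open>0.976 / 2\<close>, which is what the pair of tails requires.
\<close>

lemma sinc_tail_endpoint_odd:
  assumes k: "k \<ge> 1"
  defines "q \<equiv> 2 * k + 1" and "X \<equiv> pi * real (2 * k + 1) / real (2 * k + 2)"
  shows "sinc_tail (Suc q) X \<le> (1 / 4 + 3 / 13) / (real q * X ^ q)"
proof -
  define \<beta> where "\<beta> = pi / real (2 * k + 2)"
  have "0 < \<beta>" by (simp add: \<beta>_def)
  moreover have "\<beta> \<le> pi / 4"
    unfolding \<beta>_def by (rule divide_left_mono) (use k in auto)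
  ultimately have \<beta>: "0 < \<beta>" "\<beta> \<le> pi / 4" by auto
  have X: "X = pi - \<beta>"
    by (simp add: X_def \<beta>_def field_simps)
  have "((sin (pi / 4))\<^sup>2) ^ (k + 1) \<le> ((sin (pi / 4))\<^sup>2) ^ 2"
    using k by (intro power_decreasing) (auto simp: sin_pi_4_squared)
  then have s: "((sin (pi / 4))\<^sup>2) ^ (k + 1) \<le> 1 / 4"
    by (simp add: sin_pi_4_squared power_divide)
  have "pi - \<beta> = pi * (real q / real (2 * k + 2))" "pi + \<beta> = pi * ((real q + 2) / real (2 * k + 2))"
    by (simp_all add: \<beta>_def q_def field_simps)
  moreover have "real q / (real q + 2) = 1 / (1 + 2 / real q)"
    by (simp add: q_def field_simps)
  ultimately have "(pi - \<beta>) / (pi + \<beta>) = 1 / (1 + 2 / real q)"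
    by simp
  then have "((pi - \<beta>) / (pi + \<beta>)) ^ q = 1 / (1 + 2 / real q) ^ q"
    by (simp add: power_one_over)
  also have "\<dots> \<le> 1 / (13 / 3)"
  proof (rule divide_left_mono)
    have q3: "real q \<ge> 3" using k by (simp add: q_def)
    have "1 + real q * (2 / real q) + real q * (real q - 1) / 2 * (2 / real q)\<^sup>2 \<le> (1 + 2 / real q) ^ q"
      by (rule Bernoulli_second_order) simp
    moreover have "1 + real q * (2 / real q) + real q * (real q - 1) / 2 * (2 / real q)\<^sup>2 = 5 - 2 / real q"
      using q3 by (simp add: power2_eq_square field_simps)
    moreover have "2 / real q \<le> 2 / 3"
      using q3 by (intro divide_left_mono) auto
    ultimately show "13 / 3 \<le> (1 + 2 / real q) ^ q" by linarith
  qed (auto intro!: mult_pos_pos zero_less_power add_pos_nonneg)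
  finally have r: "((pi - \<beta>) / (pi + \<beta>)) ^ q \<le> 3 / 13" by simp
  have q: "2 * (k + 1) = Suc q" by (simp add: q_def)
  show ?thesis
    using sinc_tail_near_pi_le[of "k + 1" \<beta> "pi / 4" "1 / 4" "3 / 13", OF _ \<beta> _ s] r unfolding X q by simp
qed

text \<open>
  Here \<open>\<beta> = \<pi> / (k + 1) \<le> \<pi>/3\<close> gives the summand \<open>(3/4)\<^sup>3\<close>, and Bernoulli's inequality the other one.
  A factor \<open>X \<ge> 2\<close> is in reserve in this case.
\<close>

lemma sinc_tail_endpoint_even:
  assumes k: "k \<ge> 2"
  defines "q \<equiv> 2 * k + 1" and "X \<equiv> pi * real k / real (k + 1)"
  shows "sinc_tail (Suc q) X \<le> (27 / 64 + 1 / 5) / (real q * X ^ q)"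
proof -
  define \<beta> where "\<beta> = pi / real (k + 1)"
  have "0 < \<beta>" by (simp add: \<beta>_def)
  moreover have "\<beta> \<le> pi / 3"
    unfolding \<beta>_def by (rule divide_left_mono) (use k in auto)
  ultimately have \<beta>: "0 < \<beta>" "\<beta> \<le> pi / 3" by auto
  have X: "X = pi - \<beta>"
    by (simp add: X_def \<beta>_def field_simps)
  have "((sin (pi / 3))\<^sup>2) ^ (k + 1) \<le> ((sin (pi / 3))\<^sup>2) ^ 3"
    using k by (intro power_decreasing) (auto simp: sin_pi_3_squared)
  then have s: "((sin (pi / 3))\<^sup>2) ^ (k + 1) \<le> 27 / 64"
    by (simp add: sin_pi_3_squared power_divide)
  have "pi - \<beta> = pi * (real k / (real k + 1))" "pi + \<beta> = pi * ((real k + 2) / (real k + 1))"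
    by (simp_all add: \<beta>_def field_simps)
  moreover have "real k / (real k + 2) = 1 / (1 + 2 / real k)"
    using k by (simp add: field_simps)
  ultimately have "(pi - \<beta>) / (pi + \<beta>) = 1 / (1 + 2 / real k)"
    by simp
  then have "((pi - \<beta>) / (pi + \<beta>)) ^ q = 1 / (1 + 2 / real k) ^ q"
    by (simp add: power_one_over)
  also have "\<dots> \<le> 1 / 5"
  proof (rule divide_left_mono)
    have "1 + real q * (2 / real k) \<le> (1 + 2 / real k) ^ q"
      by (rule Bernoulli_inequality) (auto intro: order_trans[of _ 0])
    moreover have "1 + real q * (2 / real k) = 5 + 2 / real k"
      using k by (simp add: q_def field_simps)
    ultimately show "5 \<le> (1 + 2 / real k) ^ q"
      by (smt (verit) divide_nonneg_nonneg of_nat_0_le_iff)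
  qed (auto intro!: mult_pos_pos zero_less_power add_pos_nonneg)
  finally have r: "((pi - \<beta>) / (pi + \<beta>)) ^ q \<le> 1 / 5" .
  have q: "2 * (k + 1) = Suc q" by (simp add: q_def)
  show ?thesis
    using sinc_tail_near_pi_le[of "k + 1" \<beta> "pi / 3" "27 / 64" "1 / 5", OF _ \<beta> _ s] r unfolding X q by simp
qed

text \<open>
  The sine attains its maximum at the starting point, so the interval has to be subdivided. With the
  bounds \<open>1\<close>, \<open>9/16\<close>, \<open>1/4\<close>, \<open>1\<close> for \<open>sin\<^sup>4\<close> on the intervals between \<open>\<pi>/2\<close>, \<open>2\<pi>/3\<close>, \<open>3\<pi>/4\<close>, \<open>5\<pi>/4\<close> and
  infinity the claim follows from \<open>12.4 \<le> 4 \<pi>\<close>.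
\<close>

lemma sinc_tail_endpoint_two: "2 * sinc_tail 4 (pi / 2) \<le> 1 / (3 * (pi / 2)\<^sup>2)"
proof -
  have step: "sinc_tail 4 a \<le> sinc_tail 4 b + c * (1 / (3 * a ^ 3) - 1 / (3 * b ^ 3))"
    if "0 < a" "a \<le> b" "\<And>y. a \<le> y \<Longrightarrow> y \<le> b \<Longrightarrow> sin y ^ 4 \<le> c" for a b c
    using sinc_tail_power_step[of 3 a b c] that by simp
  have near: "sin y ^ 4 \<le> ((sin \<beta>)\<^sup>2)\<^sup>2" if "\<bar>y - pi\<bar> \<le> \<beta>" "\<beta> \<le> pi / 2" for y \<beta>
    using sin_power_near_pi[OF that, of 2] by simp
  have 1: "sinc_tail 4 (pi / 2) \<le> sinc_tail 4 (2 * pi / 3) + 1 * (1 / (3 * (pi / 2) ^ 3) - 1 / (3 * (2 * pi / 3) ^ 3))"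
    by (rule step) (auto intro: sin_even_power_le_1)
  have 2: "sinc_tail 4 (2 * pi / 3) \<le> sinc_tail 4 (3 * pi / 4) + 9 / 16 * (1 / (3 * (2 * pi / 3) ^ 3) - 1 / (3 * (3 * pi / 4) ^ 3))"
  proof (rule step)
    show "sin y ^ 4 \<le> 9 / 16" if "2 * pi / 3 \<le> y" "y \<le> 3 * pi / 4" for y
      using near[of y "pi / 3"] that pi_gt_zero by (simp add: sin_pi_3_squared power_divide abs_if)
  qed auto
  have 3: "sinc_tail 4 (3 * pi / 4) \<le> sinc_tail 4 (5 * pi / 4) + 1 / 4 * (1 / (3 * (3 * pi / 4) ^ 3) - 1 / (3 * (5 * pi / 4) ^ 3))"
  proof (rule step)
    show "sin y ^ 4 \<le> 1 / 4" if "3 * pi / 4 \<le> y" "y \<le> 5 * pi / 4" for y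
      using near[of y "pi / 4"] that pi_gt_zero by (simp add: sin_pi_4_squared power_divide abs_if)
  qed auto
  have 4: "sinc_tail 4 (5 * pi / 4) \<le> 1 / (3 * (5 * pi / 4) ^ 3)"
    using sinc_tail_power_le[of 3 "5 * pi / 4"] by simp
  define w where "w = 1 / (3 * pi ^ 3)"
  have w: "1 / (3 * (pi / 2) ^ 3) = 8 * w" "1 / (3 * (2 * pi / 3) ^ 3) = 27 / 8 * w"
    "1 / (3 * (3 * pi / 4) ^ 3) = 64 / 27 * w" "1 / (3 * (5 * pi / 4) ^ 3) = 64 / 125 * w"
    by (simp_all add: w_def power3_eq_cube)
  have "w > 0" by (simp add: w_def)
  have "2 * sinc_tail 4 (pi / 2) \<le> 12.4 * w"
    using 1 2 3 4 \<open>w > 0\<close> unfolding w by simp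
  also have "\<dots> \<le> 4 * pi * w"
    using pi_approx(1) \<open>w > 0\<close> by (intro mult_right_mono) auto
  also have "\<dots> = 1 / (3 * (pi / 2)\<^sup>2)"
    by (simp add: w_def power2_eq_square power3_eq_cube)
  finally show ?thesis .
qed


lemma sin_le_quintic:
  fixes x :: real
  assumes "0 \<le> x"
  shows "sin x \<le> x - x ^ 3 / 6 + x ^ 5 / 120"
proof -
  have "\<bar>sin x - (\<Sum>m<5. sin_coeff m * x ^ m)\<bar> \<le> inverse (fact 5) * \<bar>x\<bar> ^ 5"
    by (rule Maclaurin_sin_bound)
  moreover have "(\<Sum>m<5. sin_coeff m * x ^ m) = x - x ^ 3 / 6"
  proof -
    have "{..<5::nat} = {0, 1, 2, 3, 4}" by auto
    then show ?thesis by (simp add: sin_coeff_def fact_numeral)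
  qed
  moreover have "inverse (fact 5) * \<bar>x\<bar> ^ 5 = x ^ 5 / 120"
    using assms by (simp add: fact_numeral)
  ultimately show ?thesis by linarith
qed

lemma sin_power4_le:
  assumes "0 \<le> y" "y \<le> b" "b \<le> pi / 2" "b - b ^ 3 / 6 + b ^ 5 / 120 \<le> c"
  shows "sin y ^ 4 \<le> c ^ 4"
proof (rule power_mono)
  show "0 \<le> sin y" using assms pi_gt_zero by (intro sin_ge_zero) auto
  have "sin y \<le> sin b" using assms by (intro sin_monotone_2pi_le) auto
  also have "\<dots> \<le> c" using sin_le_quintic[of b] assms by linarith
  finally show "sin y \<le> c" .
qed

lemma pi_bounds: "3.1415 < pi" "pi < 3.1416"
  using pi_approx by auto

lemma reflected_ratio_ge:
  assumes "0 \<le> a" "a \<le> y" "y < pi" "0 \<le> d" "d * (3.1416 - a) \<le> a"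
  shows "d ^ 4 \<le> (y / (pi - y)) ^ 4"
proof (rule power_mono)
  have "d * (pi - y) \<le> d * (3.1416 - a)"
    using assms pi_bounds by (intro mult_left_mono) auto
  then have "d * (pi - y) \<le> y" using assms by linarith
  then show "d \<le> y / (pi - y)" using assms by (simp add: pos_le_divide_eq)
qed (use assms in auto)

text \<open>
  Near \<open>y = 1.4\<close> the inequality \<open>sin\<^sup>4 y \<le> 2 y / 3\<close> is false; the contribution of the mirror point
  \<open>\<pi> - y\<close> is what makes the estimate true. On each of four intervals the factors are bounded by their values
  at an endpoint.
\<close>

lemma sin4_reflected_le:
  assumes y: "1 \<le> y" "y \<le> pi / 2"
  shows "sin y ^ 4 * (1 - (y / (pi - y)) ^ 4) \<le> 2 / 3 * y"
proof -
  have s0: "0 \<le> sin y ^ 4" by simp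
  have s1: "sin y ^ 4 \<le> 1" by (rule sin_even_power_le_1) simp
  have r0: "0 \<le> (y / (pi - y)) ^ 4" by simp
  have *: "sin y ^ 4 * (1 - (y / (pi - y)) ^ 4) \<le> c * e"
    if "sin y ^ 4 \<le> c" "1 - (y / (pi - y)) ^ 4 \<le> e" "0 \<le> e" for c e
    using mult_left_mono[OF that(2) s0] mult_right_mono[OF that(1,3)] by linarith
  have ypi: "y < pi" using y pi_gt_zero by linarith
  consider "y \<le> 1.1" | "1.1 \<le> y" "y \<le> 1.2" | "1.2 \<le> y" "y \<le> 1.3" | "1.3 \<le> y" by linarith
  then show ?thesis
  proof cases
    case 1
    have "sin y ^ 4 \<le> 0.892 ^ 4"
      by (rule sin_power4_le[of _ "1.1"]) (use 1 y pi_bounds in \<open>simp_all add: eval_nat_numeral\<close>)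
    from *[OF this, of 1] r0 have "sin y ^ 4 * (1 - (y / (pi - y)) ^ 4) \<le> 0.892 ^ 4 * 1" by simp
    also have "\<dots> \<le> 2 / 3 * 1" by (simp add: eval_nat_numeral)
    finally show ?thesis using y by linarith
  next
    case 2
    have "sin y ^ 4 \<le> 0.933 ^ 4"
      by (rule sin_power4_le[of _ "1.2"]) (use 2 y pi_bounds in \<open>simp_all add: eval_nat_numeral\<close>)
    moreover have "0.538 ^ 4 \<le> (y / (pi - y)) ^ 4"
      by (rule reflected_ratio_ge[of "1.1"]) (use 2 ypi in simp_all)
    ultimately have "sin y ^ 4 * (1 - (y / (pi - y)) ^ 4) \<le> 0.933 ^ 4 * (1 - 0.538 ^ 4)"
      by (intro *) (simp_all add: eval_nat_numeral)
    also have "\<dots> \<le> 2 / 3 * 1.1" by (simp add: eval_nat_numeral)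
    finally show ?thesis using 2 by linarith
  next
    case 3
    have "sin y ^ 4 \<le> 0.965 ^ 4"
      by (rule sin_power4_le[of _ "1.3"]) (use 3 y pi_bounds in \<open>simp_all add: eval_nat_numeral\<close>)
    moreover have "0.618 ^ 4 \<le> (y / (pi - y)) ^ 4"
      by (rule reflected_ratio_ge[of "1.2"]) (use 3 ypi in simp_all)
    ultimately have "sin y ^ 4 * (1 - (y / (pi - y)) ^ 4) \<le> 0.965 ^ 4 * (1 - 0.618 ^ 4)"
      by (intro *) (simp_all add: eval_nat_numeral)
    also have "\<dots> \<le> 2 / 3 * 1.2" by (simp add: eval_nat_numeral)
    finally show ?thesis using 3 by linarith
  next
    case 4
    have "0.705 ^ 4 \<le> (y / (pi - y)) ^ 4"
      by (rule reflected_ratio_ge[of "1.3"]) (use 4 ypi in simp_all)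
    then have "sin y ^ 4 * (1 - (y / (pi - y)) ^ 4) \<le> 1 * (1 - 0.705 ^ 4)"
      by (intro * s1) (simp_all add: eval_nat_numeral)
    also have "\<dots> \<le> 2 / 3 * 1.3" by (simp add: eval_nat_numeral)
    finally show ?thesis using 4 by linarith
  qed
qed


lemma sin_ge_cubic:
  fixes x :: real
  assumes "0 \<le> x"
  shows "x - x ^ 3 / 6 \<le> sin x"
proof -
  have "(\<lambda>x. sin x - (x - x ^ 3 / 6)) 0 \<le> (\<lambda>x. sin x - (x - x ^ 3 / 6)) x"
  proof (rule DERIV_nonneg_imp_nondecreasing[OF assms])
    fix y :: real
    have d: "((\<lambda>x. sin x - (x - x ^ 3 / 6)) has_real_derivative cos y - (1 - y\<^sup>2 / 2)) (at y)"
      by (auto intro!: derivative_eq_intros simp: power2_eq_square)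
    have "cos y = 1 - 2 * (sin (y / 2))\<^sup>2"
      using cos_double_sin[of "y / 2"] by simp
    moreover have "(sin (y / 2))\<^sup>2 \<le> (y / 2)\<^sup>2"
      using abs_sin_x_le_abs_x[of "y / 2"] by (simp only: abs_le_square_iff)
    ultimately have "0 \<le> cos y - (1 - y\<^sup>2 / 2)"
      by (simp add: power_divide)
    with d show "\<exists>D. ((\<lambda>x. sin x - (x - x ^ 3 / 6)) has_real_derivative D) (at y) \<and> 0 \<le> D"
      by blast
  qed
  then show ?thesis by simp
qed

text \<open>
  The point \<open>5/3\<close> is the smallest value of \<open>m / s\<close> for odd \<open>m \<ge> 5\<close>. The constant is such that its cube is
  below \<open>0.976\<close>.
\<close>

lemma sin_squared_le_beyond_5_3:
  assumes "5 / 3 \<le> y" "y \<le> pi"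
  shows "(sin y)\<^sup>2 \<le> 0.9909"
proof -
  \<comment> \<open>a lower bound for \<open>5/3 - \<pi>/2\<close>\<close>
  define e :: real where "e = 0.0958"
  have e: "0 \<le> e" "e \<le> y - pi / 2" "y - pi / 2 \<le> pi / 2"
    using assms pi_bounds by (auto simp: e_def)
  have "0.0956 \<le> e - e ^ 3 / 6"
    by (simp add: e_def power3_eq_cube)
  also have "\<dots> \<le> sin e"
    by (rule sin_ge_cubic[OF e(1)])
  also have "\<dots> \<le> sin (y - pi / 2)"
    using e by (intro sin_monotone_2pi_le) auto
  also have "\<dots> = - cos y"
    by (simp add: sin_diff)
  finally have "0.0956\<^sup>2 \<le> (- cos y)\<^sup>2"
    by (rule power_mono) simp
  then have "0.0091 \<le> (cos y)\<^sup>2"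
    by (simp add: power2_eq_square)
  then show ?thesis
    by (simp add: sin_squared_eq)
qed

text \<open>
  The fraction of the claimed constant that is available to the tails. The remaining 2.4 percent pay
  for the lower bound on the central value of the B-spline; for \<open>s = 2\<close> this value is known exactly.
\<close>

definition tail_factor :: "nat \<Rightarrow> real" where
  "tail_factor s = (if s = 2 then 1 else 0.976)"

lemma sinc_tail_pair_two:
  assumes "1 \<le> X" "X \<le> pi / 2"
  shows "sinc_tail 4 X + sinc_tail 4 (pi - X) \<le> 1 / (3 * X\<^sup>2)"
proof -
  have "sinc_tail (Suc 3) X + sinc_tail (Suc 3) (pi - X) \<le> 1 / (real 3 * X ^ 2)"
  proof (rule sinc_tail_pair_le)
    show "2 * sinc_tail (Suc 3) (pi / 2) \<le> 1 / (real 3 * (pi / 2) ^ 2)"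
      using sinc_tail_endpoint_two by simp
    show "sinc y ^ Suc 3 - sinc (pi - y) ^ Suc 3 \<le> (1 * real 2 / real 3) / y ^ Suc 2" if "X \<le> y" "y \<le> pi / 2" for y
    proof -
      have y: "1 \<le> y" "y < pi" "y > 0" using that assms pi_gt_zero by linarith+
      have "sinc y ^ 4 - sinc (pi - y) ^ 4 = (sin y ^ 4 * (1 - (y / (pi - y)) ^ 4)) / y ^ 4"
        using y by (simp add: power_divide field_simps)
      also have "\<dots> \<le> (2 / 3 * y) / y ^ 4"
        using y that by (intro divide_right_mono sin4_reflected_le) auto
      also have "\<dots> = (1 * real 2 / real 3) / y ^ Suc 2"
        using y by (simp add: eval_nat_numeral)
      finally show ?thesis by simp
    qed
  qed (use assms in auto)
  then show ?thesis by simp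
qed

lemma sinc_power_le:
  assumes "y > 0" "sin y ^ p \<le> c"
  shows "sinc y ^ p \<le> c / y ^ p"
  using assms by (simp add: power_divide divide_right_mono)

text \<open>
  The exponent of the sine exceeds that of \<open>1/X\<close> by exactly one, so the pointwise condition is
  \<open>sin\<^sup>p \<le> tail_factor\<close>. It is trivial for \<open>k = 1\<close>; for larger \<open>k\<close> it holds because
  \<open>y \<ge> m / s \<ge> 5/3\<close> lies beyond the maximum of the sine.
\<close>

lemma sinc_tail_pair_odd:
  assumes k: "k \<ge> 1" and X: "real (2 * k + 1) / real (k + 1) \<le> X" "X \<le> pi * real (2 * k + 1) / real (2 * k + 2)"
  shows "sinc_tail (2 * k + 2) X + sinc_tail (2 * k + 2) (pi * real (2 * k + 1) / real (k + 1) - X)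
     \<le> tail_factor (k + 1) / (real (2 * k + 1) * X ^ (2 * k + 1))"
proof -
  let ?q = "2 * k + 1" and ?C = "pi * real (2 * k + 1) / real (k + 1)"
  have C2: "?C / 2 = pi * real (2 * k + 1) / real (2 * k + 2)"
    by (simp add: field_simps)
  have X0: "X > 0"
    by (rule less_le_trans[OF _ X(1)]) (intro divide_pos_pos, auto)
  have Cpi: "?C / 2 \<le> pi"
    unfolding C2 by (simp add: field_simps)
  have "sinc_tail (Suc ?q) X + sinc_tail (Suc ?q) (?C - X) \<le> tail_factor (k + 1) / (real ?q * X ^ ?q)"
  proof (rule sinc_tail_pair_le)
    show "2 * sinc_tail (Suc ?q) (?C / 2) \<le> tail_factor (k + 1) / (real ?q * (?C / 2) ^ ?q)"
    proof -
      have "2 * sinc_tail (Suc ?q) (?C / 2) \<le> 2 * ((1 / 4 + 3 / 13) / (real ?q * (?C / 2) ^ ?q))"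
        unfolding C2 by (intro mult_left_mono sinc_tail_endpoint_odd k) simp
      also have "\<dots> = (25 / 26) / (real ?q * (?C / 2) ^ ?q)"
        unfolding times_divide_eq_right by (rule arg_cong[where f="\<lambda>c. c / (real ?q * (?C / 2) ^ ?q)"]) simp
      also have "\<dots> \<le> tail_factor (k + 1) / (real ?q * (?C / 2) ^ ?q)"
        using X0 X(2) unfolding C2[symmetric] by (intro divide_right_mono) (auto simp: tail_factor_def)
      finally show ?thesis .
    qed
    show "sinc y ^ Suc ?q - sinc (?C - y) ^ Suc ?q \<le> (tail_factor (k + 1) * real ?q / real ?q) / y ^ Suc ?q"
      if y: "X \<le> y" "y \<le> ?C / 2" for y
    proof -
      have "sin y ^ Suc ?q \<le> tail_factor (k + 1)"
      proof (cases "k = 1")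
        case True
        then show ?thesis using sin_even_power_le_1[of "Suc ?q" y] by (simp add: tail_factor_def)
      next
        case False
        with k have k2: "k \<ge> 2" by simp
        have "5 / 3 \<le> real (2 * k + 1) / real (k + 1)"
          using k2 by (simp add: field_simps)
        then have "5 / 3 \<le> y" "y \<le> pi"
          using X(1) y Cpi by linarith+
        then have "(sin y)\<^sup>2 \<le> 0.9909"
          by (rule sin_squared_le_beyond_5_3)
        then have "((sin y)\<^sup>2) ^ (k + 1) \<le> 0.9909 ^ (k + 1)"
          by (rule power_mono) simp
        also have "\<dots> \<le> 0.9909 ^ 3"
          using k2 by (intro power_decreasing) auto
        also have "\<dots> \<le> 0.976"
          by (simp add: power3_eq_cube)
        finally have "sin y ^ (2 * (k + 1)) \<le> 0.976"
          by (simp only: power_mult)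
        then show ?thesis using k2 by (simp add: tail_factor_def)
      qed
      then have "sinc y ^ Suc ?q \<le> tail_factor (k + 1) / y ^ Suc ?q"
        using X0 y by (intro sinc_power_le) auto
      moreover have "0 \<le> sinc (?C - y) ^ Suc ?q"
        by (rule zero_le_even_power) simp
      ultimately show ?thesis by simp
    qed
    show "X \<le> ?C / 2"
      unfolding C2 by (rule X(2))
  qed (use X0 k in auto)
  then show ?thesis by simp
qed

text \<open>
  The exponents differ by two, and the additional factor \<open>1/y \<le> s/m\<close> already yields the pointwise
  condition with the trivial bound for the sine.
\<close>

lemma sinc_tail_pair_even:
  assumes k: "k \<ge> 2" and X: "real (2 * k) / real (k + 1) \<le> X" "X \<le> pi * real k / real (k + 1)"
  shows "sinc_tail (2 * k + 2) X + sinc_tail (2 * k + 2) (pi * real (2 * k) / real (k + 1) - X)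
     \<le> 0.976 / (real (2 * k + 1) * X ^ (2 * k))"
proof -
  let ?q = "2 * k + 1" and ?C = "pi * real (2 * k) / real (k + 1)"
  have C2: "?C / 2 = pi * real k / real (k + 1)"
    by (simp add: field_simps)
  have X0: "X > 0"
    by (rule less_le_trans[OF _ X(1)]) (intro divide_pos_pos, use k in auto)
  have "sinc_tail (Suc ?q) X + sinc_tail (Suc ?q) (?C - X) \<le> 0.976 / (real ?q * X ^ (2 * k))"
  proof (rule sinc_tail_pair_le)
    show "2 * sinc_tail (Suc ?q) (?C / 2) \<le> 0.976 / (real ?q * (?C / 2) ^ (2 * k))"
    proof -
      define Z where "Z = ?C / 2"
      have Z0: "Z > 0" using X0 X(2) unfolding Z_def C2 by linarith
      have "2 \<le> pi * (2 / 3)" using pi_gt3 by simp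
      also have "\<dots> \<le> pi * (real k / real (k + 1))"
        using k by (intro mult_left_mono) (auto simp: field_simps)
      finally have Z2: "2 \<le> Z" unfolding Z_def C2 by simp
      have "2 * sinc_tail (Suc ?q) Z \<le> 2 * ((27 / 64 + 1 / 5) / (real ?q * Z ^ ?q))"
        unfolding Z_def C2 by (intro mult_left_mono sinc_tail_endpoint_even k) simp
      also have "\<dots> \<le> (0.976 * Z) / (real ?q * Z ^ ?q)"
        unfolding times_divide_eq_right using Z2 by (intro divide_right_mono) auto
      also have "\<dots> = 0.976 / (real ?q * Z ^ (2 * k))"
        using Z0 by simp
      finally show ?thesis unfolding Z_def .
    qed
    show "sinc y ^ Suc ?q - sinc (?C - y) ^ Suc ?q \<le> (0.976 * real (2 * k) / real ?q) / y ^ Suc (2 * k)"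
      if y: "X \<le> y" "y \<le> ?C / 2" for y
    proof -
      have y0: "y > 0" using X0 y by linarith
      have "1 \<le> 0.976 * real (2 * k) / real ?q * (real (2 * k) / real (k + 1))"
      proof -
        have "2 * real k \<le> real k * real k"
          using k by (intro mult_right_mono) auto
        moreover have "2 \<le> real k" using k by simp
        ultimately have "125 + real k * 375 \<le> real k * (real k * 238)" by linarith
        then have "real ?q * real (k + 1) \<le> 0.976 * real (2 * k) * real (2 * k)"
          by (simp add: algebra_simps)
        then show ?thesis by (simp add: field_simps)
      qed
      also have "\<dots> \<le> 0.976 * real (2 * k) / real ?q * y"
        using X(1) y by (intro mult_left_mono) auto
      finally have "1 \<le> 0.976 * real (2 * k) / real ?q * y" .
      moreover have "sin y ^ Suc ?q \<le> 1"
        by (rule sin_even_power_le_1) simp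
      ultimately have "sin y ^ Suc ?q \<le> 0.976 * real (2 * k) / real ?q * y"
        by (rule order_trans[rotated])
      then have "sinc y ^ Suc ?q \<le> (0.976 * real (2 * k) / real ?q * y) / y ^ Suc ?q"
        using y0 by (intro sinc_power_le)
      also have "\<dots> = (0.976 * real (2 * k) / real ?q) / y ^ Suc (2 * k)"
        using y0 by simp
      finally have "sinc y ^ Suc ?q \<le> (0.976 * real (2 * k) / real ?q) / y ^ Suc (2 * k)" .
      moreover have "0 \<le> sinc (?C - y) ^ Suc ?q"
        by (rule zero_le_even_power) simp
      ultimately show ?thesis by linarith
    qed
  qed (use X X0 C2 k in auto)
  then show ?thesis by simp
qed

text \<open>
  The power is \<open>X\<^sup>m\<close> rather than the natural \<open>X\<^sup>2\<^sup>s\<^sup>-\<^sup>1\<close>. The two agree for odd \<open>m\<close>; for even \<open>m\<close> this is a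
  weaker claim, since \<open>X \<ge> 1\<close>.
\<close>

lemma sinc_tail_pair_bound:
  fixes m s :: nat
  assumes m: "m \<ge> 2" and s: "s = nat \<lceil>(real m + 1) / 2\<rceil>"
    and X: "real m / real s \<le> X" "X \<le> pi * real m / (2 * real s)"
  shows "sinc_tail (2 * s) X + sinc_tail (2 * s) (pi * real m / real s - X) \<le> tail_factor s / ((2 * real s - 1) * X ^ m)"
proof (cases "even m")
  case True
  then obtain k where k: "m = 2 * k" by (elim evenE)
  have "\<lceil>(real m + 1) / 2\<rceil> = int k + 1"
    unfolding k by (rule ceiling_unique) auto
  then have sk: "s = k + 1" unfolding s by simp
  show ?thesis
  proof (cases "k = 1")
    case True
    then show ?thesis
      using sinc_tail_pair_two[of X] X by (simp add: k sk tail_factor_def)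
  next
    case False
    with m k have "k \<ge> 2" by simp
    moreover have "X \<le> pi * real k / real (k + 1)"
      using X(2) by (simp add: k sk field_simps)
    ultimately show ?thesis
      using sinc_tail_pair_even[of k X] X by (simp add: k sk tail_factor_def)
  qed
next
  case False
  then obtain k where k: "m = 2 * k + 1" by (elim oddE)
  have "\<lceil>(real m + 1) / 2\<rceil> = int k + 1"
    unfolding k by (rule ceiling_unique) auto
  then have sk: "s = k + 1" unfolding s by simp
  have "k \<ge> 1" using m k by simp
  then show ?thesis
    using sinc_tail_pair_odd[of k X] X by (simp add: k sk algebra_simps)
qed

section \<open>The central value of the B-spline\<close>

lemma bspline_at_0:
  assumes "n \<ge> 2"
  shows "bspline n 0 = (LBINT y. sinc y ^ n) / pi"
proof -
  have "complex_of_real (bspline n 0) = (LBINT y. complex_of_real (sinc y ^ n / pi))"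
    using bspline_inversion[OF assms, of 0] by simp
  also have "\<dots> = complex_of_real (LBINT y. sinc y ^ n / pi)"
    by (rule integral_complex_of_real)
  finally have "bspline n 0 = (LBINT y. sinc y ^ n / pi)"
    by (simp only: of_real_eq_iff)
  then show ?thesis by simp
qed

lemma bspline_2: "bspline 2 x = max 0 (1 - \<bar>x\<bar>)"
proof -
  have "bspline 2 x = conv centered_box (bspline 1) x"
    using bspline_Suc[of 1] by (simp add: numeral_2_eq_2)
  also have "\<dots> = (LBINT u. indicator {max (x - 1/2) (-1/2)..min (x + 1/2) (1/2)} u)"
    unfolding conv_box_eq bspline_1 by (intro Bochner_Integration.integral_cong) (auto simp: indicator_def)
  also have "\<dots> = max 0 (1 - \<bar>x\<bar>)"
    by (auto simp: max_def min_def abs_if)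
  finally show ?thesis .
qed

lemma abs_primitive: "((\<lambda>u. u * \<bar>u\<bar> / 2) has_real_derivative \<bar>u\<bar>) (at (u::real))"
proof -
  consider "u > 0" | "u < 0" | "u = 0" by linarith
  then show ?thesis
  proof cases
    case 1
    show ?thesis
    proof (rule has_field_derivative_transform_within_open)
      show "((\<lambda>u. u * u / 2) has_real_derivative \<bar>u\<bar>) (at u)"
        using 1 by (auto intro!: derivative_eq_intros)
    qed (use 1 in \<open>auto simp: open_greaterThan intro!: open_greaterThan[of 0]\<close>)
  next
    case 2
    show ?thesis
    proof (rule has_field_derivative_transform_within_open)
      show "((\<lambda>u. - (u * u) / 2) has_real_derivative \<bar>u\<bar>) (at u)"
        using 2 by (auto intro!: derivative_eq_intros)
    qed (use 2 in \<open>auto intro!: open_lessThan[of 0]\<close>)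
  next
    case 3
    have "((\<lambda>y::real. \<bar>y\<bar> / 2) \<longlongrightarrow> \<bar>0\<bar> / 2) (at 0)"
      by (intro tendsto_intros) auto
    moreover have "\<forall>\<^sub>F y::real in at 0. \<bar>y\<bar> / 2 = (y * \<bar>y\<bar> / 2 - 0 * \<bar>0\<bar> / 2) / (y - 0)"
      by (auto simp: eventually_at_filter)
    ultimately have "((\<lambda>y. (y * \<bar>y\<bar> / 2 - 0 * \<bar>0\<bar> / 2) / (y - 0)) \<longlongrightarrow> \<bar>0\<bar> / 2) (at (0::real))"
      by (rule Lim_transform_eventually)
    then show ?thesis
      unfolding has_field_derivative_iff 3 by simp
  qed
qed

lemma bspline_3:
  assumes "\<bar>x\<bar> \<le> 1/2"
  shows "bspline 3 x = 3 / 4 - x\<^sup>2"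
proof -
  have "bspline 3 x = conv centered_box (bspline 2) x"
    using bspline_Suc[of 2] by (simp add: numeral_3_eq_3 numeral_2_eq_2)
  also have "\<dots> = (LBINT u. (1 - \<bar>u\<bar>) * indicator {x - 1/2..x + 1/2} u)"
    unfolding conv_box_eq bspline_2 using assms
    by (intro Bochner_Integration.integral_cong) (auto simp: indicator_def abs_if split: if_splits)
  also have "\<dots> = (\<lambda>u. u - u * \<bar>u\<bar> / 2) (x + 1/2) - (\<lambda>u. u - u * \<bar>u\<bar> / 2) (x - 1/2)"
    by (rule integral_FTC_Icc_real) (auto intro!: DERIV_diff DERIV_ident abs_primitive continuous_intros)
  also have "\<dots> = 3 / 4 - x\<^sup>2"
  proof -
    have "\<bar>x + 1/2\<bar> = x + 1/2" "\<bar>x - 1/2\<bar> = 1/2 - x"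
      using assms by (auto simp: abs_if split: if_splits)
    then show ?thesis by (simp only:) (simp add: field_simps power2_eq_square)
  qed
  finally show ?thesis .
qed

text \<open>
  The case \<open>m = 2\<close> of the error estimate leaves too little room for a mere lower bound of this value. It
  is computed from the explicit formulas for the splines of lower order.
\<close>

lemma bspline_4_at_0: "bspline 4 0 = 2 / 3"
proof -
  have "bspline 4 0 = conv centered_box (bspline 3) 0"
    using bspline_Suc[of 3] by (simp add: eval_nat_numeral)
  also have "\<dots> = (LBINT u. (3 / 4 - u\<^sup>2) * indicator {- 1/2..1/2} u)"
    unfolding conv_box_eq
    by (intro Bochner_Integration.integral_cong) (auto simp: indicator_def bspline_3)
  also have "\<dots> = (\<lambda>u. 3 / 4 * u - u ^ 3 / 3) (1/2) - (\<lambda>u. 3 / 4 * u - u ^ 3 / 3) (- 1/2)"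
    by (rule integral_FTC_Icc_real) (auto intro!: derivative_eq_intros simp: power2_eq_square)
  also have "\<dots> = 2 / 3"
    by (simp add: power3_eq_cube)
  finally show ?thesis .
qed

text \<open>
  Up to scaling this is Wallis' integral \<open>J\<^sub>n = \<integral> (1 - u\<^sup>2)\<^sup>n du\<close> over \<open>[-1, 1]\<close>.
\<close>

definition wallis_integral :: "nat \<Rightarrow> real" where
  "wallis_integral n = (LBINT y. (1 - y\<^sup>2 / 6) ^ n * indicator {- sqrt 6..sqrt 6} y)"

lemma wallis_integral_0: "wallis_integral 0 = 2 * sqrt 6"
  by (simp add: wallis_integral_def)

lemma wallis_integrable: "integrable lborel (\<lambda>y::real. (1 - y\<^sup>2 / 6) ^ n * indicator {- sqrt 6..sqrt 6} y)"
proof -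
  have "integrable lborel (\<lambda>y::real. indicator {- sqrt 6..sqrt 6} y *\<^sub>R (1 - y\<^sup>2 / 6) ^ n)"
    by (intro borel_integrable_compact) (auto intro!: continuous_intros)
  then show ?thesis by (simp add: mult.commute)
qed

text \<open>
  Integration by parts, in the form that \<open>y (1 - y\<^sup>2/6)\<^sup>n\<^sup>+\<^sup>1\<close> vanishes at both ends.
\<close>

lemma wallis_integral_Suc: "wallis_integral (Suc n) = real (2 * n + 2) / real (2 * n + 3) * wallis_integral n"
proof -
  let ?g = "\<lambda>y::real. 1 - y\<^sup>2 / 6"
  have "(LBINT y. (real (2 * n + 3) * ?g y ^ Suc n - real (2 * n + 2) * ?g y ^ n) * indicator {- sqrt 6..sqrt 6} y)
     = (\<lambda>y. y * ?g y ^ Suc n) (sqrt 6) - (\<lambda>y. y * ?g y ^ Suc n) (- sqrt 6)"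
  proof (rule integral_FTC_Icc_real)
    show "((\<lambda>y. y * ?g y ^ Suc n) has_real_derivative real (2 * n + 3) * ?g y ^ Suc n - real (2 * n + 2) * ?g y ^ n) (at y)" for y
    proof -
      have "((\<lambda>y. y * ?g y ^ Suc n) has_real_derivative ?g y ^ Suc n + y * (real (Suc n) * ?g y ^ n * (- (2 * y / 6)))) (at y)"
        by (auto intro!: derivative_eq_intros simp del: power_Suc)
      moreover have "?g y ^ Suc n + y * (real (Suc n) * ?g y ^ n * (- (2 * y / 6))) = real (2 * n + 3) * ?g y ^ Suc n - real (2 * n + 2) * ?g y ^ n"
        by (simp add: field_simps power2_eq_square)
      ultimately show ?thesis by simp
    qed
  qed (auto intro!: continuous_intros)
  also have "\<dots> = 0" by simp
  finally have "(LBINT y. real (2 * n + 3) * (?g y ^ Suc n * indicator {- sqrt 6..sqrt 6} y) - real (2 * n + 2) * (?g y ^ n * indicator {- sqrt 6..sqrt 6} y)) = 0"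
    by (simp only: left_diff_distrib mult.assoc)
  then have "real (2 * n + 3) * wallis_integral (Suc n) - real (2 * n + 2) * wallis_integral n = 0"
    unfolding wallis_integral_def
    by (subst (asm) Bochner_Integration.integral_diff[OF integrable_mult_right[OF wallis_integrable] integrable_mult_right[OF wallis_integrable]])
      (simp only: integral_mult_right_zero)
  then show ?thesis by (simp add: field_simps)
qed

lemma wallis_integral_nonneg: "0 \<le> wallis_integral n"
  by (induction n) (auto simp: wallis_integral_0 wallis_integral_Suc)

lemma wallis_integral_6: "wallis_integral 6 = 2 * sqrt 6 * (46080 / 135135)"
  by (simp add: numeral_eq_Suc wallis_integral_Suc wallis_integral_0)

text \<open>
  The product of \<open>s\<close> and the squared integral increases with \<open>s\<close>; by the recursion this amounts to
  \<open>s ((4s+3)(4s+5))\<^sup>2 \<le> (s+1) ((4s+2)(4s+4))\<^sup>2\<close>.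
\<close>

lemma wallis_integral_lower:
  assumes "s \<ge> 3"
  shows "3 * (wallis_integral 6)\<^sup>2 \<le> real s * (wallis_integral (2 * s))\<^sup>2"
  using assms
proof (induction s rule: nat_induct_at_least)
  case (Suc s)
  define w where "w = wallis_integral (2 * s)"
  define A B where "A = real ((4 * s + 2) * (4 * s + 4))" and "B = real ((4 * s + 3) * (4 * s + 5))"
  have B: "B > 0" unfolding B_def by (simp only: of_nat_0_less_iff) simp
  have w': "wallis_integral (2 * Suc s) = A / B * w"
  proof -
    have "2 * Suc s = Suc (Suc (2 * s))" "2 * Suc (2 * s) + 2 = 4 * s + 4" "2 * Suc (2 * s) + 3 = 4 * s + 5"
      "2 * (2 * s) + 2 = 4 * s + 2" "2 * (2 * s) + 3 = 4 * s + 3"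
      by simp_all
    then have "wallis_integral (2 * Suc s) = real (4 * s + 4) / real (4 * s + 5) * (real (4 * s + 2) / real (4 * s + 3) * w)"
      by (simp only: wallis_integral_Suc w_def)
    moreover have "a / b * (c / d * w) = c * a / (d * b) * w" for a b c d :: real
      by (simp add: mult_ac)
    ultimately show ?thesis
      unfolding A_def B_def of_nat_mult by (simp only:)
  qed
  have "real s * B\<^sup>2 \<le> real (Suc s) * A\<^sup>2"
  proof -
    have "s * ((4 * s + 3) * (4 * s + 5))\<^sup>2 \<le> Suc s * ((4 * s + 2) * (4 * s + 4))\<^sup>2"
      by (simp add: power2_eq_square algebra_simps)
    then show ?thesis
      unfolding A_def B_def of_nat_power[symmetric] of_nat_mult[symmetric] of_nat_le_iff .
  qed
  then have "real s * w\<^sup>2 \<le> real (Suc s) * A\<^sup>2 / B\<^sup>2 * w\<^sup>2"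
    using B by (intro mult_right_mono) (auto simp: field_simps)
  also have "\<dots> = real (Suc s) * (A / B * w)\<^sup>2"
    by (simp add: power_mult_distrib power_divide)
  finally show ?case
    using Suc.IH unfolding w' w_def[symmetric] by linarith
qed simp

lemma sinc_ge_quadratic: "1 - y\<^sup>2 / 6 \<le> sinc y"
proof -
  have *: "1 - y\<^sup>2 / 6 \<le> sin y / y" if "y > 0" for y :: real
    using sin_ge_cubic[of y] that by (simp add: pos_le_divide_eq field_simps power2_eq_square power3_eq_cube)
  show ?thesis
    using *[of y] *[of "-y"] by (cases y "0::real" rule: linorder_cases) auto
qed

lemma wallis_integral_le_bspline:
  assumes "even n" "n \<ge> 2"
  shows "wallis_integral n \<le> pi * bspline n 0"
proof -
  have "wallis_integral n \<le> (LBINT y. sinc y ^ n)"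
    unfolding wallis_integral_def
  proof (rule integral_mono[OF wallis_integrable integrable_sinc_power[OF assms(2)]])
    show "(1 - y\<^sup>2 / 6) ^ n * indicator {- sqrt 6..sqrt 6} y \<le> sinc y ^ n" for y
    proof (cases "y \<in> {- sqrt 6..sqrt 6}")
      case True
      then have "y\<^sup>2 \<le> 6"
        using abs_le_square_iff[of y "sqrt 6"] by (simp add: abs_le_iff)
      then have "(1 - y\<^sup>2 / 6) ^ n \<le> sinc y ^ n"
        by (intro power_mono sinc_ge_quadratic) simp
      with True show ?thesis by simp
    next
      case False
      have "0 \<le> sinc y ^ n" by (rule zero_le_even_power[OF assms(1)])
      with False show ?thesis by simp
    qed
  qed
  then show ?thesis using bspline_at_0[OF assms(2)] by simp
qed

text \<open>
  By inversion the central value is the integral of \<open>sinc\<^sup>2\<^sup>s\<close> divided by \<open>\<pi>\<close>, hence at least the Wallis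
  integral of order \<open>2 s\<close> divided by \<open>\<pi>\<close>. At \<open>s = 3\<close> all square roots cancel and
  \<open>9 \<cdot> 46080 / (135135 \<pi>) \<ge> 0.976\<close> remains.
\<close>

lemma bspline_at_0_lower:
  assumes "s \<ge> 2"
  shows "tail_factor s \<le> 3 * sqrt (real s) / (2 * sqrt 2) * bspline (2 * s) 0"
proof (cases "s = 2")
  case True
  then show ?thesis by (simp add: tail_factor_def bspline_4_at_0)
next
  case False
  with assms have s: "s \<ge> 3" by simp
  have "sqrt (3 * (wallis_integral 6)\<^sup>2) \<le> sqrt (real s * (wallis_integral (2 * s))\<^sup>2)"
    by (rule real_sqrt_le_mono[OF wallis_integral_lower[OF s]])
  then have "sqrt 3 * wallis_integral 6 \<le> sqrt (real s) * wallis_integral (2 * s)"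
    by (simp add: real_sqrt_mult wallis_integral_nonneg)
  also have "\<dots> \<le> sqrt (real s) * (pi * bspline (2 * s) 0)"
    using s by (intro mult_left_mono wallis_integral_le_bspline) auto
  finally have *: "sqrt 3 * wallis_integral 6 \<le> sqrt (real s) * (pi * bspline (2 * s) 0)" .
  have "sqrt 3 * sqrt 6 = sqrt (9 * 2)"
    by (simp flip: real_sqrt_mult)
  also have "\<dots> = 3 * sqrt 2"
    by (subst real_sqrt_mult) simp
  finally have "sqrt 3 * wallis_integral 6 = 6 * sqrt 2 * (46080 / 135135)"
    unfolding wallis_integral_6 by simp
  with * have "3 / (2 * sqrt 2) * (6 * sqrt 2 * (46080 / 135135)) \<le> 3 / (2 * sqrt 2) * (sqrt (real s) * (pi * bspline (2 * s) 0))"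
    by (intro mult_left_mono) auto
  then have "9 * (46080 / 135135) \<le> pi * (3 * sqrt (real s) / (2 * sqrt 2) * bspline (2 * s) 0)"
    by (simp add: mult_ac)
  moreover have "pi * 0.976 \<le> 9 * (46080 / 135135)"
    using pi_bounds by simp
  ultimately have "pi * 0.976 \<le> pi * (3 * sqrt (real s) / (2 * sqrt 2) * bspline (2 * s) 0)"
    by linarith
  then show ?thesis
    using False by (simp only: mult_le_cancel_left_pos[OF pi_gt_zero]) (simp add: tail_factor_def)
qed

section \<open>Paley--Wiener functions\<close>

text \<open>
  The complement of the support is a union of possibly uncountably many open sets; Lindelof's
  theorem reduces it to countably many null conditions.
\<close>

lemma AE_outside_ess_support:
  assumes "ess_support g \<subseteq> S"
  shows "AE v in lborel. v \<notin> S \<longrightarrow> g v = 0"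
proof -
  define \<U> where "\<U> = {U. open U \<and> (AE v in lborel. v \<in> U \<longrightarrow> g v = 0)}"
  obtain \<V> where \<V>: "\<V> \<subseteq> \<U>" "countable \<V>" "\<Union>\<V> = \<Union>\<U>"
    by (rule Lindelof[of \<U>]) (auto simp: \<U>_def)
  have "AE v in lborel. \<forall>U\<in>\<V>. v \<in> U \<longrightarrow> g v = 0"
    using \<V>(1,2) by (subst AE_ball_countable) (auto simp: \<U>_def)
  then show ?thesis
  proof eventually_elim
    case (elim v)
    have "v \<notin> S \<Longrightarrow> v \<in> \<Union>\<V>"
      using assms \<V>(3) by (auto simp: ess_support_def \<U>_def)
    with elim show ?case by blast
  qed
qed

lemma smooth_isCont:
  assumes "smooth f"
  shows "isCont f t"
proof -
  from assms obtain D where "D 0 = f" "\<And>n t. (D n has_vector_derivative D (Suc n) t) (at t)"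
    unfolding smooth_def by blast
  then have "(f has_vector_derivative D 1 t) (at t)"
    by (metis One_nat_def)
  then show ?thesis
    by (rule has_vector_derivative_continuous)
qed

lemma bandlimited_integrable:
  assumes g: "g \<in> L2_space" and "\<delta> \<ge> 0" and supp: "AE v in lborel. v \<notin> {-\<delta>..\<delta>} \<longrightarrow> g v = 0"
  shows "integrable lborel g" "(LBINT v. cmod (g v)) \<le> sqrt (2 * \<delta>) * L2_norm g"
proof -
  note [measurable] = L2_spaceD(1)[OF g]
  let ?i = "\<lambda>v. complex_of_real (indicator {-\<delta>..\<delta>} v)"
  have sq: "(\<lambda>v. (cmod (?i v))\<^sup>2) = indicator {-\<delta>..\<delta>}"
    by (auto simp: indicator_def)
  have i: "?i \<in> L2_space"
  proof -
    have "integrable lborel (\<lambda>v. (cmod (?i v))\<^sup>2)"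
      unfolding sq by (rule integrable_indicator_Icc)
    then show ?thesis by (simp add: L2_space_def)
  qed
  have in': "L2_norm ?i = sqrt (2 * \<delta>)"
    unfolding L2_norm_def sq using assms(2) by simp
  have AE: "AE v in lborel. g v * ?i v = g v"
    using supp by eventually_elim (auto simp: indicator_def)
  have int: "integrable lborel (\<lambda>v. g v * ?i v)"
    by (rule L2_Cauchy_Schwarz(1)[OF g i])
  show gi: "integrable lborel g"
    using int by (rule integrable_cong_AE_imp) (use AE in auto)
  have "(LBINT v. cmod (g v)) = (LBINT v. cmod (g v) * cmod (?i v))"
    by (rule integral_cong_AE) (use AE in \<open>auto simp flip: norm_mult\<close>)
  also have "\<dots> \<le> L2_norm g * sqrt (2 * \<delta>)"
    using L2_Cauchy_Schwarz(2)[OF g i] in' by simp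
  finally show "(LBINT v. cmod (g v)) \<le> sqrt (2 * \<delta>) * L2_norm g"
    by (simp add: mult.commute)
qed

lemma paley_wiener_representation:
  assumes "f \<in> paley_wiener \<delta>" "\<delta> \<ge> 0"
  obtains g where "integrable lborel g" "AE v in lborel. v \<notin> {-\<delta>..\<delta>} \<longrightarrow> g v = 0"
    "(LBINT v. cmod (g v)) \<le> sqrt (2 * \<delta>) * L2_norm f"
    "\<And>t. f t = (LBINT v. g v * cis (2 * pi * v * t))"
proof -
  from assms(1) obtain g where f: "f \<in> L2_space" "smooth f" and g: "has_L2_fourier f g" "ess_support g \<subseteq> {-\<delta>..\<delta>}"
    unfolding paley_wiener_def by blast
  have gL: "g \<in> L2_space" using g(1) by (simp add: has_L2_fourier_def)
  have supp: "AE v in lborel. v \<notin> {-\<delta>..\<delta>} \<longrightarrow> g v = 0"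
    by (rule AE_outside_ess_support[OF g(2)])
  note gi = bandlimited_integrable[OF gL assms(2) supp]
  have "sqrt (2 * \<delta>) * L2_norm g \<le> sqrt (2 * \<delta>) * L2_norm f"
    by (intro mult_left_mono has_L2_fourier_norm_le[OF g(1)]) (use assms(2) in simp)
  then have n: "(LBINT v. cmod (g v)) \<le> sqrt (2 * \<delta>) * L2_norm f"
    using gi(2) by linarith
  have "f t = (LBINT v. g v * cis (2 * pi * v * t))" for t
    by (rule gauss_inversion[OF has_L2_fourier_gauss[OF g(1)] gi(1) f(1) smooth_isCont[OF f(2)]])
  with that gi(1) supp n show ?thesis by blast
qed

lemma bandlimited_lipschitz:
  assumes g: "integrable lborel g" and supp: "AE v in lborel. v \<notin> {-\<delta>..\<delta>} \<longrightarrow> g v = 0" and \<delta>: "\<delta> \<ge> 0"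
    and f: "\<And>t. f t = (LBINT v. g v * cis (2 * pi * v * t))"
  shows "cmod (f t - f u) \<le> 2 * pi * \<delta> * (LBINT v. cmod (g v)) * \<bar>t - u\<bar>"
proof -
  have i: "integrable lborel (\<lambda>v. g v * cis (2 * pi * v * t))" for t
    by (intro integrable_mult_cis g) simp
  have "f t - f u = (LBINT v. g v * cis (2 * pi * v * t) - g v * cis (2 * pi * v * u))"
    unfolding f by (rule Bochner_Integration.integral_diff[OF i i, symmetric])
  then have "cmod (f t - f u) \<le> (LBINT v. cmod (g v * cis (2 * pi * v * t) - g v * cis (2 * pi * v * u)))"
    by (simp only: integral_norm_bound)
  also have "\<dots> \<le> (LBINT v. cmod (g v) * (2 * pi * \<delta> * \<bar>t - u\<bar>))"
  proof (rule integral_mono_AE)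
    show "AE v in lborel. cmod (g v * cis (2 * pi * v * t) - g v * cis (2 * pi * v * u)) \<le> cmod (g v) * (2 * pi * \<delta> * \<bar>t - u\<bar>)"
      using supp
    proof eventually_elim
      case (elim v)
      show ?case
      proof (cases "v \<in> {-\<delta>..\<delta>}")
        case True
        have "cmod (cis (2 * pi * v * t) - cis (2 * pi * v * u)) \<le> \<bar>2 * pi * v * t - 2 * pi * v * u\<bar>"
          by (rule cis_diff_le)
        also have "\<dots> = 2 * pi * \<bar>v\<bar> * \<bar>t - u\<bar>"
          by (simp add: abs_mult flip: right_diff_distrib)
        also have "\<dots> \<le> 2 * pi * \<delta> * \<bar>t - u\<bar>"
          using True by (intro mult_right_mono mult_left_mono) auto
        finally have "cmod (g v) * cmod (cis (2 * pi * v * t) - cis (2 * pi * v * u)) \<le> cmod (g v) * (2 * pi * \<delta> * \<bar>t - u\<bar>)"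
          by (rule mult_left_mono) simp
        then show ?thesis
          by (simp only: norm_mult[symmetric] right_diff_distrib)
      qed (use elim in simp)
    qed
  qed (use g i in \<open>auto intro!: integrable_norm Bochner_Integration.integrable_diff\<close>)
  also have "\<dots> = 2 * pi * \<delta> * (LBINT v. cmod (g v)) * \<bar>t - u\<bar>"
    by simp
  finally show ?thesis .
qed

text \<open>
  A value of modulus \<open>e\<close> forces values of modulus at least \<open>e/2\<close> on an interval whose length depends only
  on \<open>e\<close> and \<open>C\<close>; the tails of the convergent integral of \<open>\<bar>f\<bar>\<^sup>2\<close> exclude this far out.
\<close>

lemma L2_lipschitz_vanishes:
  assumes f: "f \<in> L2_space" and C: "C \<ge> 0" and lip: "\<And>t u. cmod (f t - f u) \<le> C * \<bar>t - u\<bar>"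
  shows "(f \<longlongrightarrow> 0) at_infinity"
  unfolding Lim_at_infinity
proof (intro allI impI)
  note [measurable] = L2_spaceD(1)[OF f]
  fix e :: real assume e: "e > 0"
  \<comment> \<open>within distance \<open>r\<close> the function varies by at most \<open>e / 2\<close>\<close>
  define r where "r = e / (2 * (C + 1))"
  have r: "r > 0" "C * r \<le> e / 2"
    using e C by (auto simp: r_def field_simps)
  let ?w = "\<lambda>R y. indicator {y. R \<le> \<bar>y\<bar>} y * (cmod (f y))\<^sup>2 :: real"
  have wi: "integrable lborel (?w R)" for R
    by (rule integrable_norm_le[OF L2_spaceD(2)[OF f]]) (auto split: split_indicator)
  have "(\<lambda>n. LBINT y. ?w (real n) y) \<longlonglongrightarrow> (LBINT y::real. 0 :: real)"
  proof (rule integral_dominated_convergence[where w="\<lambda>y. (cmod (f y))\<^sup>2"])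
    show "AE y in lborel. (\<lambda>n. ?w (real n) y) \<longlonglongrightarrow> 0"
    proof (rule AE_I2)
      fix y :: real
      obtain N :: nat where N: "\<bar>y\<bar> < real N"
        using reals_Archimedean2 by blast
      have "?w (real n) y = 0" if "n \<ge> N" for n
        using N that by (simp add: indicator_def)
      then show "(\<lambda>n. ?w (real n) y) \<longlonglongrightarrow> 0"
        by (intro tendsto_eventually eventually_sequentiallyI)
    qed
    show "AE y in lborel. norm (?w (real n) y) \<le> (cmod (f y))\<^sup>2" for n
      by (auto split: split_indicator)
  qed (use L2_spaceD(2)[OF f] in auto)
  then have "\<forall>\<^sub>F n in sequentially. (LBINT y. ?w (real n) y) < 2 * r * (e / 2)\<^sup>2"
    using e r by (intro order_tendstoD) (auto intro!: mult_pos_pos)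
  then obtain N :: nat where N: "(LBINT y. ?w (real N) y) < 2 * r * (e / 2)\<^sup>2"
    unfolding eventually_sequentially by blast
  have "dist (f t) 0 < e" if t: "real N + r \<le> norm t" for t
  proof (rule ccontr)
    assume "\<not> dist (f t) 0 < e"
    then have ft: "e \<le> cmod (f t)" by simp
    have "(LBINT y. (e / 2)\<^sup>2 * indicator {t - r..t + r} y) \<le> (LBINT y. ?w (real N) y)"
    proof (rule integral_mono)
      show "(e / 2)\<^sup>2 * indicator {t - r..t + r} y \<le> ?w (real N) y" for y
      proof (cases "y \<in> {t - r..t + r}")
        case True
        then have y: "\<bar>t - y\<bar> \<le> r" by auto
        have "cmod (f t - f y) \<le> e / 2"
          using lip[of t y] mult_left_mono[OF y C] r(2) by linarith
        then have "e / 2 \<le> cmod (f y)"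
          using ft norm_triangle_ineq2[of "f t" "f y"] by linarith
        then have "(e / 2)\<^sup>2 \<le> (cmod (f y))\<^sup>2"
          using e by (intro power_mono) auto
        moreover have "real N \<le> \<bar>y\<bar>" using y t by simp
        ultimately show ?thesis using True by simp
      qed simp
    qed (use wi integrable_indicator_Icc in auto)
    moreover have "(LBINT y. (e / 2)\<^sup>2 * indicator {t - r..t + r} y) = 2 * r * (e / 2)\<^sup>2"
      using r by simp
    ultimately show False using N by linarith
  qed
  then show "\<exists>b. \<forall>x. b \<le> norm x \<longrightarrow> dist (f x) 0 < e"
    by blast
qed

lemma paley_wiener_vanishes:
  assumes f: "f \<in> paley_wiener \<delta>" and \<delta>: "\<delta> \<ge> 0"
  shows "(f \<longlongrightarrow> 0) at_infinity"
proof (rule paley_wiener_representation[OF f \<delta>])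
  fix g
  assume g: "integrable lborel g" "AE v in lborel. v \<notin> {-\<delta>..\<delta>} \<longrightarrow> g v = 0"
    "\<And>t. f t = (LBINT v. g v * cis (2 * pi * v * t))"
  show "(f \<longlongrightarrow> 0) at_infinity"
  proof (rule L2_lipschitz_vanishes)
    show "f \<in> L2_space" using f by (simp add: paley_wiener_def)
    show "0 \<le> 2 * pi * \<delta> * (LBINT v. cmod (g v))"
      using \<delta> by (intro mult_nonneg_nonneg Bochner_Integration.integral_nonneg) auto
    show "cmod (f t - f u) \<le> 2 * pi * \<delta> * (LBINT v. cmod (g v)) * \<bar>t - u\<bar>" for t u
      by (rule bandlimited_lipschitz[OF g(1,2) \<delta>]) (rule g(3))
  qed
qed

section \<open>The error on exponentials\<close>

lemma sinc_tail_reflect: "(LBINT y. indicator {..- a} y * sinc y ^ n) = sinc_tail n a" if "even n"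
proof -
  have ref: "indicator {..- a} (0 + (-1) * y) * sinc (0 + (-1) * y) ^ n = indicator {a..} y * sinc y ^ n" for y
  proof -
    have "sinc (0 + (-1) * y) = sinc y" by simp
    moreover have "indicator {..- a} (0 + (-1) * y) = (indicator {a..} y :: real)"
      by (auto simp: indicator_def)
    ultimately show ?thesis by (simp only:)
  qed
  show ?thesis
    unfolding sinc_tail_def
    by (subst lborel_integral_real_affine[where c="-1" and t=0]) (simp, simp only: ref, simp)
qed

lemma scaled_bspline_vanishes:
  assumes "s \<ge> 1" "m \<ge> 1" "real m < \<bar>z\<bar>"
  shows "bspline (2 * s) (z * real s / real m) = 0"
proof -
  have "real m * (real s / real m) < \<bar>z\<bar> * (real s / real m)"
    using assms by (intro mult_strict_right_mono) auto
  then have "real (2 * s) / 2 < \<bar>z * real s / real m\<bar>"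
    using assms by (simp add: abs_mult)
  moreover have "unit_bump (real (2 * s) / 2) (bspline (2 * s))"
    using assms by (intro bspline_unit_bump) simp
  ultimately show ?thesis
    by (simp add: unit_bump_def)
qed

text \<open>
  The density of the rescaled spline is \<open>sinc\<^sup>2\<^sup>s\<close> at scale \<open>\<beta> = 2 s / m\<close>. Its mass outside the band consists of
  the two tails that start where \<open>\<beta> y = \<pi> + \<theta>\<close> and, after reflection, where \<open>\<beta> y = \<pi> - \<theta>\<close>.
\<close>

lemma windowed_exponential_bound:
  fixes m s :: nat and x \<theta> :: real
  assumes s: "s \<ge> 1" and m: "m \<ge> 1" and \<theta>: "\<bar>\<theta>\<bar> < pi"
    and A: "finite A" "\<And>l. \<bar>x - of_int l\<bar> \<le> real m \<Longrightarrow> l \<in> A"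
  shows "cmod (cis (\<theta> * x) * of_real (bspline (2 * s) 0)
      - (\<Sum>l\<in>A. cis (\<theta> * of_int l) * of_real (sinc (pi * (x - of_int l))) * of_real (bspline (2 * s) ((x - of_int l) * real s / real m))))
    \<le> 2 / pi * (sinc_tail (2 * s) ((pi - \<theta>) * real m / (2 * real s)) + sinc_tail (2 * s) ((pi + \<theta>) * real m / (2 * real s)))"
proof -
  \<comment> \<open>the scaling that turns the spline \<open>M\<^sub>2\<^sub>s (y s / m)\<close> into a Fourier integral in the variable \<open>y\<close>\<close>
  define \<beta> where "\<beta> = 2 * real s / real m"
  have \<beta>: "\<beta> > 0" using s m by (simp add: \<beta>_def)
  let ?n = "2 * s"
  have n: "?n \<ge> 2" using s by simp
  define p where "p a = sinc (a / \<beta>) ^ ?n / (pi * \<beta>)" for a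
  define Q where "Q y = complex_of_real (bspline ?n (y * real s / real m))" for y
  have pint: "integrable lborel p"
  proof -
    have "integrable lborel (\<lambda>a. sinc (0 + (1 / \<beta>) * a) ^ ?n)"
      by (rule lborel_integrable_real_affine[OF integrable_sinc_power[OF n]]) (use \<beta> in simp)
    moreover have "0 + (1 / \<beta>) * a = a / \<beta>" for a
      by simp
    ultimately have "integrable lborel (\<lambda>a. sinc (a / \<beta>) ^ ?n)"
      by (simp only:)
    then show ?thesis
      unfolding p_def[abs_def] by (rule integrable_divide_zero)
  qed
  have p0: "0 \<le> p a" for a
    unfolding p_def by (rule divide_nonneg_pos[OF zero_le_even_power]) (use \<beta> in auto)
  have pb: "p (0 + \<beta> * y) = sinc y ^ ?n / (pi * \<beta>)" for y
    using \<beta> by (simp add: p_def)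
  have Q: "Q y = (LBINT a. of_real (p a) * cis (a * y))" for y
  proof -
    have "(LBINT a. of_real (p a) * cis (a * y)) = \<beta> *\<^sub>R (LBINT z. of_real (p (0 + \<beta> * z)) * cis ((0 + \<beta> * z) * y))"
      using \<beta> by (subst lborel_integral_real_affine[where c=\<beta> and t=0]) simp_all
    also have "\<dots> = (LBINT z. \<beta> *\<^sub>R (of_real (p (0 + \<beta> * z)) * cis ((0 + \<beta> * z) * y)))"
      by (rule integral_scaleR_right[symmetric])
    also have "\<dots> = (LBINT z. of_real (sinc z ^ ?n / pi) * cis (2 * z * (y * real s / real m)))"
    proof (rule Bochner_Integration.integral_cong[OF refl])
      fix z
      have "(0 + \<beta> * z) * y = 2 * z * (y * real s / real m)"
        by (simp add: \<beta>_def)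
      moreover have "\<beta> *\<^sub>R (complex_of_real (c / (pi * \<beta>)) * w) = complex_of_real (c / pi) * w" for c w
        using \<beta> by (simp add: scaleR_conv_of_real)
      ultimately show "\<beta> *\<^sub>R (of_real (p (0 + \<beta> * z)) * cis ((0 + \<beta> * z) * y)) = of_real (sinc z ^ ?n / pi) * cis (2 * z * (y * real s / real m))"
        by (simp only: pb)
    qed
    also have "\<dots> = Q y"
      unfolding Q_def by (rule bspline_inversion[OF n, symmetric])
    finally show ?thesis ..
  qed
  have far: "(LBINT a. indicator {a. pi \<le> \<bar>\<theta> - a\<bar>} a * p a)
      = (sinc_tail ?n ((pi - \<theta>) * real m / (2 * real s)) + sinc_tail ?n ((pi + \<theta>) * real m / (2 * real s))) / pi"
  proof -
    define a1 a2 where "a1 = (pi - \<theta>) / \<beta>" and "a2 = (pi + \<theta>) / \<beta>"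
    have a: "a1 > 0" "a2 > 0" using \<theta> \<beta> by (auto simp: a1_def a2_def)
    have i: "integrable lborel (\<lambda>y. indicator B y * sinc y ^ ?n)" if "B \<in> sets borel" for B
      by (rule integrable_indicator_mult[OF integrable_sinc_power[OF n] that])
    have ind: "indicator {a. pi \<le> \<bar>\<theta> - a\<bar>} (0 + \<beta> * y) = (indicator {..- a1} y + indicator {a2..} y :: real)" for y
    proof -
      have "y \<le> - a1 \<longleftrightarrow> \<beta> * y \<le> \<theta> - pi" "a2 \<le> y \<longleftrightarrow> pi + \<theta> \<le> \<beta> * y"
        using \<beta> by (auto simp: a1_def a2_def field_simps)
      moreover have "\<not> (y \<le> - a1 \<and> a2 \<le> y)" using a by auto
      moreover have "pi \<le> \<bar>\<theta> - (0 + \<beta> * y)\<bar> \<longleftrightarrow> \<beta> * y \<le> \<theta> - pi \<or> pi + \<theta> \<le> \<beta> * y"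
        by auto
      ultimately show ?thesis
        by (auto simp: indicator_def)
    qed
    have "(LBINT a. indicator {a. pi \<le> \<bar>\<theta> - a\<bar>} a * p a)
        = \<beta> *\<^sub>R (LBINT y. indicator {a. pi \<le> \<bar>\<theta> - a\<bar>} (0 + \<beta> * y) * p (0 + \<beta> * y))"
      using \<beta> by (subst lborel_integral_real_affine[where c=\<beta> and t=0]) simp_all
    also have "(LBINT y. indicator {a. pi \<le> \<bar>\<theta> - a\<bar>} (0 + \<beta> * y) * p (0 + \<beta> * y))
        = (LBINT y. (indicator {..- a1} y * sinc y ^ ?n + indicator {a2..} y * sinc y ^ ?n) / (pi * \<beta>))"
      by (simp only: ind pb distrib_right times_divide_eq_right)
    also have "\<dots> = ((LBINT y. indicator {..- a1} y * sinc y ^ ?n) + (LBINT y. indicator {a2..} y * sinc y ^ ?n)) / (pi * \<beta>)"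
      by (subst integral_divide_zero, subst Bochner_Integration.integral_add[OF i i]) simp_all
    also have "\<dots> = (sinc_tail ?n a1 + sinc_tail ?n a2) / (pi * \<beta>)"
      by (subst sinc_tail_reflect) (simp_all only: sinc_tail_def, simp)
    also have "\<beta> *\<^sub>R \<dots> = (sinc_tail ?n a1 + sinc_tail ?n a2) / pi"
      using \<beta> by simp
    finally show ?thesis
      by (simp add: a1_def a2_def \<beta>_def)
  qed
  define A' where "A' = {l::int. \<bar>x - of_int l\<bar> \<le> real m}"
  have A': "A' \<subseteq> A" using A(2) by (auto simp: A'_def)
  have Q0: "Q (x - of_int l) = 0" if "l \<notin> A'" for l
  proof -
    have "real m < \<bar>x - of_int l\<bar>" using that by (auto simp: A'_def)
    then show ?thesis
      unfolding Q_def using scaled_bspline_vanishes[OF s m] by simp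
  qed
  have "cmod (cis (\<theta> * x) * Q 0 - (\<Sum>l\<in>A. cis (\<theta> * of_int l) * of_real (sinc (pi * (x - of_int l))) * Q (x - of_int l)))
      \<le> 2 * (LBINT a. indicator {a. pi \<le> \<bar>\<theta> - a\<bar>} a * p a)"
    by (rule sampled_exponential_bound[OF pint p0 Q A(1)]) (use Q0 A' in blast)
  then show ?thesis
    unfolding far by (simp add: Q_def)
qed

lemma half_order_ge_2:
  assumes "m \<ge> 2" "s = nat \<lceil>(real m + 1) / 2\<rceil>"
  shows "s \<ge> 2"
proof -
  have "1 < \<lceil>(real m + 1) / 2\<rceil>"
    unfolding less_ceiling_iff using assms(1) by simp
  then show ?thesis unfolding assms(2) by linarith
qed

text \<open>
  In terms of the larger tail, which starts at \<open>Y = (\<pi> - \<bar>\<theta>\<bar>) m / (2 s)\<close>, the other one starts at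
  \<open>\<pi> m / s - Y\<close>. The resulting bound grows as \<open>Y\<close> decreases, so the largest admissible frequency is the worst.
\<close>

lemma regularized_shannon_kernel_bound:
  fixes m s :: nat and x \<theta> :: real
  assumes m: "m \<ge> 2" and s: "s = nat \<lceil>(real m + 1) / 2\<rceil>"
    and \<theta>: "\<bar>\<theta>\<bar> \<le> \<theta>0" "\<theta>0 \<le> pi - 2"
    and A: "finite A" "\<And>l. \<bar>x - of_int l\<bar> \<le> real m \<Longrightarrow> l \<in> A"
  defines "X \<equiv> (pi - \<theta>0) * real m / (2 * real s)"
  shows "cmod (cis (\<theta> * x) * of_real (bspline (2 * s) 0)
      - (\<Sum>l\<in>A. cis (\<theta> * of_int l) * of_real (sinc (pi * (x - of_int l))) * of_real (bspline (2 * s) ((x - of_int l) * real s / real m))))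
    \<le> 2 / pi * (tail_factor s / ((2 * real s - 1) * X ^ m))"
proof -
  have s2: "s \<ge> 2"
    by (rule half_order_ge_2[OF m s])
  define Y where "Y = (pi - \<bar>\<theta>\<bar>) * real m / (2 * real s)"
  have Y: "real m / real s \<le> Y" "Y \<le> pi * real m / (2 * real s)" "X \<le> Y"
  proof -
    have "2 * real m / (2 * real s) \<le> (pi - \<bar>\<theta>\<bar>) * real m / (2 * real s)"
      using \<theta> by (intro divide_right_mono mult_right_mono) auto
    then show "real m / real s \<le> Y" by (simp add: Y_def)
    show "Y \<le> pi * real m / (2 * real s)" "X \<le> Y"
      unfolding Y_def X_def using \<theta> by (auto intro!: divide_right_mono mult_right_mono)
  qed
  have X0: "X > 0"
    unfolding X_def using \<theta> m s2 by (intro divide_pos_pos mult_pos_pos) auto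
  have refl: "pi * real m / real s - Y = (pi + \<bar>\<theta>\<bar>) * real m / (2 * real s)"
    using s2 by (simp add: Y_def field_simps)
  have "cmod (cis (\<theta> * x) * of_real (bspline (2 * s) 0)
      - (\<Sum>l\<in>A. cis (\<theta> * of_int l) * of_real (sinc (pi * (x - of_int l))) * of_real (bspline (2 * s) ((x - of_int l) * real s / real m))))
    \<le> 2 / pi * (sinc_tail (2 * s) ((pi - \<theta>) * real m / (2 * real s)) + sinc_tail (2 * s) ((pi + \<theta>) * real m / (2 * real s)))"
    by (rule windowed_exponential_bound) (use s2 m \<theta> A in auto)
  also have "\<dots> = 2 / pi * (sinc_tail (2 * s) Y + sinc_tail (2 * s) (pi * real m / real s - Y))"
    unfolding refl unfolding Y_def by (cases "\<theta> \<ge> 0") (auto simp: add.commute)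
  also have "\<dots> \<le> 2 / pi * (tail_factor s / ((2 * real s - 1) * Y ^ m))"
    by (intro mult_left_mono sinc_tail_pair_bound m s Y) simp
  also have "\<dots> \<le> 2 / pi * (tail_factor s / ((2 * real s - 1) * X ^ m))"
    using X0 Y(3) s2
    by (intro mult_left_mono divide_left_mono power_mono mult_pos_pos) (auto simp: tail_factor_def)
  finally show ?thesis .
qed

section \<open>The regularized Shannon formula in \<open>C\<^sub>0(\<real>)\<close>\<close>

text \<open>
  The norm is defined as a greatest element, so a maximum point has to be found first: the function
  is small outside a compact interval and attains its maximum on it.
\<close>

lemma C0_norm_le:
  assumes h: "h \<in> C0_space" and le: "\<And>t. cmod (h t) \<le> K"
  shows "C0_norm h \<le> K"
proof -
  have cont: "continuous_on UNIV h" and lim: "(h \<longlongrightarrow> 0) at_infinity"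
    using h by (auto simp: C0_space_def)
  have "\<exists>t0. \<forall>t. cmod (h t) \<le> cmod (h t0)"
  proof (cases "\<forall>t. h t = 0")
    case False
    then obtain t1 where t1: "cmod (h t1) > 0" by auto
    from lim t1 obtain b where b: "\<And>x. norm x \<ge> b \<Longrightarrow> dist (h x) 0 < cmod (h t1)"
      unfolding Lim_at_infinity by blast
    define R where "R = max \<bar>b\<bar> \<bar>t1\<bar>"
    have "\<exists>x\<in>{-R..R}. \<forall>y\<in>{-R..R}. cmod (h y) \<le> cmod (h x)"
      by (rule continuous_attains_sup) (auto simp: R_def intro!: continuous_intros continuous_on_subset[OF cont])
    then obtain t0 where t0: "\<And>y. y \<in> {-R..R} \<Longrightarrow> cmod (h y) \<le> cmod (h t0)" by blast
    have "t1 \<in> {-R..R}" by (auto simp: R_def)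
    note t01 = t0[OF this]
    have "cmod (h t) \<le> cmod (h t0)" for t
    proof (cases "t \<in> {-R..R}")
      case False
      then have "b \<le> norm t" by (auto simp: R_def)
      from b[OF this] t01 show ?thesis by simp
    qed (rule t0)
    then show ?thesis by blast
  qed auto
  then obtain t0 where t0: "\<And>t. cmod (h t) \<le> cmod (h t0)" by blast
  have "C0_norm h = cmod (h t0)"
    unfolding C0_norm_def by (rule Greatest_equality) (use t0 in auto)
  with le show ?thesis by simp
qed

lemma finite_card_near_integers:
  "finite {l::int. \<bar>x - of_int l\<bar> \<le> real m}" "card {l::int. \<bar>x - of_int l\<bar> \<le> real m} \<le> 2 * m + 1"
proof -
  have sub: "{l::int. \<bar>x - of_int l\<bar> \<le> real m} \<subseteq> {\<lceil>x - real m\<rceil>..\<lfloor>x + real m\<rfloor>}"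
  proof
    fix l assume "l \<in> {l::int. \<bar>x - of_int l\<bar> \<le> real m}"
    then have "x - real m \<le> of_int l" "of_int l \<le> x + real m"
      by (auto simp: abs_le_iff)
    then show "l \<in> {\<lceil>x - real m\<rceil>..\<lfloor>x + real m\<rfloor>}"
      by (simp only: atLeastAtMost_iff ceiling_le_iff le_floor_iff)
  qed
  then show "finite {l::int. \<bar>x - of_int l\<bar> \<le> real m}"
    by (rule finite_subset) simp
  have "card {l::int. \<bar>x - of_int l\<bar> \<le> real m} \<le> card {\<lceil>x - real m\<rceil>..\<lfloor>x + real m\<rfloor>}"
    by (rule card_mono[OF _ sub]) simp
  also have "\<dots> \<le> 2 * m + 1"
    by simp linarith
  finally show "card {l::int. \<bar>x - of_int l\<bar> \<le> real m} \<le> 2 * m + 1" .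
qed

lemma bspline_even_at_0_pos: "s \<ge> 2 \<Longrightarrow> 0 < bspline (2 * s) 0"
proof -
  assume s: "s \<ge> 2"
  have "0 < tail_factor s" by (simp add: tail_factor_def)
  also have "\<dots> \<le> 3 * sqrt (real s) / (2 * sqrt 2) * bspline (2 * s) 0"
    by (rule bspline_at_0_lower[OF s])
  finally show ?thesis
    by (rule zero_less_mult_pos) (use s in simp)
qed

lemma sample_distance:
  assumes "L > 0" "\<bar>L * t - of_int l\<bar> \<le> real m"
  shows "\<bar>t - of_int l / L\<bar> \<le> real m / L"
proof -
  have "t - of_int l / L = (L * t - of_int l) / L"
    using assms by (simp add: field_simps)
  then show ?thesis
    using assms by (simp add: divide_right_mono)
qed

lemma bspline_window_vanishes:
  assumes "L > 0" "m \<ge> 1" "s \<ge> 1" "real m < \<bar>L * u\<bar>"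
  shows "bspline_window L m s u = 0"
proof -
  show ?thesis
    unfolding bspline_window_def using scaled_bspline_vanishes[OF assms(3,2,4)] by simp
qed

text \<open>
  The spline vanishes outside the truncation interval, so any finite set that contains the relevant
  indices may be summed over.
\<close>

lemma regularized_shannon_eq_sum:
  assumes L: "L > 0" and m: "m \<ge> 1" and s: "s \<ge> 1"
    and A: "finite A" "\<And>l. \<bar>L * t - of_int l\<bar> \<le> real m \<Longrightarrow> l \<in> A"
  shows "regularized_shannon L m (bspline_window L m s) f t
    = (\<Sum>l\<in>A. f (of_int l / L) * of_real (sinc (pi * (L * t - of_int l)) * bspline_window L m s (t - of_int l / L)))"
proof -
  let ?i = "\<lambda>l. indicator {- (real m / L)..real m / L} (t - of_int l / L)"
  let ?w = "\<lambda>l. bspline_window L m s (t - of_int l / L)"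
  have arg: "L * pi * (t - of_int l / L) = pi * (L * t - of_int l)" "L * (t - of_int l / L) = L * t - of_int l" for l :: int
    using L by (simp_all add: field_simps)
  have ind: "w * (?i l) = w" if "l \<in> A" "w = c * (?w l)" for l w c
  proof (cases "\<bar>L * t - of_int l\<bar> \<le> real m")
    case True
    then have "t - of_int l / L \<in> {- (real m / L)..real m / L}"
      using sample_distance[OF L True] unfolding atLeastAtMost_iff by (intro conjI) linarith+
    then show ?thesis by simp
  next
    case False
    then have "?w l = 0"
      by (intro bspline_window_vanishes L m s) (simp add: arg)
    with that show ?thesis by simp
  qed
  have "regularized_shannon L m (bspline_window L m s) f t
     = (\<Sum>\<^sub>\<infinity>l\<in>A. f (of_int l / L) * of_real (sinc (pi * (L * t - of_int l)) * (?w l)))"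
    unfolding regularized_shannon_def
  proof (rule infsum_cong_neutral)
    fix l assume "l \<in> UNIV - A"
    then have "\<not> \<bar>L * t - of_int l\<bar> \<le> real m" using A(2) by blast
    then have "real m < \<bar>L * t - of_int l\<bar>" by simp
    then have "?w l = 0"
      by (intro bspline_window_vanishes L m s) (simp add: arg)
    then show "f (of_int l / L) * complex_of_real (sinc (L * pi * (t - of_int l / L)) * (?w l) *
          (?i l)) = 0"
      by simp
  next
    fix l assume "l \<in> UNIV \<inter> A"
    then have "l \<in> A" by simp
    from ind[OF this refl, of "sinc (pi * (L * t - of_int l))"]
    show "f (of_int l / L) * complex_of_real (sinc (L * pi * (t - of_int l / L)) * (?w l) *
          (?i l))
        = f (of_int l / L) * of_real (sinc (pi * (L * t - of_int l)) * (?w l))"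
      by (simp only: arg)
  qed simp
  then show ?thesis
    using A(1) by simp
qed

lemma bspline_window_continuous:
  assumes "s \<ge> 1"
  shows "continuous_on S (\<lambda>t. bspline_window L m s (t - u))"
proof -
  have "continuous_on UNIV (bspline (2 * s))"
    using assms by (intro bspline_continuous) simp
  then have "continuous_on S (\<lambda>t. bspline (2 * s) (L * (t - u) * real s / real m))"
    by (rule continuous_on_compose2) (auto simp: divide_inverse intro!: continuous_intros)
  then show ?thesis
    unfolding bspline_window_def by (cases "bspline (2 * s) 0 = 0") (auto intro!: continuous_intros)
qed

text \<open>
  Near each point one finite set of indices serves all \<open>t\<close>.
\<close>

lemma regularized_shannon_continuous:
  assumes L: "L > 0" and m: "m \<ge> 1" and s: "s \<ge> 1"
  shows "continuous_on UNIV (regularized_shannon L m (bspline_window L m s) f)"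
proof -
  let ?R = "regularized_shannon L m (bspline_window L m s) f"
  have "isCont (?R) t0" for t0
  proof -
    \<comment> \<open>enlarged because \<open>L t\<close> moves by less than \<open>L\<close> on the unit ball\<close>
    define A where "A = {l::int. \<bar>L * t0 - of_int l\<bar> \<le> real (m + nat \<lceil>L\<rceil>)}"
    have A: "finite A" unfolding A_def by (rule finite_card_near_integers)
    have sub: "l \<in> A" if "t \<in> ball t0 1" "\<bar>L * t - of_int l\<bar> \<le> real m" for t l
    proof -
      have "\<bar>L * t0 - L * t\<bar> \<le> L"
        using that(1) L by (simp add: dist_real_def abs_mult mult_le_cancel_left1 flip: right_diff_distrib)
      moreover have "L \<le> real (nat \<lceil>L\<rceil>)" by linarith
      ultimately have "\<bar>L * t0 - of_int l\<bar> \<le> real m + real (nat \<lceil>L\<rceil>)"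
        using that(2) by linarith
      then show ?thesis
        by (simp only: A_def mem_Collect_eq of_nat_add)
    qed
    let ?S = "\<lambda>t. \<Sum>l\<in>A. f (of_int l / L) * of_real (sinc (pi * (L * t - of_int l)) * bspline_window L m s (t - of_int l / L))"
    have eq: "?R t = ?S t" if "t \<in> ball t0 1" for t
      by (rule regularized_shannon_eq_sum[OF L m s A]) (rule sub[OF that])
    have "continuous_on (ball t0 1) ?S"
      by (intro continuous_intros bspline_window_continuous s continuous_on_sinc)
    moreover have "continuous_on (ball t0 1) (?R) \<longleftrightarrow> continuous_on (ball t0 1) ?S"
      by (rule continuous_on_cong[OF refl]) (rule eq)
    ultimately have "continuous_on (ball t0 1) (?R)"
      by simp
    then show ?thesis
      by (simp add: continuous_on_eq_continuous_at)
  qed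
  then show ?thesis
    by (simp add: continuous_on_eq_continuous_at)
qed

text \<open>
  At most \<open>2 m + 1\<close> samples contribute at \<open>t\<close>, all taken within distance \<open>m / L\<close> of \<open>t\<close>.
\<close>

lemma regularized_shannon_vanishes:
  assumes L: "L > 0" and m: "m \<ge> 1" and s: "s \<ge> 2" and f: "(f \<longlongrightarrow> 0) at_infinity"
  shows "(regularized_shannon L m (bspline_window L m s) f \<longlongrightarrow> 0) at_infinity"
  unfolding Lim_at_infinity
proof (intro allI impI)
  fix e :: real assume e: "e > 0"
  let ?R = "regularized_shannon L m (bspline_window L m s) f"
  define M where "M = bspline (2 * s) 0"
  have M: "M > 0" unfolding M_def by (rule bspline_even_at_0_pos[OF s])
  \<comment> \<open>the denominator exceeds the number \<open>2 m + 1\<close> of terms, which makes the final inequality strict\<close>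
  define \<epsilon> where "\<epsilon> = e * M / (2 * real m + 2)"
  have \<epsilon>: "\<epsilon> > 0" using e M by (simp add: \<epsilon>_def)
  then obtain b where b: "\<And>u. b \<le> norm u \<Longrightarrow> dist (f u) 0 < \<epsilon>"
    using f unfolding Lim_at_infinity by blast
  have sl: "unit_bump (real (2 * s) / 2) (bspline (2 * s))"
    using s by (intro bspline_unit_bump) simp
  have "dist (?R t) 0 < e" if t: "b + real m / L \<le> norm t" for t
  proof -
    define A where "A = {l::int. \<bar>L * t - of_int l\<bar> \<le> real m}"
    have A: "finite A" "card A \<le> 2 * m + 1"
      unfolding A_def by (rule finite_card_near_integers)+
      let ?s = "\<lambda>l. sinc (pi * (L * t - of_int l))"
      let ?w = "\<lambda>l. bspline_window L m s (t - of_int l / L)"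
    have "norm (?R t)
        = norm (\<Sum>l\<in>A. f (of_int l / L) * of_real ((?s l) * (?w l)))"
      using s by (subst regularized_shannon_eq_sum[OF L m _ A(1)]) (auto simp: A_def)
    also have "\<dots> \<le> of_nat (card A) * (\<epsilon> / M)"
    proof (rule sum_norm_bound)
      fix l assume "l \<in> A"
      then have "\<bar>t - of_int l / L\<bar> \<le> real m / L"
        using sample_distance[OF L] by (simp add: A_def)
      then have "b \<le> norm (of_int l / L)"
        using t unfolding real_norm_def by linarith
      from b[OF this] have fl: "norm (f (of_int l / L)) \<le> \<epsilon>" by simp
      have "\<bar>(?w l)\<bar> \<le> 1 / M"
        using sl M unfolding bspline_window_def M_def[symmetric]
        by (auto simp: unit_bump_def intro!: divide_right_mono)
      then have "\<bar>(?s l)\<bar> * \<bar>(?w l)\<bar> \<le> 1 * (1 / M)"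
        by (intro mult_mono sinc_abs_le_1) auto
      then have "norm (f (of_int l / L)) * (\<bar>(?s l)\<bar> * \<bar>(?w l)\<bar>) \<le> \<epsilon> * (1 * (1 / M))"
        by (rule mult_mono[OF fl]) (use \<epsilon> in auto)
      then show "norm (f (of_int l / L) * of_real ((?s l) * (?w l))) \<le> \<epsilon> / M"
        by (simp only: norm_mult norm_of_real abs_mult mult_1_left times_divide_eq_right mult_1_right)
    qed
    also have "\<dots> \<le> (2 * real m + 1) * (\<epsilon> / M)"
    proof (rule mult_right_mono)
      have "real (card A) \<le> real (2 * m + 1)" using A(2) by (simp only: of_nat_le_iff)
      then show "real (card A) \<le> 2 * real m + 1" by simp
    qed (use \<epsilon> M in simp)
    also have "\<dots> = e * ((2 * real m + 1) / (2 * real m + 2))"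
      using M by (simp add: \<epsilon>_def)
    also have "\<dots> < e * 1"
      using e by (intro mult_strict_left_mono) (auto simp: field_simps)
    finally show ?thesis by simp
  qed
  then show "\<exists>b. \<forall>x. b \<le> norm x \<longrightarrow> dist (?R x) 0 < e"
    by blast
qed

section \<open>The error estimate\<close>

lemma regularized_shannon_error:
  fixes m s :: nat
  assumes f: "f \<in> paley_wiener \<delta>" and \<delta>: "\<delta> \<ge> 0" and L: "L > 0"
    and m: "m \<ge> 2" and s: "s = nat \<lceil>(real m + 1) / 2\<rceil>"
    and \<delta>L: "2 * pi * \<delta> / L \<le> pi - 2"
  shows "cmod (f t - regularized_shannon L m (bspline_window L m s) f t)
    \<le> 3 * sqrt (\<delta> * real s) / ((2 * real s - 1) * pi)
        / (pi * real m * (1 - 2 * \<delta> / L) / (2 * real s)) ^ m * L2_norm f"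
proof (rule paley_wiener_representation[OF f \<delta>])
  fix g
  assume g: "integrable lborel g" "AE v in lborel. v \<notin> {-\<delta>..\<delta>} \<longrightarrow> g v = 0"
    "(LBINT v. cmod (g v)) \<le> sqrt (2 * \<delta>) * L2_norm f"
    "\<And>t. f t = (LBINT v. g v * cis (2 * pi * v * t))"
  have s2: "s \<ge> 2" by (rule half_order_ge_2[OF m s])
  let ?R = "regularized_shannon L m (bspline_window L m s) f"
  define M where "M = bspline (2 * s) 0"
  have M: "M > 0" unfolding M_def by (rule bspline_even_at_0_pos[OF s2])
  define X where "X = (pi - 2 * pi * \<delta> / L) * real m / (2 * real s)"
  have X: "X = pi * real m * (1 - 2 * \<delta> / L) / (2 * real s)"
    by (simp add: X_def algebra_simps)
  have X0: "X > 0"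
    unfolding X_def using \<delta>L m s2 by (intro divide_pos_pos mult_pos_pos) auto
  define A where "A = {l::int. \<bar>L * t - of_int l\<bar> \<le> real m}"
  have A: "finite A" unfolding A_def by (rule finite_card_near_integers)
  define c where "c l = sinc (pi * (L * t - of_int l)) * bspline_window L m s (t - of_int l / L)" for l :: int
  have gi: "integrable lborel (\<lambda>v. g v * cis (2 * pi * v * u))" for u
    by (intro integrable_mult_cis g) simp
  define K where "K v = cis (2 * pi * v * t) - (\<Sum>l\<in>A. of_real (c l) * cis (2 * pi * v * (of_int l / L)))" for v
  define b where "b = 2 / pi * (tail_factor s / ((2 * real s - 1) * X ^ m)) / M"
  have Kb: "cmod (K v) \<le> b" if v: "\<bar>v\<bar> \<le> \<delta>" for v
  proof -
    let ?\<theta> = "2 * pi * v / L"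
    have \<theta>: "\<bar>?\<theta>\<bar> \<le> 2 * pi * \<delta> / L"
      using v L by (simp add: abs_mult divide_right_mono mult_left_mono)
    have e: "?\<theta> * (L * t) = 2 * pi * v * t" "?\<theta> * of_int l = 2 * pi * v * (of_int l / L)" for l :: int
      using L by simp_all
    have w: "bspline_window L m s (t - of_int l / L) = bspline (2 * s) ((L * t - of_int l) * real s / real m) / M" for l :: int
      using L by (simp add: bspline_window_def M_def right_diff_distrib)
    have "of_real M * K v = cis (?\<theta> * (L * t)) * of_real (bspline (2 * s) 0)
      - (\<Sum>l\<in>A. cis (?\<theta> * of_int l) * of_real (sinc (pi * (L * t - of_int l))) * of_real (bspline (2 * s) ((L * t - of_int l) * real s / real m)))"
    proof -
      have "of_real M * (complex_of_real (q * (r / M)) * z) = z * of_real q * of_real r" for q r z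
        using M by simp
      then have cl: "of_real M * (complex_of_real (c l) * z) = z * of_real (sinc (pi * (L * t - of_int l))) * of_real (bspline (2 * s) ((L * t - of_int l) * real s / real m))" for l z
        unfolding c_def w by (simp only:)
      show ?thesis
        unfolding K_def e right_diff_distrib sum_distrib_left
        by (intro arg_cong2[where f="(-)"] sum.cong refl) (rule cl[unfolded right_diff_distrib] | simp only: M_def mult.commute)+
    qed
    then have "cmod (of_real M * K v) \<le> 2 / pi * (tail_factor s / ((2 * real s - 1) * X ^ m))"
      unfolding X_def
      by (simp only:) (rule regularized_shannon_kernel_bound[OF m s \<theta> \<delta>L A], simp add: A_def)
    then have "M * cmod (K v) \<le> 2 / pi * (tail_factor s / ((2 * real s - 1) * X ^ m))"
      using M by (simp add: norm_mult)
    then show ?thesis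
      unfolding b_def pos_le_divide_eq[OF M] by (simp only: mult.commute[of _ M])
  qed
  have "f t - ?R t = f t - (\<Sum>l\<in>A. of_real (c l) * f (of_int l / L))"
    using m s2 by (subst regularized_shannon_eq_sum[OF L _ _ A]) (auto simp: A_def c_def mult.commute)
  also have "\<dots> = (LBINT v. g v * K v)"
  proof -
    have "has_bochner_integral lborel (\<lambda>v. g v * cis (2 * pi * v * t) - (\<Sum>l\<in>A. of_real (c l) * (g v * cis (2 * pi * v * (of_int l / L)))))
        (f t - (\<Sum>l\<in>A. of_real (c l) * f (of_int l / L)))"
      unfolding g(4)
      by (intro has_bochner_integral_diff has_bochner_integral_sum has_bochner_integral_mult_right has_bochner_integral_integrable gi)
    moreover have "g v * cis (2 * pi * v * t) - (\<Sum>l\<in>A. of_real (c l) * (g v * cis (2 * pi * v * (of_int l / L)))) = g v * K v" for v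
      by (simp add: K_def right_diff_distrib sum_distrib_left mult.left_commute)
    ultimately show ?thesis
      by (simp add: has_bochner_integral_iff)
  qed
  finally have "cmod (f t - ?R t) \<le> (LBINT v. cmod (g v * K v))"
    by (simp only: integral_norm_bound)
  also have "\<dots> \<le> (LBINT v. b * cmod (g v))"
  proof (rule integral_mono_AE')
    show "integrable lborel (\<lambda>v. b * cmod (g v))"
      using g(1) by simp
    have "0 \<le> b"
      using Kb[of 0] \<delta> by (auto intro: order_trans[OF norm_ge_zero])
    then show "AE v in lborel. 0 \<le> b * cmod (g v)" by simp
    show "AE v in lborel. cmod (g v * K v) \<le> b * cmod (g v)"
      using g(2)
    proof eventually_elim
      case (elim v)
      show ?case
      proof (cases "\<bar>v\<bar> \<le> \<delta>")
        case True
        then show ?thesis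
          using mult_right_mono[OF Kb[OF True], of "cmod (g v)"] by (simp add: norm_mult mult.commute)
      qed (use elim in auto)
    qed
  qed
  also have "\<dots> = b * (LBINT v. cmod (g v))" by simp
  also have "\<dots> \<le> b * (sqrt (2 * \<delta>) * L2_norm f)"
    using Kb[of 0] \<delta> by (intro mult_left_mono g(3)) (auto intro: order_trans[OF norm_ge_zero])
  also have "\<dots> \<le> 3 * sqrt (\<delta> * real s) / ((2 * real s - 1) * pi) / X ^ m * L2_norm f"
  proof -
    define D where "D = (2 * real s - 1) * pi * X ^ m"
    have D: "D > 0" unfolding D_def using s2 X0 by (intro mult_pos_pos) auto
    have "tail_factor s / M \<le> 3 * sqrt (real s) / (2 * sqrt 2)"
      using bspline_at_0_lower[OF s2] M by (simp add: M_def pos_divide_le_eq)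
    then have "tail_factor s / M * (2 * sqrt 2 * sqrt \<delta> * L2_norm f / D) \<le> 3 * sqrt (real s) / (2 * sqrt 2) * (2 * sqrt 2 * sqrt \<delta> * L2_norm f / D)"
      by (rule mult_right_mono) (use D \<delta> L2_norm_nonneg in auto)
    moreover have "b * (sqrt (2 * \<delta>) * L2_norm f) = tail_factor s / M * (2 * sqrt 2 * sqrt \<delta> * L2_norm f / D)"
      by (simp add: b_def D_def real_sqrt_mult mult_ac)
    moreover have "3 * sqrt (real s) / (2 * sqrt 2) * (2 * sqrt 2 * sqrt \<delta> * L2_norm f / D)
        = 3 * sqrt (\<delta> * real s) / ((2 * real s - 1) * pi) / X ^ m * L2_norm f"
      by (simp add: D_def real_sqrt_mult)
    ultimately show ?thesis by simp
  qed
  finally show ?thesis unfolding X .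
qed

theorem theorem5p3:
  fixes N m s :: nat and \<tau> \<delta> lam L :: real and f :: "real \<Rightarrow> complex"
  assumes "N \<ge> 1"
    and "0 < \<tau>" and "\<tau> < 1/2"
    and "\<delta> = \<tau> * real N"
    and "lam \<ge> 0"
    and "L = real N * (1 + lam)"
    and "m \<ge> 2"
    and "f \<in> paley_wiener \<delta>"
    and "\<tau> / (1 + lam) < 1/2 - 1/pi"
    and "s = nat \<lceil>(real m + 1) / 2\<rceil>"
  shows "(\<lambda>t. f t - regularized_shannon L m (bspline_window L m s) f t) \<in> C0_space \<and>
    C0_norm (\<lambda>t. f t - regularized_shannon L m (bspline_window L m s) f t)
      \<le> 3 * sqrt (\<delta> * real s) / ((2 * real s - 1) * pi)
        * exp (- real m * (ln (pi * real m * (1 + lam - 2 * \<tau>)) - ln (2 * real s * (1 + lam))))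
        * L2_norm f"
proof -
  let ?q = "2 * real s * (1 + lam)"
  let ?p = "pi * real m * (1 + lam - 2 * \<tau>)"
  let ?R = "regularized_shannon L m (bspline_window L m s) f"
  have L: "L > 0" and \<delta>: "\<delta> \<ge> 0"
    using assms by auto
  have s2: "s \<ge> 2" by (rule half_order_ge_2[OF assms(7,10)])
  have \<delta>L: "\<delta> / L = \<tau> / (1 + lam)"
    using assms(1,4,5,6) by simp
  \<comment> \<open>the assumption on \<open>\<tau>\<close>, expressed for the normalized frequency \<open>2 \<pi> \<delta> / L\<close>\<close>
  have freq: "2 * pi * \<delta> / L \<le> pi - 2"
  proof -
    have "2 * pi * (\<tau> / (1 + lam)) \<le> 2 * pi * (1 / 2 - 1 / pi)"
      using assms(9) by (intro mult_left_mono) auto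
    also have "\<dots> = pi - 2" by (simp add: right_diff_distrib)
    finally show ?thesis by (simp only: \<delta>L flip: times_divide_eq_right)
  qed
  define X where "X = pi * real m * (1 - 2 * \<delta> / L) / (2 * real s)"
  have "2 * \<delta> / L = 2 * (\<tau> / (1 + lam))"
    by (simp only: \<delta>L flip: times_divide_eq_right)
  then have "1 - 2 * \<delta> / L = (1 + lam - 2 * \<tau>) / (1 + lam)"
    using assms(5) by (simp add: field_simps)
  then have X: "X = (?p) / (?q)"
    by (simp add: X_def)
  have pos: "?p > 0" "?q > 0"
    using assms(3,5,7) s2 by auto
  then have X0: "X > 0" unfolding X by simp
  have "ln X = ln (?p) - ln (?q)"
    unfolding X using less_imp_neq[OF pos(1), symmetric] less_imp_neq[OF pos(2), symmetric] by (simp only: ln_div if_True simp_thms)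
  then have "exp (- real m * (ln (?p) - ln (?q))) = exp (- (real m * ln X))"
    by (simp only: mult_minus_left)
  also have "\<dots> = 1 / X ^ m"
    using X0 by (simp add: exp_minus exp_of_nat_mult inverse_eq_divide)
  finally have ex: "exp (- real m * (ln (?p) - ln (?q))) = 1 / X ^ m" .
  let ?E = "\<lambda>t. f t - ?R t"
  have "smooth f" using assms(8) by (simp add: paley_wiener_def)
  then have "continuous_on UNIV f"
    by (simp add: continuous_on_eq_continuous_at smooth_isCont)
  moreover have "continuous_on UNIV (?R)"
    using L assms(7) s2 by (intro regularized_shannon_continuous) auto
  ultimately have "continuous_on UNIV ?E"
    by (intro continuous_on_diff)
  moreover have "(?E \<longlongrightarrow> 0) at_infinity"
  proof -
    have f0: "(f \<longlongrightarrow> 0) at_infinity"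
      by (rule paley_wiener_vanishes[OF assms(8) \<delta>])
    have "(?R \<longlongrightarrow> 0) at_infinity"
      using L assms(7) s2 f0 by (intro regularized_shannon_vanishes) auto
    from tendsto_diff[OF f0 this] show ?thesis by simp
  qed
  ultimately have C0: "?E \<in> C0_space"
    by (simp add: C0_space_def)
  have "C0_norm ?E \<le> 3 * sqrt (\<delta> * real s) / ((2 * real s - 1) * pi) / X ^ m * L2_norm f"
    unfolding X_def by (intro C0_norm_le[OF C0] regularized_shannon_error assms(7,8,10) \<delta> L freq)
  then show ?thesis
    using C0 unfolding ex by simp
qed

end
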